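(* Let $0<s<1$, $\lambda\in\mathbb{R}$, and let $\Omega$ be an unbounded domain in $\Sigma_\lambda$. For some sufficiently large $\bar t$, assume that $w_\lambda\in\big(C^{1,1}_{loc}(\Omega)\cap\mathcal{L}_{2s}\big)\times C^1([\bar t,\infty))$ is uniformly bounded and lower semi-continuous in $x$ on $\overline{\Omega}$, and satisfies $$\begin{cases}\dfrac{\partial w_\lambda}{\partial t}(x,t)+(-\Delta)^s w_\lambda(x,t)=c_\lambda(x,t)\,w_\lambda(x,t), & (x,t)\in\Omega\times[\bar t,\infty),\\ w_\lambda(x,t)\ge 0, & (x,t)\in(\Sigma_\lambda\setminus\Omega)\times[\bar t,\infty),\\ w_\lambda(x,t)=-w_\lambda(x^\lambda,t), & (x,t)\in\Sigma_\lambda\times[\bar t,\infty).\end{cases}$$ Further assume that there is a constant $\sigma>0$ such that $c_\lambda(x,t)<-\sigma$ at the points of $\Omega\times[\bar t,\infty)$ where $w_\lambda(x,t)<0$, and that $$\varliminf_{|x|\to\infty}w_\lambda(x,t)\ge 0\quad\text{uniformly for } t\ge\bar t.$$ Then $$\varliminf_{t\to\infty}w_\lambda(x,t)\ge 0\qquad\text{for all }x\in\Omega.$$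
   Context: For $\lambda\in\mathbb{R}$: $T_\lambda=\{x\in\mathbb{R}^N\mid x_1=\lambda\}$, $\Sigma_\lambda=\{x\in\mathbb{R}^N\mid x_1<\lambda\}$, and $x^\lambda=(2\lambda-x_1,x_2,\dots,x_N)$ is the reflection of $x$ about $T_\lambda$. The notation $w\in X\times C^1(I)$ means that $w(\cdot,t)\in X$ for each $t\in I$ and $w(x,\cdot)\in C^1(I)$ for each $x$. The space $\mathcal{L}_{2s}$ consists of functions $w(\cdot,t)\in L^1_{loc}(\mathbb{R}^N)$ with $\int_{\mathbb{R}^N}\frac{|w(x,t)|}{1+|x|^{N+2s}}dx<+\infty$. For each fixed $t$, the fractional Laplacian is $$(-\Delta)^s w(x,t)=C_{N,s}\,\lim_{\varepsilon\to0}\int_{\mathbb{R}^N\setminus B_\varepsilon(x)}\frac{w(x,t)-w(y,t)}{|x-y|^{N+2s}}\,dy,$$ where $C_{N,s}>0$ is the usual normalization constant. *)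

theory Defs
  imports "HOL-Analysis.Analysis"
begin

text \<open>
  The space is \<open>real ^ 'n\<close> with \<open>N = CARD('n)\<close>. The index type carries no distinguished element,
  so the coordinate called \<open>x\<^sub>1\<close> in the mathematics is \<open>x $ k\<close> for an arbitrary index \<open>k\<close>.
\<close>

definition half_space :: "'n::finite \<Rightarrow> real \<Rightarrow> (real ^ 'n) set"
  where "half_space k l = {x. x $ k < l}"

definition reflect :: "'n::finite \<Rightarrow> real \<Rightarrow> real ^ 'n \<Rightarrow> real ^ 'n"
  where "reflect k l x = (\<chi> i. if i = k then 2 * l - x $ k else x $ i)"

definition C11_loc :: "(real ^ 'n::finite) set \<Rightarrow> (real ^ 'n \<Rightarrow> real) \<Rightarrow> bool"
  where "C11_loc S u \<longleftrightarrow>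
    (\<exists>g. (\<forall>x\<in>S. GDERIV u x :> g x) \<and>
         (\<forall>x\<in>S. \<exists>e>0. \<exists>L. L-lipschitz_on (ball x e \<inter> S) g))"

text \<open>One-sided differentiability at end points of \<open>I\<close> that belong to \<open>I\<close>.\<close>

definition C1_on :: "real set \<Rightarrow> (real \<Rightarrow> real) \<Rightarrow> bool"
  where "C1_on I f \<longleftrightarrow>
    (\<exists>f'. (\<forall>t\<in>I. (f has_real_derivative f' t) (at t within I)) \<and> continuous_on I f')"

definition L_2s :: "real \<Rightarrow> (real ^ 'n::finite \<Rightarrow> real) \<Rightarrow> bool"
  where "L_2s s u \<longleftrightarrow>
    (\<forall>K. compact K \<longrightarrow> set_integrable lebesgue K u) \<and>
    integrable lebesgue (\<lambda>x. \<bar>u x\<bar> / (1 + norm x powr (real CARD('n) + 2 * s)))"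

definition lower_semicont_on :: "'a::topological_space set \<Rightarrow> ('a \<Rightarrow> real) \<Rightarrow> bool"
  where "lower_semicont_on S f \<longleftrightarrow>
    (\<forall>x\<in>S. \<forall>r<f x. \<forall>\<^sub>F y in at x within S. r < f y)"

text \<open>
  The normalization for which the fractional Laplacian has Fourier symbol \<open>\<bar>\<xi>\<bar>\<close> to the power
  \<open>2 * s\<close>; it equals the reciprocal of the integral of
  \<open>(1 - cos (\<zeta> $ k)) / norm \<zeta> powr (N + 2 * s)\<close> over the whole space.
\<close>

definition frac_const :: "nat \<Rightarrow> real \<Rightarrow> real"
  where "frac_const N s =
    4 powr s * Gamma (real N / 2 + s) / (pi powr (real N / 2) * \<bar>Gamma (- s)\<bar>)"

text \<open>
  \<open>Lim\<close> is meaningful only where the limit exists; it does at every \<open>x\<close> in an open set \<open>S\<close> if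
  \<open>C11_loc S u\<close>, \<open>L_2s s u\<close> and \<open>0 < s < 1\<close>.
\<close>

definition frac_laplacian :: "real \<Rightarrow> (real ^ 'n::finite \<Rightarrow> real) \<Rightarrow> real ^ 'n \<Rightarrow> real"
  where "frac_laplacian s u x =
    frac_const CARD('n) s *
    Lim (at_right 0) (\<lambda>\<epsilon>. LINT y:- ball x \<epsilon>|lebesgue.
      (u x - u y) / norm (x - y) powr (real CARD('n) + 2 * s))"

end

theory Submission
  imports Defs
begin

text \<open>
  Write \<open>N = CARD('n)\<close>, \<open>\<Sigma>\<close> for the half space and \<open>v = max 0 (- w)\<close> for the negative part of \<open>w\<close>.
  The claim says that \<open>v\<close> tends to \<open>0\<close> at the points of \<open>\<Omega>\<close>; the proof gives this uniformly on \<open>\<Sigma>\<close>.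

  \<^emph>\<open>Maximum principle.\<close> Let \<open>h\<close> be nonnegative on \<open>\<Sigma>\<close>, and extend it beyond the hyperplane either by
  nonnegative values or antisymmetrically. Suppose that \<open>v - h\<close> has a positive maximum
  over \<open>\<Sigma>\<close> at the point \<open>x\<close> at time \<open>t\<close>. By antisymmetry the values of \<open>w\<close> beyond the
  hyperplane are controlled by those in \<open>\<Sigma>\<close>, and a reflected point has less weight in the kernel
  than the point itself. Hence the fractional Laplacian of \<open>w\<close> at \<open>x\<close> is at most that of \<open>- h\<close>, and
  the equation and \<open>c < - \<sigma>\<close> give \<open>\<partial>\<^sub>t v < - (-\<Delta>)\<^sup>s h - \<sigma> v\<close> there. If \<open>h\<close> is a supersolution, then
  \<open>v - h\<close> decreases in time at \<open>x\<close>, and this excludes that \<open>v\<close> ever exceeds \<open>h\<close>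
  (\<open>frac_laplacian_at_touching_point\<close>, \<open>decrease_at_touching_point\<close>, \<open>right_usc_comparison\<close>).

  \<^emph>\<open>The barrier.\<close> Suppose that \<open>v \<le> m\<close> from time \<open>t0\<close> on. The barrier is \<open>\<Theta> t * (1 + \<beta> * q)\<close>, where
  \<open>\<Theta>\<close> decreases exponentially from \<open>m\<close> to \<open>m / (1 + \<beta> / 4)\<close> and \<open>q\<close> is a bump in a thin strip
  along the hyperplane. The bump is needed because nothing is assumed about \<open>w\<close> on the hyperplane:
  it lifts the barrier above \<open>m\<close> close to it. It can be afforded because a positive constant on \<open>\<Sigma>\<close>,
  extended antisymmetrically, has a fractional Laplacian of order \<open>d\<close> to the power \<open>- 2 * s\<close> at distance
  \<open>d\<close> from the hyperplane; this beats the bump for a small \<open>\<beta>\<close> that depends on \<open>N\<close> and \<open>s\<close> only, whatever the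
  width of the strip (\<open>barrier_constant\<close>). So \<open>v\<close> is multiplied by a fixed factor
  below \<open>1\<close> in bounded time, and iteration finishes the proof
  (\<open>improved_bound\<close>, \<open>negative_part_vanishes\<close>).

  \<^emph>\<open>Regularity.\<close> The comparison needs a maximum of \<open>v - h\<close> that cannot jump up immediately after some
  time, but \<open>v\<close> is only known to be continuous in \<open>x\<close> for each \<open>t\<close> and in \<open>t\<close> for each \<open>x\<close>. A
  narrow spike of \<open>v\<close> could emerge from a point at some time, moving so that every fixed point sees a
  continuous function of time. Two arguments exclude this.

  The first concerns a ball that is free of such events on a time interval open to the left. As the time decreases
  to the left end, \<open>v\<close> converges pointwise, hence by dominated convergence the mass of the part of \<open>v\<close> that
  exceeds the supremum of the limit tends to \<open>0\<close>. The fractional diffusion turns small mass into small supremum after any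
  positive time, so no spike is left (\<open>no_spike_emergence\<close>). The diffusion is realized by iterated
  averages over jumps (\<open>jump_avg\<close>), whose properties are elementary, instead of the fractional heat
  kernel.

  The second is a Baire category argument. If the set of spike points is nonempty, then some portion of its
  closure consists of points with uniform Lipschitz bounds in time and in space. The time at
  which a spike appears near this portion is preceded by a last time at which the closure meets a small ball. At that time the
  uniform bounds make \<open>v\<close> small on a ball, and the first argument then excludes the spike
  (\<open>no_spikes\<close>).
\<close>

section \<open>The kernel of the fractional Laplacian\<close>

definition kernel :: "real \<Rightarrow> real ^ 'n::finite \<Rightarrow> real"
  where "kernel s z = 1 / norm z powr (real CARD('n) + 2 * s)"

lemma kernel_nonneg [simp]: "0 \<le> kernel s z"
  by (simp add: kernel_def)

lemma kernel_uminus [simp]: "kernel s (- z) = kernel s z"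
  by (simp add: kernel_def)

lemma borel_measurable_kernel [measurable]: "kernel s \<in> borel_measurable borel"
  unfolding kernel_def [abs_def] by measurable

lemma kernel_antimono:
  fixes a b :: "real ^ 'n::finite"
  assumes "0 < s" "0 < norm a" "norm a \<le> norm b"
  shows "kernel s b \<le> kernel s a"
  using assms unfolding kernel_def
  by (intro divide_left_mono powr_mono2 mult_pos_pos) auto

text \<open>
  A substitute for polar coordinates: a function that is at most \<open>a j\<close> on the \<open>j\<close>-th of countably many
  balls covering its support has an integral of at most the sum of \<open>a j\<close> times their volumes. With dyadic
  radii this is sharp, up to constants, for powers of the norm.
\<close>

lemma integral_le_shells:
  fixes F :: "real ^ 'n::finite \<Rightarrow> real" and a \<rho> :: "nat \<Rightarrow> real"
  assumes F [measurable]: "F \<in> borel_measurable borel" and F0: "\<And>z. 0 \<le> F z"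
    and a: "\<And>j. 0 \<le> a j" and \<rho>: "\<And>j. 0 \<le> \<rho> j"
    and le: "\<And>z. F z \<noteq> 0 \<Longrightarrow> \<exists>j. norm z \<le> \<rho> j \<and> F z \<le> a j"
    and sums: "(\<lambda>j. a j * (unit_ball_vol (real CARD('n)) * \<rho> j ^ CARD('n))) sums S"
  shows "integrable lborel F" "(LINT z|lborel. F z) \<le> S"
proof -
  let ?V = "\<lambda>j. unit_ball_vol (real CARD('n)) * \<rho> j ^ CARD('n)"
  have V0: "0 \<le> ?V j" for j
    using \<rho> by auto
  have S0: "0 \<le> S"
    using sums_le [OF _ sums_zero sums] a V0 by simp
  have "(\<integral>\<^sup>+z. ennreal (F z) \<partial>lborel)
      \<le> (\<integral>\<^sup>+z. (\<Sum>j. ennreal (a j) * indicator (cball (0::real ^ 'n) (\<rho> j)) z) \<partial>lborel)"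
  proof (rule nn_integral_mono)
    fix z :: "real ^ 'n"
    show "ennreal (F z) \<le> (\<Sum>j. ennreal (a j) * indicator (cball 0 (\<rho> j)) z)"
    proof (cases "F z = 0")
      case False
      then obtain j where j: "norm z \<le> \<rho> j" "F z \<le> a j"
        using le by blast
      have "ennreal (F z) \<le> ennreal (a j) * indicator (cball 0 (\<rho> j)) z"
        using j by (auto simp: ennreal_leI)
      also have "\<dots> \<le> (\<Sum>j. ennreal (a j) * indicator (cball 0 (\<rho> j)) z)"
        using sum_le_suminf [of "\<lambda>j. ennreal (a j) * indicator (cball 0 (\<rho> j)) z" "{j}"]
        by (simp del: indicator_simps sum_mult_indicator)
      finally show ?thesis .
    qed auto
  qed
  also have "\<dots> = (\<Sum>j. (\<integral>\<^sup>+z. ennreal (a j) * indicator (cball (0::real ^ 'n) (\<rho> j)) z \<partial>lborel))"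
    by (intro nn_integral_suminf borel_measurable_times_ennreal borel_measurable_indicator) auto
  also have "\<dots> = (\<Sum>j. ennreal (a j * ?V j))"
    by (intro suminf_cong)
      (use \<rho> a in \<open>auto simp: nn_integral_cmult_indicator emeasure_cball ennreal_mult\<close>)
  also have "\<dots> = ennreal S"
    by (rule suminf_ennreal_eq) (use a V0 sums in auto)
  finally have *: "(\<integral>\<^sup>+z. ennreal (F z) \<partial>lborel) \<le> ennreal S" .
  show "integrable lborel F"
    using * F0 by (intro integrableI_bounded) (auto simp: le_less_trans)
  then have "ennreal (LINT z|lborel. F z) = (\<integral>\<^sup>+z. ennreal (F z) \<partial>lborel)"
    by (intro nn_integral_eq_integral [symmetric]) (use F0 in auto)
  with * S0 show "(LINT z|lborel. F z) \<le> S"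
    by (metis ennreal_le_iff)
qed

text \<open>
  The dyadic shell of inner radius \<open>2 ^ j * r\<close> contributes a constant times \<open>(2 ^ j * r) powr (- 2 * s)\<close>, so the
  shells form a geometric series.
\<close>

lemma kernel_tail_bound:
  assumes s: "0 < s"
  obtains c where "0 \<le> c"
    "\<And>r. 0 < r \<Longrightarrow> integrable lborel (\<lambda>z::real ^ 'n::finite. indicator (- ball 0 r) z * kernel s z)"
    "\<And>r. 0 < r \<Longrightarrow> (LINT z::real ^ 'n|lborel. indicator (- ball 0 r) z * kernel s z) \<le> c * r powr (- 2 * s)"
proof -
  define N where "N = CARD('n)"
  define V where "V = unit_ball_vol (real N)"
  define p where "p = real N + 2 * s"
  define q where "q = 2 powr (- 2 * s)"
  have q: "0 < q" "q < 1"
    using s powr_less_mono [of "- 2 * s" 0 2] by (auto simp: q_def)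
  define c where "c = V * 2 ^ N * (1 / (1 - q))"
  have V0: "0 \<le> V"
    by (auto simp: V_def)
  have c: "0 \<le> c"
    using q V0 by (auto simp: c_def)
  have main: "integrable lborel (\<lambda>z::real ^ 'n. indicator (- ball 0 r) z * kernel s z)
      \<and> (LINT z::real ^ 'n|lborel. indicator (- ball 0 r) z * kernel s z) \<le> c * r powr (- 2 * s)"
    if r: "0 < r" for r
  proof -
    define a where "a j = (2 ^ j * r) powr (- p)" for j :: nat
    define \<rho> where "\<rho> j = 2 ^ Suc j * r" for j :: nat
    have eq: "a j * (V * \<rho> j ^ N) = (V * 2 ^ N * r powr (- 2 * s)) * q ^ j" for j
    proof -
      have "\<rho> j ^ N = 2 ^ N * (2 ^ j * r) powr (real N)"
        using r by (simp add: \<rho>_def powr_realpow power_mult_distrib)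
      then have "a j * (V * \<rho> j ^ N) = V * 2 ^ N * ((2 ^ j * r) powr (- p) * (2 ^ j * r) powr (real N))"
        by (simp add: a_def)
      also have "(2 ^ j * r) powr (- p) * (2 ^ j * r) powr (real N) = (2 ^ j * r) powr (- 2 * s)"
        by (simp add: p_def flip: powr_add)
      also have "\<dots> = q ^ j * r powr (- 2 * s)"
        using r by (simp add: q_def powr_mult powr_powr mult.commute flip: powr_realpow)
      finally show ?thesis
        by (simp add: mult_ac)
    qed
    have sums: "(\<lambda>j. a j * (V * \<rho> j ^ N)) sums (c * r powr (- 2 * s))"
    proof -
      have "(\<lambda>j. (V * 2 ^ N * r powr (- 2 * s)) * q ^ j) sums ((V * 2 ^ N * r powr (- 2 * s)) * (1 / (1 - q)))"
        using q by (intro sums_mult geometric_sums) auto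
      then show ?thesis
        unfolding eq by (simp add: c_def mult_ac)
    qed
    have le: "\<exists>j. norm z \<le> \<rho> j \<and> indicator (- ball 0 r) z * kernel s z \<le> a j"
      if "indicator (- ball 0 r) z * kernel s z \<noteq> 0" for z :: "real ^ 'n"
    proof -
      have "r \<le> norm z"
        using that by (auto simp: indicator_def split: if_splits)
      then have z: "r \<le> norm z" "0 < norm z"
        using r by linarith+
      \<comment> \<open>The dyadic shell that contains the point.\<close>
      define j where "j = nat \<lfloor>log 2 (norm z / r)\<rfloor>"
      have l0: "0 \<le> log 2 (norm z / r)"
        using z r by (subst zero_le_log_cancel_iff) auto
      have "real j \<le> log 2 (norm z / r)" "log 2 (norm z / r) < real j + 1"
        using l0 unfolding j_def by linarith+
      then have "2 powr (real j) \<le> norm z / r" "norm z / r \<le> 2 powr (real j + 1)"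
        using z r by (auto simp: le_log_iff less_imp_le log_less_iff)
      then have j: "2 ^ j * r \<le> norm z" "norm z \<le> \<rho> j"
        using r by (auto simp: \<rho>_def field_simps powr_realpow powr_add)
      have "kernel s z = norm z powr (- p)"
        by (simp add: kernel_def p_def N_def powr_minus_divide del: minus_add_distrib)
      also have "\<dots> \<le> a j"
        unfolding a_def using j r s by (intro powr_mono2') (auto simp: p_def)
      finally show ?thesis
        using j by (auto simp: indicator_def intro!: exI [of _ j] simp: a_def)
    qed
    have *: "(\<lambda>z::real ^ 'n. indicator (- ball 0 r) z * kernel s z) \<in> borel_measurable borel"
      by measurable
    show ?thesis
      using integral_le_shells [OF * _ _ _ le, of "c * r powr (- 2 * s)"] r sums
      by (auto simp: a_def \<rho>_def N_def V_def)
  qed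
  show ?thesis
    using that [OF c] main by blast
qed

text \<open>
  The factor \<open>(norm z)\<^sup>2\<close>, which comes from second differences, turns the exponent of the shells into
  \<open>2 - 2 * s > 0\<close>; hence the series over shrinking shells converges.
\<close>

lemma kernel_near_bound:
  assumes s: "s < 1" "0 < s"
  obtains c where "0 \<le> c"
    "\<And>r. 0 < r \<Longrightarrow> integrable lborel (\<lambda>z::real ^ 'n::finite. indicator (ball 0 r) z * ((norm z)\<^sup>2 * kernel s z))"
    "\<And>r. 0 < r \<Longrightarrow> (LINT z::real ^ 'n|lborel. indicator (ball 0 r) z * ((norm z)\<^sup>2 * kernel s z)) \<le> c * r powr (2 - 2 * s)"
proof -
  define N where "N = CARD('n)"
  define V where "V = unit_ball_vol (real N)"
  define p where "p = real N + 2 * s"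
  define q where "q = 2 powr (2 * s - 2)"
  have q: "0 < q" "q < 1"
    using s powr_less_mono [of "2 * s - 2" 0 2] by (auto simp: q_def)
  define c where "c = V * 2 powr p * (1 / (1 - q))"
  have V0: "0 \<le> V"
    by (auto simp: V_def)
  have c: "0 \<le> c"
    using q V0 by (auto simp: c_def)
  have main: "integrable lborel (\<lambda>z::real ^ 'n. indicator (ball 0 r) z * ((norm z)\<^sup>2 * kernel s z))
      \<and> (LINT z::real ^ 'n|lborel. indicator (ball 0 r) z * ((norm z)\<^sup>2 * kernel s z)) \<le> c * r powr (2 - 2 * s)"
    if r: "0 < r" for r
  proof -
    define \<rho> where "\<rho> j = r / 2 ^ j" for j :: nat
    define a where "a j = (\<rho> j)\<^sup>2 * (\<rho> j / 2) powr (- p)" for j :: nat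
    have \<rho>0: "0 < \<rho> j" for j
      using r by (simp add: \<rho>_def)
    have eq: "a j * (V * \<rho> j ^ N) = (V * 2 powr p * r powr (2 - 2 * s)) * q ^ j" for j
    proof -
      have "a j * (V * \<rho> j ^ N) = V * 2 powr p * (\<rho> j powr 2 * \<rho> j powr (- p) * \<rho> j powr (real N))"
      proof -
        have "(\<rho> j / 2) powr (- p) = 2 powr p * \<rho> j powr (- p)"
          using \<rho>0 [of j] powr_divide [of "\<rho> j" 2 "- p"] powr_minus_divide [of 2 p] by simp
        moreover have "\<rho> j powr 2 = (\<rho> j)\<^sup>2" "\<rho> j powr (real N) = \<rho> j ^ N"
          using \<rho>0 [of j] by (auto simp: powr_realpow)
        ultimately show ?thesis
          by (simp only: a_def mult_ac)
      qed
      also have "\<rho> j powr 2 * \<rho> j powr (- p) * \<rho> j powr (real N) = \<rho> j powr (2 - 2 * s)"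
        by (simp add: p_def flip: powr_add)
      also have "\<dots> = q ^ j * r powr (2 - 2 * s)"
      proof -
        have "\<rho> j = r * 2 powr (- real j)"
          using r by (simp add: \<rho>_def powr_minus powr_realpow field_simps)
        then show ?thesis
          using r by (simp add: powr_mult powr_powr q_def algebra_simps flip: powr_realpow)
      qed
      finally show ?thesis
        by (simp add: mult_ac)
    qed
    have sums: "(\<lambda>j. a j * (V * \<rho> j ^ N)) sums (c * r powr (2 - 2 * s))"
    proof -
      have "(\<lambda>j. (V * 2 powr p * r powr (2 - 2 * s)) * q ^ j) sums ((V * 2 powr p * r powr (2 - 2 * s)) * (1 / (1 - q)))"
        using q by (intro sums_mult geometric_sums) auto
      then show ?thesis
        unfolding eq by (simp add: c_def mult_ac)
    qed
    have le: "\<exists>j. norm z \<le> \<rho> j \<and> indicator (ball 0 r) z * ((norm z)\<^sup>2 * kernel s z) \<le> a j"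
      if "indicator (ball 0 r) z * ((norm z)\<^sup>2 * kernel s z) \<noteq> 0" for z :: "real ^ 'n"
    proof -
      have z: "norm z < r" "0 < norm z"
        using that by (auto simp: indicator_def split: if_splits)
      define j where "j = nat \<lfloor>log 2 (r / norm z)\<rfloor>"
      have l0: "0 \<le> log 2 (r / norm z)"
        using z r by simp
      have "real j \<le> log 2 (r / norm z)" "log 2 (r / norm z) < real j + 1"
        using l0 unfolding j_def by linarith+
      then have "2 powr (real j) \<le> r / norm z" "r / norm z \<le> 2 powr (real j + 1)"
        using z r by (auto simp: le_log_iff less_imp_le log_less_iff)
      then have j: "norm z \<le> \<rho> j" "\<rho> j / 2 \<le> norm z"
        using r z by (auto simp: \<rho>_def field_simps powr_realpow powr_add)
      have "kernel s z = norm z powr (- p)"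
        by (simp add: kernel_def p_def N_def powr_minus_divide del: minus_add_distrib)
      also have "\<dots> \<le> (\<rho> j / 2) powr (- p)"
        using j \<rho>0 [of j] s by (intro powr_mono2') (auto simp: p_def)
      finally have "(norm z)\<^sup>2 * kernel s z \<le> a j"
        unfolding a_def using j \<rho>0 [of j] z by (intro mult_mono power_mono) auto
      then show ?thesis
        using j z by (auto simp: indicator_def)
    qed
    have *: "(\<lambda>z::real ^ 'n. indicator (ball 0 r) z * ((norm z)\<^sup>2 * kernel s z)) \<in> borel_measurable borel"
      by (intro borel_measurable_times borel_measurable_indicator borel_measurable_power
          borel_measurable_norm borel_measurable_kernel) auto
    show ?thesis
      using integral_le_shells [OF * _ _ _ le, of "c * r powr (2 - 2 * s)"] r sums \<rho>0
      by (auto simp: a_def N_def V_def less_imp_le)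
  qed
  show ?thesis
    using that [OF c] main by blast
qed

text \<open>
  The ball of radius \<open>d\<close> around the point \<open>axis k (2 * d)\<close> lies in the half space \<open>{z. d \<le> z $ k}\<close> and in the ball of
  radius \<open>3 * d\<close> around the origin; the latter bounds the kernel from below.
\<close>

lemma kernel_half_space_bound:
  fixes k :: "'n::finite"
  assumes s: "0 < s"
  obtains c where "0 < c"
    "\<And>d. 0 < d \<Longrightarrow> c * d powr (- 2 * s) \<le> (LINT z::real ^ 'n|lborel. indicator {z. d \<le> z $ k} z * kernel s z)"
proof -
  define N where "N = CARD('n)"
  define V where "V = unit_ball_vol (real N)"
  define p where "p = real N + 2 * s"
  have V: "0 < V"
    by (auto simp: V_def)
  have p: "0 < p"
    using s by (simp add: p_def)
  obtain c1 where c1: "\<And>r. 0 < r \<Longrightarrow> integrable lborel (\<lambda>z::real ^ 'n. indicator (- ball 0 r) z * kernel s z)"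
    using kernel_tail_bound [OF s] by metis
  define c where "c = V * 3 powr (- p)"
  have main: "c * d powr (- 2 * s) \<le> (LINT z::real ^ 'n|lborel. indicator {z. d \<le> z $ k} z * kernel s z)"
    if d: "0 < d" for d
  proof -
    define e :: "real ^ 'n" where "e = axis k (2 * d)"
    have ne: "norm e = 2 * d"
      using d by (simp add: e_def norm_eq_sqrt_inner inner_axis_axis real_sqrt_mult)
    have in_ball: "norm z \<le> 3 * d \<and> d \<le> z $ k" if "z \<in> ball e d" for z
    proof -
      have dz: "norm (z - e) < d"
        using that by (simp add: dist_norm norm_minus_commute)
      have "\<bar>(z - e) $ k\<bar> \<le> norm (z - e)"
        by (rule component_le_norm_cart)
      moreover have "e $ k = 2 * d"
        by (simp add: e_def axis_def)
      moreover have "norm z \<le> norm (z - e) + norm e"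
        using norm_triangle_ineq [of "z - e" e] by simp
      ultimately show ?thesis
        using dz ne by auto
    qed
    have int: "integrable lborel (\<lambda>z::real ^ 'n. indicator {z. d \<le> z $ k} z * kernel s z)"
    proof (rule Bochner_Integration.integrable_bound [OF c1 [OF d]])
      show "AE z::real ^ 'n in lborel. norm (indicator {z. d \<le> z $ k} z * kernel s z)
          \<le> norm (indicator (- ball 0 d) z * kernel s z)"
      proof (intro always_eventually allI)
        fix z :: "real ^ 'n"
        show "norm (indicator {z. d \<le> z $ k} z * kernel s z) \<le> norm (indicator (- ball 0 d) z * kernel s z)"
          using component_le_norm_cart [of z k] by (auto simp: indicator_def)
      qed
    qed measurable
    have "c * d powr (- 2 * s) = (3 * d) powr (- p) * (V * d ^ N)"
    proof -
      have "d powr (- 2 * s) = d powr (- p) * d powr (real N)"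
        by (simp add: p_def flip: powr_add)
      then show ?thesis
        using d by (simp add: c_def powr_mult powr_realpow)
    qed
    also have "\<dots> = (3 * d) powr (- p) * measure lborel (ball e d)"
      using d by (simp add: content_ball V_def N_def)
    also have "\<dots> = (LINT z|lborel. (3 * d) powr (- p) * indicator (ball e d) z)"
      by simp
    also have "\<dots> \<le> (LINT z::real ^ 'n|lborel. indicator {z. d \<le> z $ k} z * kernel s z)"
    proof (rule integral_mono [OF _ int])
      show "integrable lborel (\<lambda>z. (3 * d) powr (- p) * indicator (ball e d) z)"
        by (intro integrable_mult_right integrable_real_indicator)
          (use d in \<open>auto simp: emeasure_ball\<close>)
      fix z :: "real ^ 'n"
      show "(3 * d) powr (- p) * indicator (ball e d) z \<le> indicator {z. d \<le> z $ k} z * kernel s z"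
      proof (cases "z \<in> ball e d")
        case True
        then have z: "norm z \<le> 3 * d" "d \<le> z $ k"
          using in_ball by auto
        then have "0 < norm z"
          using component_le_norm_cart [of z k] d by linarith
        then have "(3 * d) powr (- p) \<le> norm z powr (- p)"
          using z p d by (intro powr_mono2') auto
        also have "\<dots> = kernel s z"
          by (simp add: kernel_def p_def N_def powr_minus_divide del: minus_add_distrib)
        finally show ?thesis
          using z True by simp
      qed auto
    qed
    finally show ?thesis .
  qed
  have "0 < c"
    using V by (simp add: c_def)
  then show ?thesis
    using that main by blast
qed

section \<open>Affine maps that preserve Lebesgue measure\<close>

definition lebesgue_preserving :: "('a::euclidean_space \<Rightarrow> 'a) \<Rightarrow> bool"
  where "lebesgue_preserving T \<longleftrightarrow> T \<in> lebesgue \<rightarrow>\<^sub>M lebesgue \<and> distr lebesgue lebesgue T = lebesgue"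

lemma lebesgue_preserving_integral:
  fixes f :: "'a::euclidean_space \<Rightarrow> real"
  assumes "lebesgue_preserving T" "f \<in> borel_measurable lebesgue"
  shows "(LINT x|lebesgue. f (T x)) = (LINT x|lebesgue. f x)"
  using assms integral_distr [of T lebesgue lebesgue f] by (simp add: lebesgue_preserving_def)

lemma lebesgue_preserving_measurable:
  fixes f :: "'a::euclidean_space \<Rightarrow> real"
  assumes "lebesgue_preserving T" "f \<in> borel_measurable lebesgue"
  shows "(\<lambda>x. f (T x)) \<in> borel_measurable lebesgue"
  using assms measurable_compose [of T lebesgue lebesgue f borel] by (simp add: lebesgue_preserving_def)

lemma lebesgue_preserving_integrable:
  fixes f :: "'a::euclidean_space \<Rightarrow> real"
  assumes "lebesgue_preserving T" "integrable lebesgue f"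
  shows "integrable lebesgue (\<lambda>x. f (T x))"
  using assms integrable_distr [of T lebesgue lebesgue f] by (simp add: lebesgue_preserving_def)

lemma lebesgue_preserving_affine:
  fixes T :: "'a::euclidean_space \<Rightarrow> 'a"
  assumes c: "\<And>j. j \<in> Basis \<Longrightarrow> \<bar>c j\<bar> = (1::real)"
    and T: "\<And>x. T x = t + (\<Sum>j\<in>Basis. (c j * (x \<bullet> j)) *\<^sub>R j)"
  shows "lebesgue_preserving T"
proof -
  have c0: "\<And>j. j \<in> Basis \<Longrightarrow> c j \<noteq> 0"
    using c by force
  have T': "T = (\<lambda>x. t + (\<Sum>j\<in>Basis. (c j * (x \<bullet> j)) *\<^sub>R j))"
    using T by auto
  have "(\<Prod>j\<in>Basis. \<bar>c j\<bar>) = 1"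
    using c by simp
  then have "lebesgue = density (distr lebesgue lebesgue T) (\<lambda>_. 1)"
    using lebesgue_affine_euclidean [of c t] c0 unfolding T' by simp
  then have "distr lebesgue lebesgue T = lebesgue"
    by (simp add: density_1)
  then show ?thesis
    using lebesgue_affine_measurable [of c t] c0 unfolding lebesgue_preserving_def T' by simp
qed

lemma lebesgue_preserving_translation: "lebesgue_preserving (\<lambda>x. a + x)"
  by (rule lebesgue_preserving_affine [of "\<lambda>_. 1" _ a]) (auto simp: euclidean_representation)

lemma lebesgue_preserving_point_reflection: "lebesgue_preserving (\<lambda>x. a - x)"
proof (rule lebesgue_preserving_affine [of "\<lambda>_. - 1" _ a])
  show "a - x = a + (\<Sum>j\<in>Basis. (- 1 * (x \<bullet> j)) *\<^sub>R j)" for x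
    using euclidean_representation [of x] by (simp add: sum_negf)
qed auto

lemma lebesgue_preserving_reflect: "lebesgue_preserving (reflect k l :: real ^ 'n::finite \<Rightarrow> real ^ 'n)"
proof (rule lebesgue_preserving_affine [of "\<lambda>j. if j = axis k 1 then - 1 else 1" _ "axis k (2 * l)"])
  fix x :: "real ^ 'n"
  have "(\<Sum>j\<in>Basis. ((if j = axis k 1 then - 1 else 1) * (x \<bullet> j)) *\<^sub>R j)
      = (\<Sum>i\<in>UNIV. ((if i = k then - 1 else 1) * x $ i) *\<^sub>R axis i (1::real))"
  proof -
    have B: "Basis = (\<lambda>i::'n. axis i (1::real)) ` UNIV"
      by (auto simp: Basis_vec_def)
    show ?thesis
      unfolding B by (subst sum.reindex) (auto simp: inj_on_def axis_eq_axis inner_axis)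
  qed
  also have "\<dots> = (\<Sum>i\<in>UNIV. (\<chi> i. (if i = k then - 1 else 1) * x $ i) $ i *s axis i (1::real))"
    by (simp add: scalar_mult_eq_scaleR)
  also have "\<dots> = (\<chi> i. (if i = k then - 1 else 1) * x $ i)"
    by (rule basis_expansion)
  finally have eq: "(\<Sum>j\<in>Basis. ((if j = axis k 1 then - 1 else 1) * (x \<bullet> j)) *\<^sub>R j)
      = (\<chi> i. (if i = k then - 1 else 1) * x $ i)" .
  show "reflect k l x = axis k (2 * l) + (\<Sum>j\<in>Basis. ((if j = axis k 1 then - 1 else 1) * (x \<bullet> j)) *\<^sub>R j)"
    unfolding eq by (auto simp: vec_eq_iff reflect_def axis_def)
qed auto

lemma reflect_nth [simp]: "reflect k l x $ k = 2 * l - x $ k"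
  by (simp add: reflect_def)

lemma norm_diff_le_reflect:
  fixes x y :: "real ^ 'n::finite"
  assumes "x $ k < l" "y $ k < l"
  shows "norm (x - y) \<le> norm (x - reflect k l y)" "l - x $ k \<le> norm (x - reflect k l y)"
proof -
  show "norm (x - y) \<le> norm (x - reflect k l y)"
    by (rule norm_le_componentwise_cart) (use assms in \<open>auto simp: reflect_def\<close>)
  show "l - x $ k \<le> norm (x - reflect k l y)"
    using component_le_norm_cart [of "x - reflect k l y" k] assms by auto
qed

section \<open>Truncated diffusion and the fractional Laplacian\<close>

text \<open>
  What it takes to integrate \<open>u\<close> against the kernel away from its pole. Functions in \<open>L_2s\<close> and bounded measurable
  functions have this property, so that the solution and the barriers can be treated alike.
\<close>

definition tail_integrable :: "real \<Rightarrow> (real ^ 'n::finite \<Rightarrow> real) \<Rightarrow> bool"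
  where "tail_integrable s u \<longleftrightarrow> u \<in> borel_measurable lebesgue
    \<and> (\<forall>x r. integrable lebesgue (\<lambda>y. indicator (ball x r) y * u y))
    \<and> (\<forall>x r. 0 < r \<longrightarrow> integrable lebesgue (\<lambda>y. indicator (- ball x r) y * (u y * kernel s (x - y))))"

text \<open>
  The integral in the fractional Laplacian before the limit, with the sign of the Laplacian and without the
  normalizing constant.
\<close>

definition trunc_diffusion :: "real \<Rightarrow> (real ^ 'n::finite \<Rightarrow> real) \<Rightarrow> real ^ 'n \<Rightarrow> real \<Rightarrow> real"
  where "trunc_diffusion s u x \<epsilon> =
    (LINT y|lebesgue. indicator (- ball x \<epsilon>) y * ((u y - u x) * kernel s (x - y)))"

definition second_diff :: "('a::real_vector \<Rightarrow> real) \<Rightarrow> 'a \<Rightarrow> 'a \<Rightarrow> real"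
  where "second_diff u x z = u (x + z) + u (x - z) - 2 * u x"

lemma lebesgue_measurable_kernel [measurable]: "(\<lambda>y. kernel s (x - y)) \<in> borel_measurable lebesgue"
proof -
  have "(\<lambda>y. kernel s (x - y)) \<in> borel_measurable borel"
    by measurable
  then show ?thesis
    by (simp add: measurable_completion)
qed

lemma kernel_tail_integrable_lebesgue:
  fixes x :: "real ^ 'n::finite"
  assumes "0 < s" "0 < r"
  shows "integrable lebesgue (\<lambda>y. indicator (- ball x r) y * kernel s (x - y))"
proof -
  obtain c where "integrable lborel (\<lambda>z::real ^ 'n. indicator (- ball 0 r) z * kernel s z)"
    using kernel_tail_bound [OF assms(1)] assms(2) by metis
  then have "integrable lebesgue (\<lambda>z::real ^ 'n. indicator (- ball 0 r) z * kernel s z)"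
    by (subst integrable_completion) auto
  from lebesgue_preserving_integrable [OF lebesgue_preserving_point_reflection this, of x]
  show ?thesis
    by (rule back_subst [where P = "integrable lebesgue"])
      (auto simp: indicator_def dist_norm fun_eq_iff norm_minus_commute)
qed

lemma tail_integrable_bounded:
  fixes u :: "real ^ 'n::finite \<Rightarrow> real"
  assumes s: "0 < s" and u [measurable]: "u \<in> borel_measurable lebesgue" and B: "\<And>x. \<bar>u x\<bar> \<le> B"
  shows "tail_integrable s u"
  unfolding tail_integrable_def
proof (intro conjI allI impI)
  have B0: "0 \<le> B"
    using B [of 0] by linarith
  fix x :: "real ^ 'n" and r :: real
  have "emeasure lborel (ball x r) < \<infinity>"
    by (rule emeasure_lborel_ball_finite)
  then have "integrable lebesgue (\<lambda>y. B * indicator (ball x r) y)"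
    by (intro integrable_mult_right integrable_real_indicator) auto
  then show "integrable lebesgue (\<lambda>y. indicator (ball x r) y * u y)"
  proof (rule Bochner_Integration.integrable_bound)
    show "(\<lambda>y. indicator (ball x r) y * u y) \<in> borel_measurable lebesgue"
      by (intro borel_measurable_times borel_measurable_indicator u) auto
  qed (use B B0 in \<open>auto simp: indicator_def\<close>)
next
  fix x :: "real ^ 'n" and r :: real
  assume "0 < r"
  from integrable_mult_right [OF kernel_tail_integrable_lebesgue [OF s this, of x], of B]
  have "integrable lebesgue (\<lambda>y. B * (indicator (- ball x r) y * kernel s (x - y)))" .
  then show "integrable lebesgue (\<lambda>y. indicator (- ball x r) y * (u y * kernel s (x - y)))"
  proof (rule Bochner_Integration.integrable_bound)
    show "AE y in lebesgue. norm (indicator (- ball x r) y * (u y * kernel s (x - y)))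
        \<le> norm (B * (indicator (- ball x r) y * kernel s (x - y)))"
      using B by (intro always_eventually allI)
        (auto simp: indicator_def abs_mult intro!: mult_right_mono order_trans [OF B])
    show "(\<lambda>y. indicator (- ball x r) y * (u y * kernel s (x - y))) \<in> borel_measurable lebesgue"
      by (intro borel_measurable_times borel_measurable_indicator lebesgue_measurable_kernel u) auto
  qed
qed (rule u)

text \<open>
  Off a ball around \<open>x\<close> the kernel centred at \<open>x\<close> is comparable to the weight of \<open>L_2s\<close>, which is centred at the
  origin.
\<close>

lemma tail_integrable_L_2s:
  fixes u :: "real ^ 'n::finite \<Rightarrow> real"
  assumes s: "0 < s" and u: "L_2s s u"
  shows "tail_integrable s u"
proof -
  define p where "p = real CARD('n) + 2 * s"
  have p: "0 < p"
    using s by (simp add: p_def)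
  have loc: "\<And>K. compact K \<Longrightarrow> integrable lebesgue (\<lambda>y. indicator K y * u y)"
    using u by (auto simp: L_2s_def set_integrable_def)
  have meas [measurable]: "u \<in> borel_measurable lebesgue"
  proof (rule borel_measurable_LIMSEQ_real)
    show "(\<lambda>j. indicator (cball 0 (real j)) y * u y) \<longlonglongrightarrow> u y" for y
    proof (rule tendsto_eventually)
      obtain m where "norm y \<le> real m"
        using real_arch_simple by blast
      then show "\<forall>\<^sub>F j in sequentially. indicator (cball 0 (real j)) y * u y = u y"
        by (auto simp: eventually_sequentially intro!: exI [of _ m])
    qed
    show "(\<lambda>y. indicator (cball 0 (real j)) y * u y) \<in> borel_measurable lebesgue" for j
      using loc by (intro borel_measurable_integrable) auto
  qed
  have w: "integrable lebesgue (\<lambda>y. \<bar>u y\<bar> / (1 + norm y powr p))"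
    using u by (simp add: L_2s_def p_def)
  show ?thesis
    unfolding tail_integrable_def
  proof (intro conjI allI impI)
    fix x :: "real ^ 'n" and r :: real
    show "integrable lebesgue (\<lambda>y. indicator (ball x r) y * u y)"
    proof (rule Bochner_Integration.integrable_bound [OF loc [OF compact_cball, of x r]])
      show "AE y in lebesgue. norm (indicator (ball x r) y * u y) \<le> norm (indicator (cball x r) y * u y)"
        by (auto simp: indicator_def)
      show "(\<lambda>y. indicator (ball x r) y * u y) \<in> borel_measurable lebesgue"
        by (intro borel_measurable_times borel_measurable_indicator meas) auto
    qed
  next
    fix x :: "real ^ 'n" and r :: real
    assume r: "0 < r"
    define a where "a = norm x / r + 1"
    define C where "C = r powr (- p) + a powr p"
    have le: "kernel s (x - y) \<le> C / (1 + norm y powr p)" if "y \<notin> ball x r" for y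
    proof -
      define d where "d = norm (x - y)"
      have d: "r \<le> d"
        using that by (simp add: d_def dist_norm)
      have d0: "0 < d"
        using d r by linarith
      have "norm y \<le> norm x + d"
        unfolding d_def using norm_triangle_sub [of y x] by (simp add: norm_minus_commute)
      also have "\<dots> \<le> norm x * (d / r) + d"
        using d r mult_left_mono [of 1 "d / r" "norm x"] by simp
      also have "\<dots> = a * d"
        by (simp add: a_def field_simps)
      finally have "norm y powr p \<le> (a * d) powr p"
        using p by (intro powr_mono2) auto
      also have "\<dots> = a powr p * d powr p"
        using r d by (simp add: powr_mult a_def)
      finally have 1: "norm y powr p \<le> a powr p * d powr p" .
      have "r powr p \<le> d powr p"
        using d r p by (intro powr_mono2) auto
      then have 2: "1 \<le> r powr (- p) * d powr p"
        using r by (simp add: powr_minus field_simps)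
      have k: "kernel s (x - y) = 1 / d powr p"
        by (simp add: kernel_def p_def d_def)
      have "1 + norm y powr p \<le> C * d powr p"
        using 1 2 by (simp add: C_def algebra_simps)
      moreover have "0 < 1 + norm y powr p"
        by (simp add: add_pos_nonneg)
      ultimately show ?thesis
        unfolding k using d0 by (simp add: field_simps)
    qed
    show "integrable lebesgue (\<lambda>y. indicator (- ball x r) y * (u y * kernel s (x - y)))"
    proof (rule Bochner_Integration.integrable_bound [OF integrable_mult_right [OF w, of C]])
      show "AE y in lebesgue. norm (indicator (- ball x r) y * (u y * kernel s (x - y)))
          \<le> norm (C * (\<bar>u y\<bar> / (1 + norm y powr p)))"
      proof (intro always_eventually allI)
        fix y
        have C0: "0 \<le> C"
          by (simp add: C_def)
        show "norm (indicator (- ball x r) y * (u y * kernel s (x - y)))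
          \<le> norm (C * (\<bar>u y\<bar> / (1 + norm y powr p)))"
        proof (cases "y \<in> ball x r")
          case False
          have "\<bar>u y\<bar> * kernel s (x - y) \<le> \<bar>u y\<bar> * (C / (1 + norm y powr p))"
            using le [OF False] by (intro mult_left_mono) auto
          also have "\<dots> = norm (C * (\<bar>u y\<bar> / (1 + norm y powr p)))"
            using C0 by (simp add: abs_mult mult_ac abs_of_nonneg add_nonneg_nonneg)
          finally show ?thesis
            using False by (simp add: abs_mult)
        qed (use C0 in auto)
      qed
      show "(\<lambda>y. indicator (- ball x r) y * (u y * kernel s (x - y))) \<in> borel_measurable lebesgue"
        by (intro borel_measurable_times borel_measurable_indicator lebesgue_measurable_kernel meas) auto
    qed
  qed (rule meas)
qed

lemma tail_integrable_diff_integrable: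
  fixes u :: "real ^ 'n::finite \<Rightarrow> real"
  assumes s: "0 < s" and u: "tail_integrable s u" and r: "0 < r"
  shows "integrable lebesgue (\<lambda>y. indicator (- ball x r) y * ((u y - c) * kernel s (x - y)))"
proof -
  have "integrable lebesgue (\<lambda>y. indicator (- ball x r) y * (u y * kernel s (x - y))
      - c * (indicator (- ball x r) y * kernel s (x - y)))"
    using u r kernel_tail_integrable_lebesgue [OF s r, of x]
    by (intro Bochner_Integration.integrable_diff integrable_mult_right) (auto simp: tail_integrable_def)
  then show ?thesis
    by (simp add: algebra_simps)
qed

lemma tail_integrable_add:
  assumes "tail_integrable s u" "tail_integrable s v"
  shows "tail_integrable s (\<lambda>x. u x + v x)"
  using assms unfolding tail_integrable_def
  by (auto simp: distrib_left distrib_right)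

lemma tail_integrable_diff_const:
  fixes u :: "real ^ 'n::finite \<Rightarrow> real"
  assumes "0 < s" "tail_integrable s u"
  shows "tail_integrable s (\<lambda>x. u x - c)"
  using tail_integrable_add [OF assms(2) tail_integrable_bounded [of s "\<lambda>_. - c" "\<bar>c\<bar>"]] assms(1)
  by simp

text \<open>
  Averaging over \<open>z\<close> and \<open>- z\<close> removes the first-order part of \<open>u\<close>. All estimates below therefore need bounds on second
  differences only, and for upper estimates only upper bounds (semiconcavity).
\<close>

lemma trunc_diffusion_second_diff:
  fixes u :: "real ^ 'n::finite \<Rightarrow> real"
  assumes s: "0 < s" and u: "tail_integrable s u" and r: "0 < r"
  shows "integrable lebesgue (\<lambda>z. indicator (- ball 0 r) z * (second_diff u x z * kernel s z))"
    and "trunc_diffusion s u x r =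
      (LINT z|lebesgue. indicator (- ball 0 r) z * (second_diff u x z * kernel s z)) / 2"
proof -
  define F where "F = (\<lambda>y. indicator (- ball x r) y * ((u y - u x) * kernel s (x - y)))"
  have F: "integrable lebesgue F"
    unfolding F_def by (rule tail_integrable_diff_integrable [OF s u r])
  have F1: "integrable lebesgue (\<lambda>z. F (x + z))" "integrable lebesgue (\<lambda>z. F (x - z))"
    using F lebesgue_preserving_integrable lebesgue_preserving_translation
      lebesgue_preserving_point_reflection by blast+
  have F2: "(LINT z|lebesgue. F (x + z)) = (LINT y|lebesgue. F y)"
    "(LINT z|lebesgue. F (x - z)) = (LINT y|lebesgue. F y)"
    using F lebesgue_preserving_integral lebesgue_preserving_translation
      lebesgue_preserving_point_reflection by blast+
  have eq: "indicator (- ball 0 r) z * (second_diff u x z * kernel s z) = F (x + z) + F (x - z)" for z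
    by (auto simp: F_def second_diff_def indicator_def dist_norm algebra_simps)
  show "integrable lebesgue (\<lambda>z. indicator (- ball 0 r) z * (second_diff u x z * kernel s z))"
    unfolding eq using F1 by (rule Bochner_Integration.integrable_add)
  show "trunc_diffusion s u x r =
      (LINT z|lebesgue. indicator (- ball 0 r) z * (second_diff u x z * kernel s z)) / 2"
    unfolding eq Bochner_Integration.integral_add [OF F1] F2 by (simp add: trunc_diffusion_def F_def)
qed

lemma integral_outside_shrinking_ball:
  fixes F :: "'a::euclidean_space \<Rightarrow> real"
  assumes F: "integrable lebesgue F"
  shows "((\<lambda>\<epsilon>. LINT y|lebesgue. indicator (- ball x \<epsilon>) y * F y) \<longlongrightarrow> (LINT y|lebesgue. F y)) (at_right 0)"
proof (rule tendsto_at_right_sequentially [of 0 1])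
  fix S :: "nat \<Rightarrow> real"
  assume S: "\<And>n. 0 < S n" "S \<longlonglongrightarrow> 0"
  have [measurable]: "F \<in> borel_measurable lebesgue"
    using F by auto
  show "(\<lambda>n. LINT y|lebesgue. indicator (- ball x (S n)) y * F y) \<longlonglongrightarrow> (LINT y|lebesgue. F y)"
  proof (rule integral_dominated_convergence)
    show "integrable lebesgue (\<lambda>y. \<bar>F y\<bar>)"
      using F by auto
    show "AE y in lebesgue. (\<lambda>n. indicator (- ball x (S n)) y * F y) \<longlonglongrightarrow> F y"
    proof (rule AE_I')
      show "{x} \<in> null_sets lebesgue"
        unfolding negligible_iff_null_sets [symmetric] by (rule negligible_sing)
      show "{y \<in> space lebesgue. \<not> (\<lambda>n. indicator (- ball x (S n)) y * F y) \<longlonglongrightarrow> F y} \<subseteq> {x}"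
      proof (rule subsetI, rule ccontr)
        fix y
        assume y: "y \<in> {y \<in> space lebesgue. \<not> (\<lambda>n. indicator (- ball x (S n)) y * F y) \<longlonglongrightarrow> F y}"
          and "y \<notin> {x}"
        then have "0 < dist x y"
          by simp
        then have "\<forall>\<^sub>F n in sequentially. S n < dist x y"
          using S(2) order_tendstoD(2) by blast
        then have "\<forall>\<^sub>F n in sequentially. indicator (- ball x (S n)) y * F y = F y"
          by eventually_elim auto
        then have "(\<lambda>n. indicator (- ball x (S n)) y * F y) \<longlonglongrightarrow> F y"
          by (rule tendsto_eventually)
        with y show False
          by simp
      qed
    qed
    show "AE y in lebesgue. norm (indicator (- ball x (S n)) y * F y) \<le> \<bar>F y\<bar>" for n
      by (auto simp: indicator_def)
    show "(\<lambda>y. indicator (- ball x (S n)) y * F y) \<in> borel_measurable lebesgue" for n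
      by (intro borel_measurable_times borel_measurable_indicator) auto
  qed auto
qed auto

text \<open>
  By the mean value theorem in the directions \<open>z\<close> and \<open>- z\<close>, the second difference is the inner product of \<open>z\<close> with
  a difference of two gradients at points of distance at most \<open>2 * norm z\<close>.
\<close>

lemma C11_loc_second_diff:
  fixes u :: "real ^ 'n::finite \<Rightarrow> real"
  assumes "C11_loc S u" "open S" "x \<in> S"
  obtains r c where "0 < r" "0 \<le> c" "\<And>z. norm z < r \<Longrightarrow> \<bar>second_diff u x z\<bar> \<le> c * (norm z)\<^sup>2"
proof -
  obtain g where g: "\<And>x. x \<in> S \<Longrightarrow> GDERIV u x :> g x"
    and lip: "\<And>x. x \<in> S \<Longrightarrow> \<exists>e>0. \<exists>L. L-lipschitz_on (ball x e \<inter> S) g"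
    using assms(1) unfolding C11_loc_def by metis
  obtain e L where e: "0 < e" "L-lipschitz_on (ball x e \<inter> S) g"
    using lip [OF assms(3)] by blast
  obtain e' where e': "0 < e'" "ball x e' \<subseteq> S"
    using assms(2,3) open_contains_ball by blast
  define r where "r = min e e'"
  have r: "0 < r" "ball x r \<subseteq> ball x e \<inter> S"
    using e e' by (auto simp: r_def)
  have L: "L-lipschitz_on (ball x r) g"
    using e(2) r(2) by (rule lipschitz_on_subset)
  have L0: "0 \<le> L"
    using L by (rule lipschitz_on_nonneg)
  have mv: "\<exists>\<xi>. \<xi> \<in> ball x r \<and> norm (\<xi> - x) \<le> norm z \<and> u (x + z) - u x = z \<bullet> g \<xi>"
    if z: "norm z < r" for z
  proof -
    have seg: "x + t *\<^sub>R z \<in> ball x r" "norm (t *\<^sub>R z) \<le> norm z" if "0 \<le> t" "t \<le> 1" for t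
    proof -
      show "norm (t *\<^sub>R z) \<le> norm z"
        using that mult_right_mono [of t 1 "norm z"] by simp
      then show "x + t *\<^sub>R z \<in> ball x r"
        using z by (simp add: dist_norm)
    qed
    have der: "((\<lambda>t. u (x + t *\<^sub>R z)) has_real_derivative (z \<bullet> g (x + t *\<^sub>R z))) (at t)"
      if "0 \<le> t" "t \<le> 1" for t
    proof -
      have "(u has_derivative (\<lambda>h. h \<bullet> g (x + t *\<^sub>R z))) (at (x + t *\<^sub>R z))"
        using g [of "x + t *\<^sub>R z"] seg(1) [OF that] r by (auto simp: gderiv_def)
      moreover have "((\<lambda>t. x + t *\<^sub>R z) has_derivative (\<lambda>t. t *\<^sub>R z)) (at t)"
        by (auto intro!: derivative_eq_intros)
      ultimately have "((\<lambda>t. u (x + t *\<^sub>R z)) has_derivative (\<lambda>h. (h *\<^sub>R z) \<bullet> g (x + t *\<^sub>R z))) (at t)"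
        using has_derivative_compose by fastforce
      then show ?thesis
        by (simp add: has_field_derivative_def mult_commute_abs)
    qed
    obtain t where t: "0 < t" "t < 1" "u (x + 1 *\<^sub>R z) - u (x + 0 *\<^sub>R z) = (1 - 0) * (z \<bullet> g (x + t *\<^sub>R z))"
      using MVT2 [of 0 1 "\<lambda>t. u (x + t *\<^sub>R z)" "\<lambda>t. z \<bullet> g (x + t *\<^sub>R z)"] der by auto
    show ?thesis
      using t seg [of t] by (intro exI [of _ "x + t *\<^sub>R z"]) auto
  qed
  have "\<bar>second_diff u x z\<bar> \<le> (2 * L) * (norm z)\<^sup>2" if z: "norm z < r" for z
  proof -
    obtain \<xi> where \<xi>: "\<xi> \<in> ball x r" "norm (\<xi> - x) \<le> norm z" "u (x + z) - u x = z \<bullet> g \<xi>"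
      using mv [OF z] by blast
    obtain \<eta> where \<eta>: "\<eta> \<in> ball x r" "norm (\<eta> - x) \<le> norm z" "u (x + (- z)) - u x = (- z) \<bullet> g \<eta>"
      using mv [of "- z"] z by auto
    have "second_diff u x z = z \<bullet> (g \<xi> - g \<eta>)"
      using \<xi>(3) \<eta>(3) by (simp add: second_diff_def inner_diff_right)
    then have "\<bar>second_diff u x z\<bar> \<le> norm z * norm (g \<xi> - g \<eta>)"
      using Cauchy_Schwarz_ineq2 by metis
    also have "\<dots> \<le> norm z * (L * (2 * norm z))"
    proof (rule mult_left_mono)
      have "norm (g \<xi> - g \<eta>) \<le> L * norm (\<xi> - \<eta>)"
        using lipschitz_onD [OF L \<xi>(1) \<eta>(1)] by (simp add: dist_norm)
      also have "\<dots> \<le> L * (2 * norm z)"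
        using \<xi>(2) \<eta>(2) norm_triangle_ineq4 [of "\<xi> - x" "\<eta> - x"] L0
        by (intro mult_left_mono) auto
      finally show "norm (g \<xi> - g \<eta>) \<le> L * (2 * norm z)" .
    qed auto
    finally show ?thesis
      by (simp add: power2_eq_square mult_ac)
  qed
  then show ?thesis
    using that [of r "2 * L"] r L0 by auto
qed

text \<open>
  Second differences of size \<open>(norm z)\<^sup>2\<close> make the symmetrized integrand absolutely integrable up to the pole, so the
  limit exists. Without this, \<open>Lim\<close> in the definition of \<open>frac_laplacian\<close> would be an unspecified value.
\<close>

lemma trunc_diffusion_converges:
  fixes u :: "real ^ 'n::finite \<Rightarrow> real"
  assumes s: "0 < s" "s < 1" and u: "tail_integrable s u"
    and S: "C11_loc S u" "open S" "x \<in> S"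
  shows "\<exists>L. (trunc_diffusion s u x \<longlongrightarrow> L) (at_right 0)
    \<and> frac_laplacian s u x = - frac_const CARD('n) s * L"
proof -
  obtain r c where r: "0 < r" "0 \<le> c" "\<And>z. norm z < r \<Longrightarrow> \<bar>second_diff u x z\<bar> \<le> c * (norm z)\<^sup>2"
    using C11_loc_second_diff [OF S] by metis
  define F where "F = (\<lambda>z. second_diff u x z * kernel s z)"
  have [measurable]: "u \<in> borel_measurable lebesgue"
    using u by (simp add: tail_integrable_def)
  have [measurable]: "(\<lambda>z. u (x + z)) \<in> borel_measurable lebesgue" "(\<lambda>z. u (x - z)) \<in> borel_measurable lebesgue"
    using lebesgue_preserving_measurable [OF lebesgue_preserving_translation, of u x]
      lebesgue_preserving_measurable [OF lebesgue_preserving_point_reflection, of u x] u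
    by (auto simp: tail_integrable_def)
  have [measurable]: "kernel s \<in> borel_measurable (lebesgue :: (real ^ 'n) measure)"
    using lebesgue_measurable_kernel [of s 0] by simp
  have F1: "integrable lebesgue (\<lambda>z. indicator (ball 0 r) z * F z)"
  proof -
    obtain c2 where "integrable lborel (\<lambda>z::real ^ 'n. indicator (ball 0 r) z * ((norm z)\<^sup>2 * kernel s z))"
      using kernel_near_bound [OF s(2,1)] r(1) by metis
    then have "integrable lebesgue (\<lambda>z::real ^ 'n. indicator (ball 0 r) z * ((norm z)\<^sup>2 * kernel s z))"
      by (subst integrable_completion) auto
    from integrable_mult_right [OF this, of c] show ?thesis
    proof (rule Bochner_Integration.integrable_bound)
      show "AE z in lebesgue. norm (indicator (ball 0 r) z * F z)
          \<le> norm (c * (indicator (ball 0 r) z * ((norm z)\<^sup>2 * kernel s z)))"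
      proof (intro always_eventually allI)
        fix z :: "real ^ 'n"
        show "norm (indicator (ball 0 r) z * F z) \<le> norm (c * (indicator (ball 0 r) z * ((norm z)\<^sup>2 * kernel s z)))"
        proof (cases "norm z < r")
          case True
          then have "\<bar>second_diff u x z\<bar> * kernel s z \<le> (c * (norm z)\<^sup>2) * kernel s z"
            using r(3) by (intro mult_right_mono) auto
          then show ?thesis
            using True r(2) by (simp add: F_def abs_mult mult_ac)
        qed auto
      qed
      show "(\<lambda>z. indicator (ball 0 r) z * F z) \<in> borel_measurable lebesgue"
        unfolding F_def second_diff_def
        by (intro borel_measurable_times borel_measurable_indicator borel_measurable_diff
            borel_measurable_add borel_measurable_const) auto
    qed
  qed
  have F2: "integrable lebesgue (\<lambda>z. indicator (- ball 0 r) z * F z)"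
    unfolding F_def by (rule trunc_diffusion_second_diff(1) [OF s(1) u r(1)])
  have F: "integrable lebesgue F"
  proof -
    have "F = (\<lambda>z. indicator (ball 0 r) z * F z + indicator (- ball 0 r) z * F z)"
      by (auto simp: indicator_def fun_eq_iff)
    then show ?thesis
      using Bochner_Integration.integrable_add [OF F1 F2] by simp
  qed
  define L where "L = (LINT z|lebesgue. F z) / 2"
  have ev: "\<forall>\<^sub>F \<epsilon> in at_right 0. (LINT z|lebesgue. indicator (- ball 0 \<epsilon>) z * F z) / 2 = trunc_diffusion s u x \<epsilon>"
    using eventually_at_right_less [of 0] unfolding F_def
    by eventually_elim (simp add: trunc_diffusion_second_diff(2) [OF s(1) u])
  have "((\<lambda>\<epsilon>. (LINT z|lebesgue. indicator (- ball 0 \<epsilon>) z * F z) / 2) \<longlongrightarrow> L) (at_right 0)"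
    unfolding L_def by (intro tendsto_intros integral_outside_shrinking_ball F) auto
  then have lim: "(trunc_diffusion s u x \<longlongrightarrow> L) (at_right 0)"
    using ev by (rule Lim_transform_eventually)
  have "(u x - u y) / norm (x - y) powr (real CARD('n) + 2 * s) = - ((u y - u x) * kernel s (x - y))" for y
    unfolding kernel_def times_divide_eq_right mult_1_right minus_divide_left by simp
  then have "(LINT y:- ball x \<epsilon>|lebesgue. (u x - u y) / norm (x - y) powr (real CARD('n) + 2 * s))
      = - trunc_diffusion s u x \<epsilon>" for \<epsilon>
    by (simp add: set_lebesgue_integral_def trunc_diffusion_def)
  then have "frac_laplacian s u x = frac_const CARD('n) s * Lim (at_right 0) (\<lambda>\<epsilon>. - trunc_diffusion s u x \<epsilon>)"
    by (simp add: frac_laplacian_def)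
  also have "Lim (at_right 0) (\<lambda>\<epsilon>. - trunc_diffusion s u x \<epsilon>) = - L"
    by (rule tendsto_Lim) (auto intro!: tendsto_intros lim)
  finally show ?thesis
    using lim by auto
qed

lemma tail_integrable_mult:
  assumes "tail_integrable s u"
  shows "tail_integrable s (\<lambda>x. a * u x)"
  unfolding tail_integrable_def
proof (intro conjI allI impI)
  show "(\<lambda>x. a * u x) \<in> borel_measurable lebesgue"
    using assms by (intro borel_measurable_times borel_measurable_const) (simp add: tail_integrable_def)
  show "integrable lebesgue (\<lambda>y. indicator (ball x r) y * (a * u y))" for x r
    using assms integrable_mult_right [of a lebesgue "\<lambda>y. indicator (ball x r) y * u y"]
    by (simp add: tail_integrable_def mult.left_commute)
  show "integrable lebesgue (\<lambda>y. indicator (- ball x r) y * (a * u y * kernel s (x - y)))" if "0 < r" for x r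
    using assms that integrable_mult_right [of a lebesgue "\<lambda>y. indicator (- ball x r) y * (u y * kernel s (x - y))"]
    by (simp add: tail_integrable_def mult.left_commute mult.assoc)
qed

lemma tail_integrable_continuous_bounded:
  fixes u :: "real ^ 'n::finite \<Rightarrow> real"
  assumes "0 < s" "continuous_on UNIV u" "\<And>x. \<bar>u x\<bar> \<le> B"
  shows "tail_integrable s u"
proof (rule tail_integrable_bounded [OF assms(1) _ assms(3)])
  have "u \<in> borel_measurable borel"
    using assms(2) by (rule borel_measurable_continuous_onI)
  then show "u \<in> borel_measurable lebesgue"
    by (simp add: measurable_completion)
qed

lemma trunc_diffusion_add:
  fixes u w :: "real ^ 'n::finite \<Rightarrow> real"
  assumes "0 < s" "tail_integrable s u" "tail_integrable s w" "0 < \<epsilon>"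
  shows "trunc_diffusion s (\<lambda>y. u y + w y) x \<epsilon> = trunc_diffusion s u x \<epsilon> + trunc_diffusion s w x \<epsilon>"
proof -
  have "trunc_diffusion s u x \<epsilon> + trunc_diffusion s w x \<epsilon>
    = (LINT y|lebesgue. indicator (- ball x \<epsilon>) y * ((u y - u x) * kernel s (x - y))
        + indicator (- ball x \<epsilon>) y * ((w y - w x) * kernel s (x - y)))"
    unfolding trunc_diffusion_def
    by (intro Bochner_Integration.integral_add [symmetric] tail_integrable_diff_integrable assms)
  also have "\<dots> = trunc_diffusion s (\<lambda>y. u y + w y) x \<epsilon>"
    unfolding trunc_diffusion_def
    by (rule Bochner_Integration.integral_cong) (auto simp: algebra_simps)
  finally show ?thesis
    by simp
qed

lemma trunc_diffusion_affine:
  "trunc_diffusion s (\<lambda>y. a + b * u y) x \<epsilon> = b * trunc_diffusion s u x \<epsilon>"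
proof -
  have "trunc_diffusion s (\<lambda>y. a + b * u y) x \<epsilon>
    = (LINT y|lebesgue. b * (indicator (- ball x \<epsilon>) y * ((u y - u x) * kernel s (x - y))))"
    unfolding trunc_diffusion_def
    by (rule Bochner_Integration.integral_cong) (auto simp: algebra_simps)
  then show ?thesis
    by (simp add: trunc_diffusion_def)
qed

lemma trunc_diffusion_lborel:
  fixes u :: "real ^ 'n::finite \<Rightarrow> real"
  assumes u: "continuous_on UNIV u"
  shows "trunc_diffusion s u x \<epsilon> = (LINT z|lborel. indicator (- ball 0 \<epsilon>) z * kernel s z * (u (x + z) - u x))"
proof -
  have [measurable]: "u \<in> borel_measurable borel"
    using u by (rule borel_measurable_continuous_onI)
  have m: "(\<lambda>y. indicator (- ball x \<epsilon>) y * ((u y - u x) * kernel s (x - y))) \<in> borel_measurable borel"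
    by measurable
  have m': "(\<lambda>z. indicator (- ball 0 \<epsilon>) z * kernel s z * (u (x + z) - u x)) \<in> borel_measurable lborel"
    by measurable
  have "trunc_diffusion s u x \<epsilon>
    = (LINT z|lebesgue. indicator (- ball x \<epsilon>) (x + z) * ((u (x + z) - u x) * kernel s (x - (x + z))))"
    unfolding trunc_diffusion_def
    by (rule lebesgue_preserving_integral [symmetric, OF lebesgue_preserving_translation])
      (use m in \<open>simp add: measurable_completion\<close>)
  also have "\<dots> = (LINT z|lebesgue. indicator (- ball 0 \<epsilon>) z * kernel s z * (u (x + z) - u x))"
    by (rule Bochner_Integration.integral_cong) (auto simp: indicator_def dist_norm)
  also have "\<dots> = (LINT z|lborel. indicator (- ball 0 \<epsilon>) z * kernel s z * (u (x + z) - u x))"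
    by (rule integral_completion [OF m'])
  finally show ?thesis .
qed

text \<open>
  Between the radii \<open>\<epsilon>\<close> and \<open>r\<close> a semiconcave function gains at most the second moment of the kernel.
\<close>

lemma trunc_diffusion_near_le:
  fixes u :: "real ^ 'n::finite \<Rightarrow> real"
  assumes s: "0 < s" and u: "tail_integrable s u" and \<epsilon>: "0 < \<epsilon>" "\<epsilon> \<le> r" and c: "0 \<le> c"
    and sd: "\<And>z. norm z < r \<Longrightarrow> second_diff u x z \<le> c * (norm z)\<^sup>2"
    and near: "integrable lborel (\<lambda>z::real ^ 'n. indicator (ball 0 r) z * ((norm z)\<^sup>2 * kernel s z))"
      "(LINT z::real ^ 'n|lborel. indicator (ball 0 r) z * ((norm z)\<^sup>2 * kernel s z)) \<le> b"
  shows "trunc_diffusion s u x \<epsilon> \<le> c * b / 2 + trunc_diffusion s u x r"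
proof -
  have r: "0 < r"
    using \<epsilon> by simp
  define F where "F = (\<lambda>z. second_diff u x z * kernel s z)"
  define Q where "Q = (\<lambda>z::real ^ 'n. indicator (ball 0 r) z * ((norm z)\<^sup>2 * kernel s z))"
  have Qm: "Q \<in> borel_measurable lborel"
    unfolding Q_def by (intro borel_measurable_integrable near)
  have Q: "integrable lebesgue Q" "(LINT z|lebesgue. Q z) \<le> b"
    using near Qm by (auto simp: integrable_completion integral_completion simp flip: Q_def)
  have F1: "integrable lebesgue (\<lambda>z. indicator (- ball 0 \<epsilon>) z * F z)"
    unfolding F_def by (rule trunc_diffusion_second_diff(1) [OF s u \<epsilon>(1)])
  have F2: "integrable lebesgue (\<lambda>z. indicator (- ball 0 r) z * F z)"
    unfolding F_def by (rule trunc_diffusion_second_diff(1) [OF s u r])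
  have "(LINT z|lebesgue. indicator (- ball 0 \<epsilon>) z * F z)
      \<le> (LINT z|lebesgue. c * Q z + indicator (- ball 0 r) z * F z)"
  proof (rule integral_mono [OF F1])
    show "integrable lebesgue (\<lambda>z. c * Q z + indicator (- ball 0 r) z * F z)"
      using Q(1) F2 by (intro Bochner_Integration.integrable_add integrable_mult_right)
    fix z :: "real ^ 'n"
    show "indicator (- ball 0 \<epsilon>) z * F z \<le> c * Q z + indicator (- ball 0 r) z * F z"
    proof (cases "norm z < r")
      case True
      have "F z \<le> c * Q z"
        using mult_right_mono [OF sd [OF True], of "kernel s z"] True
        by (simp add: F_def Q_def mult.assoc)
      moreover have "0 \<le> c * Q z"
        using c by (simp add: Q_def)
      ultimately show ?thesis
        using True by (simp add: indicator_def)
    next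
      case False
      then show ?thesis
        using \<epsilon> by (simp add: Q_def)
    qed
  qed
  also have "\<dots> = c * (LINT z|lebesgue. Q z) + (LINT z|lebesgue. indicator (- ball 0 r) z * F z)"
    using Q(1) F2 by simp
  also have "\<dots> \<le> c * b + (LINT z|lebesgue. indicator (- ball 0 r) z * F z)"
    using Q(2) c by (simp add: mult_left_mono)
  finally show ?thesis
    by (simp add: trunc_diffusion_second_diff(2) [OF s u] \<epsilon>(1) r F_def field_simps)
qed

lemma trunc_diffusion_far_le:
  fixes u :: "real ^ 'n::finite \<Rightarrow> real"
  assumes s: "0 < s" and u: "tail_integrable s u" and r: "0 < r" and B: "0 \<le> B"
    and le: "\<And>y. u y \<le> u x + B"
    and far: "(LINT z::real ^ 'n|lborel. indicator (- ball 0 r) z * kernel s z) \<le> b"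
  shows "trunc_diffusion s u x r \<le> B * b"
proof -
  have I: "(LINT y|lebesgue. indicator (- ball x r) y * kernel s (x - y))
      = (LINT z::real ^ 'n|lborel. indicator (- ball 0 r) z * kernel s z)"
  proof -
    have m: "(\<lambda>z::real ^ 'n. indicator (- ball 0 r) z * kernel s z) \<in> borel_measurable lborel"
      by measurable
    have "(LINT z::real ^ 'n|lborel. indicator (- ball 0 r) z * kernel s z)
        = (LINT z::real ^ 'n|lebesgue. indicator (- ball 0 r) z * kernel s z)"
      by (rule integral_completion [symmetric, OF m])
    also have "\<dots> = (LINT y|lebesgue. indicator (- ball 0 r) (x - y) * kernel s (x - y))"
      by (rule lebesgue_preserving_integral [symmetric, OF lebesgue_preserving_point_reflection])
        (use m in \<open>simp add: measurable_completion\<close>)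
    also have "\<dots> = (LINT y|lebesgue. indicator (- ball x r) y * kernel s (x - y))"
      by (rule Bochner_Integration.integral_cong) (auto simp: indicator_def dist_norm norm_minus_commute)
    finally show ?thesis
      by simp
  qed
  have "trunc_diffusion s u x r \<le> (LINT y|lebesgue. B * (indicator (- ball x r) y * kernel s (x - y)))"
    unfolding trunc_diffusion_def
  proof (rule integral_mono)
    show "integrable lebesgue (\<lambda>y. indicator (- ball x r) y * ((u y - u x) * kernel s (x - y)))"
      by (rule tail_integrable_diff_integrable [OF s u r])
    show "integrable lebesgue (\<lambda>y. B * (indicator (- ball x r) y * kernel s (x - y)))"
      by (intro integrable_mult_right kernel_tail_integrable_lebesgue s r)
    fix y
    have "(u y - u x) * kernel s (x - y) \<le> B * kernel s (x - y)"
      using le [of y] by (intro mult_right_mono) auto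
    then show "indicator (- ball x r) y * ((u y - u x) * kernel s (x - y))
        \<le> B * (indicator (- ball x r) y * kernel s (x - y))"
      by (simp add: indicator_def)
  qed
  also have "\<dots> = B * (LINT z::real ^ 'n|lborel. indicator (- ball 0 r) z * kernel s z)"
    by (simp add: I)
  also have "\<dots> \<le> B * b"
    using far B by (rule mult_left_mono)
  finally show ?thesis .
qed

lemma frac_const_pos:
  assumes "0 < s" "s < 1"
  shows "0 < frac_const N s"
proof -
  have "- s \<notin> \<int>\<^sub>\<le>\<^sub>0"
  proof
    assume "- s \<in> \<int>\<^sub>\<le>\<^sub>0"
    then obtain n where "- s = - real n"
      by (elim nonpos_Ints_cases') auto
    with assms show False
      by simp
  qed
  then have "Gamma (- s) \<noteq> 0"
    by (simp add: Gamma_eq_zero_iff)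
  then show ?thesis
    using assms by (auto simp: frac_const_def intro!: divide_pos_pos mult_pos_pos Gamma_real_pos)
qed

section \<open>The maximum principle for antisymmetric functions\<close>

text \<open>
  Let \<open>\<phi> = w + H - (w x + H x)\<close>. It is nonnegative on the half space. At the reflection of \<open>y\<close> it may be negative,
  but not below \<open>- \<phi> y\<close>, and the kernel gives the reflected point less weight than \<open>y\<close>. So \<open>y\<close> and its
  reflection together contribute a nonnegative amount to the truncated diffusion of \<open>\<phi>\<close>. Only the reflection of the
  truncation ball has lost its partner; its contribution vanishes with the radius.
  
  The condition on \<open>H y + H (reflect k l y)\<close> admits functions that are nonnegative everywhere as well as
  antisymmetric ones.
\<close>

lemma frac_laplacian_at_touching_point:
  fixes w H :: "real ^ 'n::finite \<Rightarrow> real"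
  assumes s: "0 < s" "s < 1" and w: "tail_integrable s w" and C11: "C11_loc S w" "open S" "x \<in> S"
    and x: "x $ k < l"
    and anti: "\<And>y. y $ k < l \<Longrightarrow> w y = - w (reflect k l y)"
    and H: "tail_integrable s H"
    and Hpos: "\<And>y. y $ k < l \<Longrightarrow> 0 \<le> H y + H (reflect k l y)"
    and Hx: "H x \<le> - w x"
    and touch: "\<And>y. y $ k < l \<Longrightarrow> w x + H x \<le> w y + H y"
    and C0: "0 \<le> frac_const CARD('n) s"
    and \<epsilon>0: "0 < \<epsilon>0" and b: "\<And>\<epsilon>. 0 < \<epsilon> \<Longrightarrow> \<epsilon> < \<epsilon>0 \<Longrightarrow> trunc_diffusion s H x \<epsilon> \<le> b"
  shows "frac_laplacian s w x \<le> frac_const CARD('n) s * b"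
proof -
  define d where "d = l - x $ k"
  define P where "P = d powr (- (real CARD('n) + 2 * s))"
  define \<phi> where "\<phi> = (\<lambda>y. w y + H y - (w x + H x))"
  have d: "0 < d"
    using x by (simp add: d_def)
  have \<phi>: "tail_integrable s \<phi>"
    unfolding \<phi>_def by (intro tail_integrable_diff_const tail_integrable_add s w H)
  have [measurable]: "\<phi> \<in> borel_measurable lebesgue"
    using \<phi> by (simp add: tail_integrable_def)
  have \<phi>0: "0 \<le> \<phi> y" if "y $ k < l" for y
    using touch [OF that] by (simp add: \<phi>_def)
  have \<phi>R: "- \<phi> y \<le> \<phi> (reflect k l y)" if "y $ k < l" for y
    using anti [OF that] Hpos [OF that] Hx by (simp add: \<phi>_def)
  have kR: "kernel s (x - reflect k l y) \<le> P" if "y $ k < l" for y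
  proof -
    have "d \<le> norm (x - reflect k l y)"
      using norm_diff_le_reflect(2) [OF x that] by (simp add: d_def)
    then have "norm (x - reflect k l y) powr (- (real CARD('n) + 2 * s)) \<le> P"
      unfolding P_def using d s by (intro powr_mono2') auto
    then show ?thesis
      by (simp add: kernel_def powr_minus_divide del: minus_add_distrib)
  qed
  obtain L where L: "(trunc_diffusion s w x \<longlongrightarrow> L) (at_right 0)"
    and fr: "frac_laplacian s w x = - frac_const CARD('n) s * L"
    using trunc_diffusion_converges [OF s w C11] by blast
  define I where "I \<epsilon> = (LINT y|lebesgue. indicator (ball x \<epsilon>) y * \<phi> y)" for \<epsilon>
  have I_lim: "(I \<longlongrightarrow> 0) (at_right 0)"
  proof -
    define F where "F = (\<lambda>y. indicator (ball x 1) y * \<phi> y)"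
    have F: "integrable lebesgue F"
      using \<phi> by (simp add: F_def tail_integrable_def)
    have "I \<epsilon> = (LINT y|lebesgue. F y) - (LINT y|lebesgue. indicator (- ball x \<epsilon>) y * F y)"
      if "0 < \<epsilon>" "\<epsilon> < 1" for \<epsilon>
    proof -
      have "integrable lebesgue (\<lambda>y. indicator (- ball x \<epsilon>) y * F y)"
      proof (rule Bochner_Integration.integrable_bound [OF F])
        show "(\<lambda>y. indicator (- ball x \<epsilon>) y * F y) \<in> borel_measurable lebesgue"
          using F by (intro borel_measurable_times borel_measurable_indicator) auto
      qed (auto simp: indicator_def)
      then have "(LINT y|lebesgue. F y) - (LINT y|lebesgue. indicator (- ball x \<epsilon>) y * F y)
          = (LINT y|lebesgue. F y - indicator (- ball x \<epsilon>) y * F y)"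
        by (intro Bochner_Integration.integral_diff [symmetric] F)
      also have "\<dots> = I \<epsilon>"
        unfolding I_def
        by (rule Bochner_Integration.integral_cong) (use that in \<open>auto simp: F_def indicator_def\<close>)
      finally show ?thesis
        by simp
    qed
    then have ev: "\<forall>\<^sub>F \<epsilon> in at_right 0. (LINT y|lebesgue. F y) - (LINT y|lebesgue. indicator (- ball x \<epsilon>) y * F y) = I \<epsilon>"
      unfolding eventually_at_right_field by (intro exI [of _ 1]) auto
    have "((\<lambda>\<epsilon>. (LINT y|lebesgue. F y) - (LINT y|lebesgue. indicator (- ball x \<epsilon>) y * F y))
        \<longlongrightarrow> (LINT y|lebesgue. F y) - (LINT y|lebesgue. F y)) (at_right 0)"
      by (intro tendsto_intros integral_outside_shrinking_ball F)
    then have "((\<lambda>\<epsilon>. (LINT y|lebesgue. F y) - (LINT y|lebesgue. indicator (- ball x \<epsilon>) y * F y)) \<longlongrightarrow> 0) (at_right 0)"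
      by simp
    then show ?thesis
      using ev by (rule Lim_transform_eventually)
  qed
  have lower: "- P * I \<epsilon> \<le> trunc_diffusion s w x \<epsilon> + trunc_diffusion s H x \<epsilon>"
    if \<epsilon>: "0 < \<epsilon>" "\<epsilon> < d" for \<epsilon>
  proof -
    define G where "G = (\<lambda>y. indicator (- ball x \<epsilon>) y * (\<phi> y * kernel s (x - y)))"
    have G: "integrable lebesgue G"
      using \<phi> \<epsilon> by (simp add: G_def tail_integrable_def)
    have ball_half: "y $ k < l" if "y \<in> ball x \<epsilon>" for y
      using that component_le_norm_cart [of "x - y" k] \<epsilon> by (auto simp: dist_norm d_def)
    have sum: "trunc_diffusion s w x \<epsilon> + trunc_diffusion s H x \<epsilon> = (LINT y|lebesgue. G y)"
    proof -
      have "trunc_diffusion s w x \<epsilon> + trunc_diffusion s H x \<epsilon>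
        = (LINT y|lebesgue. indicator (- ball x \<epsilon>) y * ((w y - w x) * kernel s (x - y))
            + indicator (- ball x \<epsilon>) y * ((H y - H x) * kernel s (x - y)))"
        unfolding trunc_diffusion_def
        by (intro Bochner_Integration.integral_add [symmetric] tail_integrable_diff_integrable s w H \<epsilon>)
      also have "\<dots> = (LINT y|lebesgue. G y)"
        by (rule Bochner_Integration.integral_cong) (auto simp: G_def \<phi>_def algebra_simps)
      finally show ?thesis .
    qed
    define A where "A = {y::real ^ 'n. y $ k < l}"
    define B where "B = {y::real ^ 'n. y $ k > l}"
    have [measurable]: "A \<in> sets lebesgue" "B \<in> sets lebesgue"
      unfolding A_def B_def by (auto intro!: borel_open open_halfspace_component_lt_cart open_halfspace_component_gt_cart)
    have [measurable]: "G \<in> borel_measurable lebesgue"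
      using G by auto
    have GA: "integrable lebesgue (\<lambda>y. indicator A y * G y)"
      by (rule Bochner_Integration.integrable_bound [OF G]) (auto simp: indicator_def)
    have GB: "integrable lebesgue (\<lambda>y. indicator B y * G y)"
      by (rule Bochner_Integration.integrable_bound [OF G]) (auto simp: indicator_def)
    \<comment> \<open>The part beyond the hyperplane, moved into the half space by the reflection.\<close>
    define G' where "G' = (\<lambda>y. indicator B (reflect k l y) * G (reflect k l y))"
    have G': "integrable lebesgue G'" "(LINT y|lebesgue. G' y) = (LINT y|lebesgue. indicator B y * G y)"
      unfolding G'_def
      using lebesgue_preserving_integrable [OF lebesgue_preserving_reflect GB, of k l]
        lebesgue_preserving_integral [OF lebesgue_preserving_reflect borel_measurable_integrable [OF GB], of k l]
      by auto
    have off: "G y = indicator A y * G y + indicator B y * G y" if "y $ k \<noteq> l" for y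
      using that by (cases "y $ k < l") (auto simp: A_def B_def)
    have AE: "AE y in lebesgue. G y = indicator A y * G y + indicator B y * G y"
    proof (rule AE_I')
      show "{y::real ^ 'n. y $ k = l} \<in> null_sets lebesgue"
        using negligible_standard_hyperplane [of "axis k (1::real)" l]
        by (simp add: negligible_iff_null_sets inner_axis)
      show "{y \<in> space lebesgue. G y \<noteq> indicator A y * G y + indicator B y * G y} \<subseteq> {y. y $ k = l}"
        using off by blast
    qed
    have "(LINT y|lebesgue. G y) = (LINT y|lebesgue. indicator A y * G y + indicator B y * G y)"
      using G GA GB by (intro integral_cong_AE AE) auto
    also have "\<dots> = (LINT y|lebesgue. indicator A y * G y) + (LINT y|lebesgue. G' y)"
      using GA GB G'(2) by simp
    also have "\<dots> = (LINT y|lebesgue. indicator A y * G y + G' y)"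
      by (rule Bochner_Integration.integral_add [symmetric, OF GA G'(1)])
    finally have eq: "(LINT y|lebesgue. G y) = (LINT y|lebesgue. indicator A y * G y + G' y)" .
    have "(LINT y|lebesgue. - P * (indicator (ball x \<epsilon>) y * \<phi> y)) \<le> (LINT y|lebesgue. indicator A y * G y + G' y)"
    proof (rule integral_mono)
      show "integrable lebesgue (\<lambda>y. - P * (indicator (ball x \<epsilon>) y * \<phi> y))"
        using \<phi> by (intro integrable_mult_right) (simp add: tail_integrable_def)
      show "integrable lebesgue (\<lambda>y. indicator A y * G y + G' y)"
        using GA G'(1) by (rule Bochner_Integration.integrable_add)
      fix y :: "real ^ 'n"
      show "- P * (indicator (ball x \<epsilon>) y * \<phi> y) \<le> indicator A y * G y + G' y"
      proof (cases "y \<in> A")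
        case False
        then have "y \<notin> ball x \<epsilon>"
          using ball_half by (auto simp: A_def)
        then show ?thesis
          using False by (auto simp: G'_def A_def B_def)
      next
        case True
        then have y: "y $ k < l" "reflect k l y $ k > l"
          by (auto simp: A_def)
        have "reflect k l y \<notin> ball x \<epsilon>"
          using ball_half [of "reflect k l y"] y(2) by auto
        then have G'y: "G' y = \<phi> (reflect k l y) * kernel s (x - reflect k l y)"
          using y(1) by (simp add: G'_def G_def B_def)
        have *: "- \<phi> y * kernel s (x - reflect k l y) \<le> G' y"
          unfolding G'y using \<phi>R [OF y(1)] by (intro mult_right_mono) auto
        show ?thesis
        proof (cases "y \<in> ball x \<epsilon>")
          case True
          have "- P * \<phi> y \<le> - \<phi> y * kernel s (x - reflect k l y)"
            using mult_left_mono [OF kR [OF y(1)] \<phi>0 [OF y(1)]] by (simp add: mult.commute)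
          then show ?thesis
            using True * by (simp add: G_def)
        next
          case False
          then have "0 < norm (x - y)"
            using \<epsilon> by (auto simp: dist_norm)
          then have "kernel s (x - reflect k l y) \<le> kernel s (x - y)"
            using norm_diff_le_reflect(1) [OF x y(1)] by (intro kernel_antimono s)
          then have "\<phi> y * kernel s (x - reflect k l y) \<le> \<phi> y * kernel s (x - y)"
            using \<phi>0 [OF y(1)] by (rule mult_left_mono)
          then show ?thesis
            using False * y(1) by (simp add: G_def A_def)
        qed
      qed
    qed
    then show ?thesis
      unfolding sum eq by (simp add: I_def)
  qed
  have "- b \<le> L"
  proof (rule tendsto_le [OF trivial_limit_at_right_real L])
    show "((\<lambda>\<epsilon>. - P * I \<epsilon> - b) \<longlongrightarrow> - b) (at_right 0)"
      using tendsto_diff [OF tendsto_mult_left [OF I_lim, of "- P"] tendsto_const [of b]] by simp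
    show "\<forall>\<^sub>F \<epsilon> in at_right 0. - P * I \<epsilon> - b \<le> trunc_diffusion s w x \<epsilon>"
      unfolding eventually_at_right_field
    proof (intro exI [of _ "min d \<epsilon>0"] conjI allI impI)
      show "min d \<epsilon>0 > 0"
        using d \<epsilon>0 by auto
      fix \<epsilon> :: real
      assume "\<epsilon> > 0" "\<epsilon> < min d \<epsilon>0"
      then show "- P * I \<epsilon> - b \<le> trunc_diffusion s w x \<epsilon>"
        using lower [of \<epsilon>] b [of \<epsilon>] by auto
    qed
  qed
  then show ?thesis
    using mult_left_mono [of "- b" L "frac_const CARD('n) s"] C0 unfolding fr by simp
qed

section \<open>Averages over jumps\<close>

text \<open>
  One explicit Euler step of length \<open>\<tau>\<close> for the evolution in which mass jumps by \<open>z\<close> at rate \<open>q z\<close>.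
  If \<open>\<tau>\<close> times the total rate is at most \<open>1\<close>, then the step is an average of translates of \<open>f\<close>. Hence it
  keeps every bound that is invariant under translations and averages, such as bounds for the
  supremum, the second differences and the mass, and it does so over any number of steps.
\<close>

definition jump_avg :: "('a::euclidean_space \<Rightarrow> real) \<Rightarrow> real \<Rightarrow> ('a \<Rightarrow> real) \<Rightarrow> 'a \<Rightarrow> real"
  where "jump_avg q \<tau> f x = f x + \<tau> * (LINT z|lborel. q z * (f (x + z) - f x))"

locale jump_kernel =
  fixes q :: "'a::euclidean_space \<Rightarrow> real" and \<Lambda> :: real
  assumes q_nonneg: "0 \<le> q z" and q_int: "integrable lborel q" and q_mass: "(LINT z|lborel. q z) = \<Lambda>"
begin

lemma mass_nonneg: "0 \<le> \<Lambda>"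
  using q_nonneg q_mass Bochner_Integration.integral_nonneg [of lborel q] by simp

lemma integrable_mult_bounded:
  assumes "f \<in> borel_measurable borel" "\<And>z. \<bar>f z\<bar> \<le> M"
  shows "integrable lborel (\<lambda>z. q z * f z)"
proof (rule Bochner_Integration.integrable_bound [OF integrable_mult_right [OF q_int, of M]])
  show "(\<lambda>z. q z * f z) \<in> borel_measurable lborel"
    using q_int assms(1) by (intro borel_measurable_times) auto
  show "AE z in lborel. norm (q z * f z) \<le> norm (M * q z)"
  proof (intro always_eventually allI)
    fix z
    have "0 \<le> M"
      using assms(2) [of z] by linarith
    then show "norm (q z * f z) \<le> norm (M * q z)"
      using mult_left_mono [OF assms(2) [of z] q_nonneg [of z]] q_nonneg [of z] by (simp add: abs_mult mult.commute)
  qed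
qed

lemma shift_measurable:
  fixes f :: "'a \<Rightarrow> real"
  assumes "continuous_on UNIV f"
  shows "(\<lambda>z. f (x + z)) \<in> borel_measurable borel"
proof (rule borel_measurable_continuous_onI, rule continuous_on_compose2 [OF assms])
  show "continuous_on UNIV (\<lambda>z. x + z)"
    by (intro continuous_intros)
qed simp

lemma shift_integrable:
  assumes "continuous_on UNIV f" "\<And>z. \<bar>f z\<bar> \<le> M"
  shows "integrable lborel (\<lambda>z. q z * f (x + z))"
  using assms shift_measurable integrable_mult_bounded by blast

lemma integral_diff_eq:
  assumes "continuous_on UNIV f" "\<And>z. \<bar>f z\<bar> \<le> M"
  shows "(LINT z|lborel. q z * (f (x + z) - f x)) = (LINT z|lborel. q z * f (x + z)) - \<Lambda> * f x"
  using shift_integrable [OF assms] q_int q_mass by (simp add: right_diff_distrib)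

lemma jump_avg_eq:
  assumes "continuous_on UNIV f" "\<And>z. \<bar>f z\<bar> \<le> M"
  shows "jump_avg q \<tau> f x = (1 - \<tau> * \<Lambda>) * f x + \<tau> * (LINT z|lborel. q z * f (x + z))"
  unfolding jump_avg_def integral_diff_eq [OF assms] by (simp add: algebra_simps)

lemma integral_bounds:
  assumes "continuous_on UNIV f" "\<And>z. 0 \<le> f z" "\<And>z. f z \<le> M"
  shows "0 \<le> (LINT z|lborel. q z * f (x + z))" "(LINT z|lborel. q z * f (x + z)) \<le> \<Lambda> * M"
proof -
  have i: "integrable lborel (\<lambda>z. q z * f (x + z))"
    using assms by (intro shift_integrable [where M = M]) auto
  show "0 \<le> (LINT z|lborel. q z * f (x + z))"
    using assms q_nonneg by (intro Bochner_Integration.integral_nonneg) auto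
  have "(LINT z|lborel. q z * f (x + z)) \<le> (LINT z|lborel. q z * M)"
    using assms q_nonneg by (intro integral_mono i integrable_mult_left q_int mult_left_mono) auto
  then show "(LINT z|lborel. q z * f (x + z)) \<le> \<Lambda> * M"
    using q_int q_mass by simp
qed

lemma jump_avg_nonneg:
  assumes "continuous_on UNIV f" "\<And>z. 0 \<le> f z" "\<And>z. f z \<le> M" "0 \<le> \<tau>" "\<tau> * \<Lambda> \<le> 1"
  shows "0 \<le> jump_avg q \<tau> f x"
proof -
  have "\<And>z. \<bar>f z\<bar> \<le> M"
    using assms(2,3) by auto
  from jump_avg_eq [OF assms(1) this, of \<tau> x] show ?thesis
    using assms integral_bounds(1) [OF assms(1-3), of x] by simp
qed

lemma jump_avg_le:
  assumes "continuous_on UNIV f" "\<And>z. 0 \<le> f z" "\<And>z. f z \<le> M" "0 \<le> \<tau>" "\<tau> * \<Lambda> \<le> 1"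
  shows "jump_avg q \<tau> f x \<le> M"
proof -
  have "\<And>z. \<bar>f z\<bar> \<le> M"
    using assms(2,3) by auto
  from jump_avg_eq [OF assms(1) this, of \<tau> x]
  have "jump_avg q \<tau> f x \<le> (1 - \<tau> * \<Lambda>) * M + \<tau> * (\<Lambda> * M)"
    using assms integral_bounds(2) [OF assms(1-3), of x] by (auto intro!: add_mono mult_left_mono)
  then show ?thesis
    by (simp add: algebra_simps)
qed

lemma jump_avg_continuous:
  assumes f: "continuous_on UNIV f" and M: "\<And>z. \<bar>f z\<bar> \<le> M"
  shows "continuous_on UNIV (jump_avg q \<tau> f)"
proof -
  have "continuous_on UNIV (\<lambda>x. LINT z|lborel. q z * f (x + z))"
  proof (rule continuous_on_sequentiallyI)
    fix u :: "nat \<Rightarrow> 'a" and a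
    assume u: "u \<longlonglongrightarrow> a"
    show "(\<lambda>n. LINT z|lborel. q z * f (u n + z)) \<longlonglongrightarrow> (LINT z|lborel. q z * f (a + z))"
    proof (rule integral_dominated_convergence)
      show "integrable lborel (\<lambda>z. M * q z)"
        by (intro integrable_mult_right q_int)
      show "AE z in lborel. (\<lambda>n. q z * f (u n + z)) \<longlonglongrightarrow> q z * f (a + z)"
        using f u by (intro always_eventually allI tendsto_intros continuous_on_tendsto_compose [OF f]) auto
      show "AE z in lborel. norm (q z * f (u n + z)) \<le> M * q z" for n
        using mult_left_mono [OF M q_nonneg] q_nonneg by (intro always_eventually allI) (simp add: abs_mult mult.commute)
      show "(\<lambda>z. q z * f (a + z)) \<in> borel_measurable lborel" "\<And>n. (\<lambda>z. q z * f (u n + z)) \<in> borel_measurable lborel"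
        using shift_integrable [OF f M] by (auto intro: borel_measurable_integrable)
    qed
  qed
  then have "continuous_on UNIV (\<lambda>x. (1 - \<tau> * \<Lambda>) * f x + \<tau> * (LINT z|lborel. q z * f (x + z)))"
    by (intro continuous_intros f)
  then show ?thesis
    using jump_avg_eq [OF f M] by presburger
qed

lemma jump_avg_second_diff:
  assumes f: "continuous_on UNIV f" and M: "\<And>z. \<bar>f z\<bar> \<le> M"
    and c: "\<And>x. second_diff f x h \<le> c" and \<tau>: "0 \<le> \<tau>" "\<tau> * \<Lambda> \<le> 1"
  shows "second_diff (jump_avg q \<tau> f) x h \<le> c"
proof -
  have i: "integrable lborel (\<lambda>z. q z * f (y + z))" for y
    by (rule shift_integrable [OF f M])
  have "(LINT z|lborel. q z * f (x + h + z)) + (LINT z|lborel. q z * f (x - h + z))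
      - 2 * (LINT z|lborel. q z * f (x + z)) = (LINT z|lborel. q z * second_diff f (x + z) h)"
  proof -
    have "(LINT z|lborel. q z * second_diff f (x + z) h)
      = (LINT z|lborel. (q z * f (x + h + z) + q z * f (x - h + z)) - 2 * (q z * f (x + z)))"
      by (rule Bochner_Integration.integral_cong) (auto simp: second_diff_def algebra_simps)
    also have "\<dots> = (LINT z|lborel. q z * f (x + h + z)) + (LINT z|lborel. q z * f (x - h + z))
      - 2 * (LINT z|lborel. q z * f (x + z))"
      using i by simp
    finally show ?thesis
      by simp
  qed
  also have "\<dots> \<le> (LINT z|lborel. q z * c)"
  proof (rule integral_mono)
    have "integrable lborel (\<lambda>z. (q z * f (x + h + z) + q z * f (x - h + z)) - 2 * (q z * f (x + z)))"
      using i by (intro Bochner_Integration.integrable_diff Bochner_Integration.integrable_add integrable_mult_right)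
    then show "integrable lborel (\<lambda>z. q z * second_diff f (x + z) h)"
      by (rule back_subst [where P = "integrable lborel"]) (auto simp: second_diff_def algebra_simps fun_eq_iff)
  qed (use q_int q_nonneg c in \<open>auto intro: mult_left_mono\<close>)
  also have "\<dots> = \<Lambda> * c"
    using q_int q_mass by simp
  finally have *: "(LINT z|lborel. q z * f (x + h + z)) + (LINT z|lborel. q z * f (x - h + z))
      - 2 * (LINT z|lborel. q z * f (x + z)) \<le> \<Lambda> * c" .
  have "second_diff (jump_avg q \<tau> f) x h = (1 - \<tau> * \<Lambda>) * second_diff f x h
      + \<tau> * ((LINT z|lborel. q z * f (x + h + z)) + (LINT z|lborel. q z * f (x - h + z))
      - 2 * (LINT z|lborel. q z * f (x + z)))"
    unfolding second_diff_def jump_avg_eq [OF f M] by (simp add: algebra_simps)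
  also have "\<dots> \<le> (1 - \<tau> * \<Lambda>) * c + \<tau> * (\<Lambda> * c)"
    using * \<tau> c by (intro add_mono mult_left_mono) auto
  finally show ?thesis
    by (simp add: algebra_simps)
qed

lemma jump_avg_mass:
  assumes f: "continuous_on UNIV f" and f0: "\<And>z. 0 \<le> f z" and M: "\<And>z. f z \<le> M"
    and \<tau>: "0 \<le> \<tau>" "\<tau> * \<Lambda> \<le> 1"
  shows "(\<integral>\<^sup>+x. ennreal (jump_avg q \<tau> f x) \<partial>lborel) = (\<integral>\<^sup>+x. ennreal (f x) \<partial>lborel)"
proof -
  have aM: "\<And>z. \<bar>f z\<bar> \<le> M"
    using f0 M by auto
  have [measurable]: "f \<in> borel_measurable borel"
    using f by (rule borel_measurable_continuous_onI)
  have [measurable]: "q \<in> borel_measurable borel"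
    using q_int by auto
  have i: "integrable lborel (\<lambda>z. q z * f (x + z))" for x
    by (rule shift_integrable [OF f aM])
  have "(\<integral>\<^sup>+x. ennreal (LINT z|lborel. q z * f (x + z)) \<partial>lborel)
      = (\<integral>\<^sup>+x. (\<integral>\<^sup>+z. ennreal (q z) * ennreal (f (x + z)) \<partial>lborel) \<partial>lborel)"
    using f0 q_nonneg
    by (intro nn_integral_cong, subst nn_integral_eq_integral [OF i, symmetric]) (auto simp: ennreal_mult)
  also have "\<dots> = (\<integral>\<^sup>+z. (\<integral>\<^sup>+x. ennreal (q z) * ennreal (f (x + z)) \<partial>lborel) \<partial>lborel)"
    by (rule lborel_pair.Fubini') measurable
  also have "\<dots> = (\<integral>\<^sup>+z. ennreal (q z) * (\<integral>\<^sup>+x. ennreal (f x) \<partial>lborel) \<partial>lborel)"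
  proof (rule nn_integral_cong)
    fix z
    have "(\<integral>\<^sup>+x. ennreal (f (x + z)) \<partial>lborel) = (\<integral>\<^sup>+x. ennreal (f x) \<partial>distr lborel borel ((+) z))"
      by (subst nn_integral_distr) (auto simp: add.commute)
    also have "\<dots> = (\<integral>\<^sup>+x. ennreal (f x) \<partial>lborel)"
      by (simp add: lborel_distr_plus)
    finally show "(\<integral>\<^sup>+x. ennreal (q z) * ennreal (f (x + z)) \<partial>lborel)
        = ennreal (q z) * (\<integral>\<^sup>+x. ennreal (f x) \<partial>lborel)"
      by (simp add: nn_integral_cmult)
  qed
  also have "\<dots> = (\<integral>\<^sup>+z. ennreal (q z) \<partial>lborel) * (\<integral>\<^sup>+x. ennreal (f x) \<partial>lborel)"
    by (rule nn_integral_multc) measurable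
  also have "(\<integral>\<^sup>+z. ennreal (q z) \<partial>lborel) = ennreal \<Lambda>"
    using q_int q_nonneg q_mass by (simp add: nn_integral_eq_integral)
  finally have *: "(\<integral>\<^sup>+x. ennreal (LINT z|lborel. q z * f (x + z)) \<partial>lborel)
      = ennreal \<Lambda> * (\<integral>\<^sup>+x. ennreal (f x) \<partial>lborel)" .
  have [measurable]: "(\<lambda>x. LINT z|lborel. q z * f (x + z)) \<in> borel_measurable lborel"
    by measurable
  have "(\<integral>\<^sup>+x. ennreal (jump_avg q \<tau> f x) \<partial>lborel)
      = (\<integral>\<^sup>+x. ennreal (1 - \<tau> * \<Lambda>) * ennreal (f x) + ennreal \<tau> * ennreal (LINT z|lborel. q z * f (x + z)) \<partial>lborel)"
    unfolding jump_avg_eq [OF f aM]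
    using \<tau> f0 integral_bounds(1) [OF f f0 M]
    by (intro nn_integral_cong) (simp add: ennreal_mult ennreal_plus)
  also have "\<dots> = ennreal (1 - \<tau> * \<Lambda>) * (\<integral>\<^sup>+x. ennreal (f x) \<partial>lborel)
      + ennreal \<tau> * (ennreal \<Lambda> * (\<integral>\<^sup>+x. ennreal (f x) \<partial>lborel))"
    by (simp add: nn_integral_add nn_integral_cmult *)
  also have "\<dots> = (ennreal (1 - \<tau> * \<Lambda>) + ennreal (\<tau> * \<Lambda>)) * (\<integral>\<^sup>+x. ennreal (f x) \<partial>lborel)"
    using \<tau> mass_nonneg by (simp add: ennreal_mult distrib_right mult.assoc)
  also have "ennreal (1 - \<tau> * \<Lambda>) + ennreal (\<tau> * \<Lambda>) = 1"
    using \<tau> mass_nonneg by (subst ennreal_plus [symmetric]) auto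
  finally show ?thesis
    by simp
qed

text \<open>
  How mass controls the supremum: jumps into \<open>A\<close> have a bounded density, so they carry at most \<open>P * m\<close> to
  any single point, while all other parts of the average are bounded by \<open>S\<close>. Since the jumps into \<open>A\<close> occur at
  rate at least \<open>\<Lambda>A\<close>, the old supremum is damped by the factor \<open>1 - \<tau> * \<Lambda>A\<close> in each step.
\<close>

lemma jump_avg_sup_decay:
  assumes f: "continuous_on UNIV f" and f0: "\<And>z. 0 \<le> f z" and S: "\<And>z. f z \<le> S"
    and \<tau>: "0 \<le> \<tau>" "\<tau> * \<Lambda> \<le> 1"
    and A [measurable]: "A \<in> sets borel" and P: "\<And>z. z \<in> A \<Longrightarrow> q z \<le> P" "0 \<le> P"
    and \<Lambda>A: "\<Lambda>A \<le> (LINT z|lborel. indicator A z * q z)"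
    and m: "(\<integral>\<^sup>+x. ennreal (f x) \<partial>lborel) \<le> ennreal m" "0 \<le> m"
  shows "jump_avg q \<tau> f x \<le> (1 - \<tau> * \<Lambda>A) * S + \<tau> * (P * m)"
proof -
  have aM: "\<And>z. \<bar>f z\<bar> \<le> S"
    using f0 S by auto
  have S0: "0 \<le> S"
    using f0 [of x] S [of x] by linarith
  have [measurable]: "f \<in> borel_measurable borel"
    using f by (rule borel_measurable_continuous_onI)
  have [measurable]: "q \<in> borel_measurable borel"
    using q_int by auto
  have i: "integrable lborel (\<lambda>z. q z * f (x + z))"
    by (rule shift_integrable [OF f aM])
  have fx: "integrable lborel (\<lambda>z. f (x + z))" "(LINT z|lborel. f (x + z)) \<le> m"
  proof -
    have "(\<integral>\<^sup>+z. ennreal (f (x + z)) \<partial>lborel) = (\<integral>\<^sup>+y. ennreal (f y) \<partial>distr lborel borel ((+) x))"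
      by (subst nn_integral_distr) auto
    also have "\<dots> \<le> ennreal m"
      using m by (simp add: lborel_distr_plus)
    finally have *: "(\<integral>\<^sup>+z. ennreal (f (x + z)) \<partial>lborel) \<le> ennreal m" .
    show "integrable lborel (\<lambda>z. f (x + z))"
      using * f0 by (intro integrableI_bounded) (auto simp: le_less_trans)
    then show "(LINT z|lborel. f (x + z)) \<le> m"
      using * f0 m(2) nn_integral_eq_integral [of lborel "\<lambda>z. f (x + z)"] by simp
  qed
  have qA: "integrable lborel (\<lambda>z. indicator A z * q z)"
    by (rule Bochner_Integration.integrable_bound [OF q_int]) (auto simp: indicator_def)
  have "(LINT z|lborel. q z * f (x + z)) \<le> (LINT z|lborel. S * (q z - indicator A z * q z) + P * f (x + z))"
  proof (rule integral_mono [OF i])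
    show "integrable lborel (\<lambda>z. S * (q z - indicator A z * q z) + P * f (x + z))"
      using qA q_int fx by (intro Bochner_Integration.integrable_add integrable_mult_right Bochner_Integration.integrable_diff)
    fix z
    show "q z * f (x + z) \<le> S * (q z - indicator A z * q z) + P * f (x + z)"
    proof (cases "z \<in> A")
      case True
      then show ?thesis
        using mult_right_mono [OF P(1) f0] by simp
    next
      case False
      have "q z * f (x + z) \<le> S * q z"
        unfolding mult.commute [of S] by (rule mult_left_mono [OF S q_nonneg])
      moreover have "0 \<le> P * f (x + z)"
        using P(2) f0 by simp
      ultimately show ?thesis
        using False by simp
    qed
  qed
  also have "\<dots> = S * (\<Lambda> - (LINT z|lborel. indicator A z * q z)) + P * (LINT z|lborel. f (x + z))"
    using qA q_int fx q_mass by simp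
  also have "\<dots> \<le> S * (\<Lambda> - \<Lambda>A) + P * m"
    using \<Lambda>A S0 fx(2) P(2) by (intro add_mono mult_left_mono) auto
  finally have *: "(LINT z|lborel. q z * f (x + z)) \<le> S * (\<Lambda> - \<Lambda>A) + P * m" .
  have "jump_avg q \<tau> f x = (1 - \<tau> * \<Lambda>) * f x + \<tau> * (LINT z|lborel. q z * f (x + z))"
    by (rule jump_avg_eq [OF f aM])
  also have "\<dots> \<le> (1 - \<tau> * \<Lambda>) * S + \<tau> * (S * (\<Lambda> - \<Lambda>A) + P * m)"
    using * \<tau> S by (intro add_mono mult_left_mono) auto
  finally show ?thesis
    by (simp add: algebra_simps)
qed

text \<open>
  The consistency error of the Euler step.
\<close>

lemma jump_avg_generator_le:
  assumes f: "continuous_on UNIV f" and f0: "\<And>z. 0 \<le> f z" and M: "\<And>z. f z \<le> M" and \<tau>: "0 \<le> \<tau>"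
  shows "(LINT z|lborel. q z * (jump_avg q \<tau> f (x + z) - jump_avg q \<tau> f x))
    \<le> (LINT z|lborel. q z * (f (x + z) - f x)) + 2 * \<tau> * \<Lambda>\<^sup>2 * M"
proof -
  have aM: "\<And>z. \<bar>f z\<bar> \<le> M"
    using f0 M by auto
  have M0: "0 \<le> M"
    using f0 [of x] M [of x] by linarith
  define g where "g y = jump_avg q \<tau> f y - f y" for y
  have gc: "continuous_on UNIV g"
    unfolding g_def by (intro continuous_intros f jump_avg_continuous [OF f aM])
  have gb: "\<bar>g y\<bar> \<le> \<tau> * (\<Lambda> * M)" for y
  proof -
    have "\<Lambda> * f y \<le> \<Lambda> * M" "0 \<le> \<Lambda> * f y"
      using M f0 mass_nonneg by (auto intro: mult_left_mono)
    then have "\<bar>(LINT z|lborel. q z * f (y + z)) - \<Lambda> * f y\<bar> \<le> \<Lambda> * M"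
      using integral_bounds [OF f f0 M, of y] by linarith
    then show ?thesis
      unfolding g_def jump_avg_def integral_diff_eq [OF f aM] using \<tau> by (simp add: abs_mult mult_left_mono)
  qed
  have gi: "integrable lborel (\<lambda>z. q z * (g (x + z) - g x))"
  proof (rule integrable_mult_bounded)
    show "(\<lambda>z. g (x + z) - g x) \<in> borel_measurable borel"
      by (intro borel_measurable_diff shift_measurable gc borel_measurable_const)
    show "\<bar>g (x + z) - g x\<bar> \<le> 2 * (\<tau> * (\<Lambda> * M))" for z
      using gb [of "x + z"] gb [of x] by linarith
  qed
  have fi: "integrable lborel (\<lambda>z. q z * (f (x + z) - f x))"
  proof (rule integrable_mult_bounded)
    show "(\<lambda>z. f (x + z) - f x) \<in> borel_measurable borel"
      by (intro borel_measurable_diff shift_measurable f borel_measurable_const)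
    show "\<bar>f (x + z) - f x\<bar> \<le> 2 * M" for z
      using aM [of "x + z"] aM [of x] by linarith
  qed
  have "(LINT z|lborel. q z * (jump_avg q \<tau> f (x + z) - jump_avg q \<tau> f x))
      = (LINT z|lborel. q z * (f (x + z) - f x) + q z * (g (x + z) - g x))"
    by (rule Bochner_Integration.integral_cong) (auto simp: g_def algebra_simps)
  also have "\<dots> = (LINT z|lborel. q z * (f (x + z) - f x)) + (LINT z|lborel. q z * (g (x + z) - g x))"
    by (rule Bochner_Integration.integral_add [OF fi gi])
  also have "(LINT z|lborel. q z * (g (x + z) - g x)) \<le> (LINT z|lborel. q z * (2 * (\<tau> * (\<Lambda> * M))))"
  proof (rule integral_mono [OF gi])
    show "integrable lborel (\<lambda>z. q z * (2 * (\<tau> * (\<Lambda> * M))))"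
      by (intro integrable_mult_left q_int)
    fix z
    have "g (x + z) - g x \<le> 2 * (\<tau> * (\<Lambda> * M))"
      using gb [of "x + z"] gb [of x] by linarith
    then show "q z * (g (x + z) - g x) \<le> q z * (2 * (\<tau> * (\<Lambda> * M)))"
      using q_nonneg by (rule mult_left_mono)
  qed
  also have "(LINT z|lborel. q z * (2 * (\<tau> * (\<Lambda> * M)))) = 2 * \<tau> * \<Lambda>\<^sup>2 * M"
    using q_int q_mass by (simp add: power2_eq_square)
  finally show ?thesis
    by simp
qed

end

section \<open>Infimal convolution\<close>

lemma uniformly_continuous_on_UNIV_compact_support:
  fixes g :: "'a::heine_borel \<Rightarrow> real"
  assumes g: "continuous_on UNIV g" and out: "\<And>x. x \<notin> cball a \<rho> \<Longrightarrow> g x = 0"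
  shows "uniformly_continuous_on UNIV g"
  unfolding uniformly_continuous_on_def
proof (intro allI impI)
  fix e :: real
  assume e: "0 < e"
  have "uniformly_continuous_on (cball a (\<rho> + 1)) g"
    by (intro compact_uniformly_continuous continuous_on_subset [OF g]) auto
  then obtain d where d: "0 < d"
    "\<And>x y. x \<in> cball a (\<rho> + 1) \<Longrightarrow> y \<in> cball a (\<rho> + 1) \<Longrightarrow> dist y x < d \<Longrightarrow> dist (g y) (g x) < e"
    using e unfolding uniformly_continuous_on_def by metis
  show "\<exists>d>0. \<forall>x\<in>UNIV. \<forall>x'\<in>UNIV. dist x' x < d \<longrightarrow> dist (g x') (g x) < e"
  proof (intro exI [of _ "min d 1"] conjI ballI impI)
    fix x y :: 'a
    assume xy: "dist y x < min d 1"
    show "dist (g y) (g x) < e"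
    proof (cases "x \<in> cball a \<rho> \<or> y \<in> cball a \<rho>")
      case True
      have "dist a y \<le> dist a x + dist y x" "dist a x \<le> dist a y + dist y x"
        by (metis dist_commute dist_triangle)+
      then have "x \<in> cball a (\<rho> + 1)" "y \<in> cball a (\<rho> + 1)"
        using True xy by auto
      then show ?thesis
        using d(2) xy by simp
    next
      case False
      then show ?thesis
        using out e by simp
    qed
  qed (use d in simp)
qed

text \<open>
  Turns a uniformly continuous function into a semiconcave one that lies below it, so that its mass does not
  grow, and that is uniformly close to it for large \<open>n\<close>.
\<close>

definition inf_conv :: "real \<Rightarrow> ('a::euclidean_space \<Rightarrow> real) \<Rightarrow> 'a \<Rightarrow> real"
  where "inf_conv n g x = (INF y. g y + n * (norm (x - y))\<^sup>2)"

context
  fixes g :: "'a::euclidean_space \<Rightarrow> real" and n :: real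
  assumes g0: "\<And>y. 0 \<le> g y" and n: "0 \<le> n"
begin

lemma inf_conv_bdd: "bdd_below (range (\<lambda>y. g y + n * (norm (x - y))\<^sup>2))"
  by (rule bdd_belowI [of _ 0]) (use g0 n in auto)

lemma inf_conv_lower: "inf_conv n g x \<le> g y + n * (norm (x - y))\<^sup>2"
  unfolding inf_conv_def by (rule cINF_lower [OF inf_conv_bdd]) auto

lemma inf_conv_le: "inf_conv n g x \<le> g x"
  using inf_conv_lower [of x x] by simp

lemma inf_conv_greatest:
  assumes "\<And>y. b \<le> g y + n * (norm (x - y))\<^sup>2"
  shows "b \<le> inf_conv n g x"
  unfolding inf_conv_def by (rule cINF_greatest) (use assms in auto)

lemma inf_conv_nonneg: "0 \<le> inf_conv n g x"
  by (rule inf_conv_greatest) (use g0 n in auto)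

text \<open>
  An infimum of paraboloids of equal curvature: the paraboloid that almost touches at \<open>x\<close> bounds the values at
  \<open>x + z\<close> and \<open>x - z\<close>.
\<close>

lemma inf_conv_second_diff: "second_diff (inf_conv n g) x z \<le> 2 * n * (norm z)\<^sup>2"
proof -
  have "(inf_conv n g (x + z) + inf_conv n g (x - z)) / 2 - n * (norm z)\<^sup>2 \<le> inf_conv n g x"
  proof (rule inf_conv_greatest)
    fix y
    have "inf_conv n g (x + z) + inf_conv n g (x - z)
        \<le> (g y + n * (norm (x + z - y))\<^sup>2) + (g y + n * (norm (x - z - y))\<^sup>2)"
      by (intro add_mono inf_conv_lower)
    also have "(norm (x + z - y))\<^sup>2 = (norm (x - y))\<^sup>2 + 2 * ((x - y) \<bullet> z) + (norm z)\<^sup>2"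
      by (simp add: power2_norm_eq_inner inner_simps inner_commute algebra_simps)
    also have "(norm (x - z - y))\<^sup>2 = (norm (x - y))\<^sup>2 - 2 * ((x - y) \<bullet> z) + (norm z)\<^sup>2"
      by (simp add: power2_norm_eq_inner inner_simps inner_commute algebra_simps)
    finally show "(inf_conv n g (x + z) + inf_conv n g (x - z)) / 2 - n * (norm z)\<^sup>2
        \<le> g y + n * (norm (x - y))\<^sup>2"
      by (simp add: algebra_simps)
  qed
  then show ?thesis
    by (simp add: second_diff_def algebra_simps)
qed

lemma inf_conv_shift:
  assumes "\<And>y. g y \<le> g (y + h) + e"
  shows "inf_conv n g x \<le> inf_conv n g (x + h) + e"
proof -
  have "inf_conv n g x - e \<le> inf_conv n g (x + h)"
  proof (rule inf_conv_greatest)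
    fix y
    have "inf_conv n g x \<le> g (y - h) + n * (norm (x - (y - h)))\<^sup>2"
      by (rule inf_conv_lower)
    moreover have "g (y - h) \<le> g y + e"
      using assms [of "y - h"] by simp
    moreover have "x - (y - h) = x + h - y"
      by simp
    ultimately show "inf_conv n g x - e \<le> g y + n * (norm (x + h - y))\<^sup>2"
      by simp
  qed
  then show ?thesis
    by simp
qed

lemma inf_conv_continuous:
  assumes "uniformly_continuous_on UNIV g"
  shows "continuous_on UNIV (inf_conv n g)"
  unfolding continuous_on_iff
proof (intro ballI allI impI)
  fix x and e :: real
  assume e: "0 < e"
  obtain d where d: "0 < d" "\<And>y y'. dist y' y < d \<Longrightarrow> dist (g y') (g y) < e / 2"
    using assms e unfolding uniformly_continuous_on_def by (metis UNIV_I half_gt_zero)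
  have close: "inf_conv n g a \<le> inf_conv n g b + e / 2" if "dist a b < d" for a b
  proof -
    have "inf_conv n g a \<le> inf_conv n g (a + (b - a)) + e / 2"
    proof (rule inf_conv_shift)
      fix y
      have "dist (y + (b - a)) y < d"
        using that by (simp add: dist_norm norm_minus_commute)
      from d(2) [OF this] show "g y \<le> g (y + (b - a)) + e / 2"
        unfolding dist_real_def by linarith
    qed
    then show ?thesis
      by simp
  qed
  show "\<exists>d>0. \<forall>x'\<in>UNIV. dist x' x < d \<longrightarrow> dist (inf_conv n g x') (inf_conv n g x) < e"
  proof (intro exI [of _ d] conjI ballI impI)
    fix x'
    assume "dist x' x < d"
    then have "inf_conv n g x' \<le> inf_conv n g x + e / 2" "inf_conv n g x \<le> inf_conv n g x' + e / 2"
      using close [of x' x] close [of x x'] by (simp_all add: dist_commute)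
    then show "dist (inf_conv n g x') (inf_conv n g x) < e"
      using e unfolding dist_real_def by linarith
  qed (rule d(1))
qed

end

lemma inf_conv_approx:
  fixes g :: "'a::euclidean_space \<Rightarrow> real"
  assumes g0: "\<And>y. 0 \<le> g y" and M: "\<And>y. g y \<le> M" and uc: "uniformly_continuous_on UNIV g" and \<zeta>: "0 < \<zeta>"
  obtains n where "0 \<le> n" "\<And>x. g x \<le> inf_conv n g x + \<zeta>"
proof -
  obtain d where d: "0 < d" "\<And>y y'. dist y' y < d \<Longrightarrow> dist (g y') (g y) < \<zeta>"
    using uc \<zeta> unfolding uniformly_continuous_on_def by (metis UNIV_I)
  define n where "n = M / d\<^sup>2"
  have M0: "0 \<le> M"
    using g0 M order_trans by blast
  then have n: "0 \<le> n"
    using d by (simp add: n_def)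
  have "g x \<le> inf_conv n g x + \<zeta>" for x
  proof -
    have "g x - \<zeta> \<le> inf_conv n g x"
    proof (rule inf_conv_greatest [OF g0 n])
      fix y
      show "g x - \<zeta> \<le> g y + n * (norm (x - y))\<^sup>2"
      proof (cases "dist x y < d")
        case True
        then have "g x - \<zeta> \<le> g y"
          using d(2) [of x y] by (simp add: dist_real_def)
        moreover have "0 \<le> n * (norm (x - y))\<^sup>2"
          using n by simp
        ultimately show ?thesis
          by linarith
      next
        case False
        then have "d\<^sup>2 \<le> (norm (x - y))\<^sup>2"
          using d(1) by (intro power_mono) (auto simp: dist_norm)
        then have "n * d\<^sup>2 \<le> n * (norm (x - y))\<^sup>2"
          using n by (rule mult_left_mono)
        then have "M \<le> n * (norm (x - y))\<^sup>2"
          using d(1) by (simp add: n_def)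
        then show ?thesis
          using M [of x] g0 [of y] \<zeta> by linarith
      qed
    qed
    then show ?thesis
      by simp
  qed
  then show ?thesis
    using that n by blast
qed

section \<open>Comparison under one-sided semicontinuity\<close>

text \<open>
  Suppose that \<open>\<phi>\<close> reaches a positive value \<open>\<gamma>\<close> at time \<open>t\<close>, and go back to the infimum \<open>\<tau>\<close> of the times from which on
  the maximum stays at \<open>\<gamma>\<close> or above. Semicontinuity from the right shows that it is still so at \<open>\<tau>\<close>; but then
  the maximum is even larger immediately before \<open>\<tau>\<close>. The argument runs backwards in time because it is applied
  with semicontinuity from the right only, that is, with control of the emergence of spikes and not of their
  disappearance.
\<close>

lemma right_usc_comparison:
  fixes \<phi> :: "'a::metric_space \<Rightarrow> real \<Rightarrow> real"
  assumes D: "compact D"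
    and cont: "\<And>t. t1 \<le> t \<Longrightarrow> t \<le> t2 \<Longrightarrow> continuous_on D (\<lambda>x. \<phi> x t)"
    and init: "\<And>x. x \<in> D \<Longrightarrow> \<phi> x t1 \<le> 0"
    and rusc: "\<And>x t X S \<gamma>. x \<in> D \<Longrightarrow> t1 \<le> t \<Longrightarrow> t < t2 \<Longrightarrow> (\<And>i. X i \<in> D) \<Longrightarrow> X \<longlonglongrightarrow> x \<Longrightarrow>
      (\<And>i::nat. t < S i) \<Longrightarrow> (\<And>i. S i \<le> t2) \<Longrightarrow> S \<longlonglongrightarrow> t \<Longrightarrow> 0 < \<gamma> \<Longrightarrow>
      (\<And>i. \<gamma> \<le> \<phi> (X i) (S i)) \<Longrightarrow> \<gamma> \<le> \<phi> x t"
    and dec: "\<And>x t. x \<in> D \<Longrightarrow> t1 < t \<Longrightarrow> t \<le> t2 \<Longrightarrow> 0 < \<phi> x t \<Longrightarrow> (\<And>y. y \<in> D \<Longrightarrow> \<phi> y t \<le> \<phi> x t) \<Longrightarrow>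
      \<exists>\<eta>>0. \<forall>r. t - \<eta> < r \<and> r < t \<and> t1 \<le> r \<longrightarrow> \<phi> x t < \<phi> x r"
    and x: "x \<in> D" and t: "t1 \<le> t" "t \<le> t2"
  shows "\<phi> x t \<le> 0"
proof (rule ccontr)
  assume "\<not> \<phi> x t \<le> 0"
  then have \<gamma>: "0 < \<phi> x t"
    by simp
  define \<gamma> where "\<gamma> = \<phi> x t"
  define P where "P r \<longleftrightarrow> (\<exists>y\<in>D. \<gamma> \<le> \<phi> y r)" for r
  define A where "A = {r. t1 \<le> r \<and> r \<le> t \<and> (\<forall>q. r \<le> q \<and> q \<le> t \<longrightarrow> P q)}"
  have tA: "t \<in> A"
    using t x by (auto simp: A_def P_def \<gamma>_def)
  have A_bdd: "bdd_below A"
    by (rule bdd_belowI [of _ t1]) (auto simp: A_def)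
  define \<tau> where "\<tau> = Inf A"
  have \<tau>: "t1 \<le> \<tau>" "\<tau> \<le> t"
    unfolding \<tau>_def using tA A_bdd by (auto intro!: cInf_greatest cInf_lower simp: A_def)
  have P_above: "P q" if q: "\<tau> < q" "q \<le> t" for q
  proof -
    obtain r where "r \<in> A" "r < q"
      using q(1) tA cInf_lessD [of A q] unfolding \<tau>_def by auto
    then show ?thesis
      using q by (auto simp: A_def)
  qed
  have P\<tau>: "P \<tau>"
  proof (cases "\<tau> = t")
    case True
    then show ?thesis
      using tA by (auto simp: A_def)
  next
    case False
    then have lt: "\<tau> < t"
      using \<tau> by simp
    define S where "S i = \<tau> + (t - \<tau>) / real (Suc i)" for i
    have S: "\<tau> < S i" "S i \<le> t" for i
    proof -
      show "\<tau> < S i"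
        using lt by (simp add: S_def)
      have "(t - \<tau>) / real (Suc i) \<le> (t - \<tau>) / 1"
        using lt by (intro divide_left_mono) auto
      then show "S i \<le> t"
        by (simp add: S_def)
    qed
    have S_lim: "S \<longlonglongrightarrow> \<tau>"
    proof -
      have "(\<lambda>i. \<tau> + (t - \<tau>) * inverse (real (Suc i))) \<longlonglongrightarrow> \<tau> + (t - \<tau>) * 0"
        by (intro tendsto_intros LIMSEQ_inverse_real_of_nat)
      then show ?thesis
        by (simp add: S_def [abs_def] divide_inverse)
    qed
    have "\<forall>i. \<exists>y\<in>D. \<gamma> \<le> \<phi> y (S i)"
      using P_above S by (simp add: P_def)
    then obtain X where X: "\<And>i. X i \<in> D" "\<And>i. \<gamma> \<le> \<phi> (X i) (S i)"
      by metis
    obtain y r where y: "y \<in> D" "strict_mono (r :: nat \<Rightarrow> nat)" "(X \<circ> r) \<longlonglongrightarrow> y"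
      using D X(1) unfolding compact_def by metis
    have "\<gamma> \<le> \<phi> y \<tau>"
    proof (rule rusc [OF y(1) \<tau>(1), of "X \<circ> r" "S \<circ> r"])
      show "\<tau> < t2"
        using lt t by simp
      show "(S \<circ> r) \<longlonglongrightarrow> \<tau>"
        using S_lim y(2) by (rule LIMSEQ_subseq_LIMSEQ)
      show "(S \<circ> r) i \<le> t2" for i
        using S(2) [of "r i"] t by simp
    qed (use X y S \<gamma> in \<open>auto simp: \<gamma>_def\<close>)
    then show ?thesis
      using y(1) by (auto simp: P_def)
  qed
  have \<tau>t1: "t1 < \<tau>"
  proof (rule ccontr)
    assume "\<not> t1 < \<tau>"
    then have "\<tau> = t1"
      using \<tau> by simp
    with P\<tau> init show False
      using \<gamma> by (force simp: P_def \<gamma>_def)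
  qed
  have "D \<noteq> {}"
    using x by auto
  then obtain y where y: "y \<in> D" "\<And>z. z \<in> D \<Longrightarrow> \<phi> z \<tau> \<le> \<phi> y \<tau>"
    using continuous_attains_sup [OF D, of "\<lambda>x. \<phi> x \<tau>"] cont [of \<tau>] \<tau> t by auto
  have y\<gamma>: "\<gamma> \<le> \<phi> y \<tau>"
    using P\<tau> y(2) order_trans unfolding P_def by blast
  have "\<exists>\<eta>>0. \<forall>r. \<tau> - \<eta> < r \<and> r < \<tau> \<and> t1 \<le> r \<longrightarrow> \<phi> y \<tau> < \<phi> y r"
    by (rule dec) (use y \<tau>t1 \<tau> t y\<gamma> \<gamma> in \<open>auto simp: \<gamma>_def\<close>)
  then obtain \<eta> where \<eta>: "0 < \<eta>" "\<And>r. \<tau> - \<eta> < r \<Longrightarrow> r < \<tau> \<Longrightarrow> t1 \<le> r \<Longrightarrow> \<phi> y \<tau> < \<phi> y r"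
    by blast
  define r where "r = max t1 (\<tau> - \<eta> / 2)"
  have r: "t1 \<le> r" "r < \<tau>" "\<tau> - \<eta> < r"
    using \<tau>t1 \<eta>(1) by (auto simp: r_def)
  have "P q" if q: "r \<le> q" "q \<le> t" for q
  proof -
    consider "q < \<tau>" | "q = \<tau>" | "\<tau> < q"
      by linarith
    then show ?thesis
    proof cases
      case 1
      then have "\<phi> y \<tau> < \<phi> y q"
        using q r by (intro \<eta>(2)) auto
      then show ?thesis
        using y\<gamma> y(1) unfolding P_def by (intro bexI [of _ y]) auto
    qed (use P\<tau> P_above q in auto)
  qed
  then have "r \<in> A"
    using r \<tau> by (auto simp: A_def)
  then have "\<tau> \<le> r"
    unfolding \<tau>_def using A_bdd by (rule cInf_lower)
  with r show False
    by simp
qed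

section \<open>The negative part of an antisymmetric supersolution\<close>

text \<open>
  The constant \<open>M\<close> is the height above which a barrier need not be compared with the negative part of \<open>w\<close>.
\<close>

locale half_space_supersolution =
  fixes k :: "'n::finite" and s l tbar \<sigma> M C :: real
    and \<Omega> :: "(real ^ 'n) set" and w c :: "real ^ 'n \<Rightarrow> real \<Rightarrow> real"
  assumes s: "0 < s" "s < 1"
    and \<Omega>_open: "open \<Omega>" and \<Omega>_half: "\<Omega> \<subseteq> half_space k l"
    and w_C11: "tbar \<le> t \<Longrightarrow> C11_loc \<Omega> (\<lambda>x. w x t)" and w_L2s: "tbar \<le> t \<Longrightarrow> L_2s s (\<lambda>x. w x t)"
    and w_time: "C1_on {tbar..} (w x)"
    and M: "0 < M" and w_bounded: "x \<in> \<Omega> \<Longrightarrow> tbar \<le> t \<Longrightarrow> - M \<le> w x t"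
    and w_lsc: "tbar \<le> t \<Longrightarrow> lower_semicont_on (closure \<Omega>) (\<lambda>x. w x t)"
    and equation: "x \<in> \<Omega> \<Longrightarrow> tbar \<le> t \<Longrightarrow>
      vector_derivative (w x) (at t within {tbar..}) + frac_laplacian s (\<lambda>y. w y t) x = c x t * w x t"
    and exterior: "x \<in> half_space k l - \<Omega> \<Longrightarrow> tbar \<le> t \<Longrightarrow> 0 \<le> w x t"
    and antisym: "x \<in> half_space k l \<Longrightarrow> tbar \<le> t \<Longrightarrow> w x t = - w (reflect k l x) t"
    and \<sigma>: "0 < \<sigma>"
    and c_neg: "x \<in> \<Omega> \<Longrightarrow> tbar \<le> t \<Longrightarrow> w x t < 0 \<Longrightarrow> c x t < - \<sigma>"
    and C: "C = frac_const CARD('n) s"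
begin

definition v :: "real ^ 'n \<Rightarrow> real \<Rightarrow> real"
  where "v x t = max 0 (- w x t)"

lemma C_pos: "0 < C"
  unfolding C using s by (rule frac_const_pos)

lemma v_nonneg [simp]: "0 \<le> v x t"
  by (simp add: v_def)

lemma v_posD:
  assumes "x $ k < l" "tbar \<le> t" "0 < v x t"
  shows "x \<in> \<Omega>" "w x t = - v x t"
proof -
  show "w x t = - v x t"
    using assms(3) by (auto simp: v_def max_def split: if_splits)
  then have "w x t < 0"
    using assms(3) by simp
  then show "x \<in> \<Omega>"
    using assms(1,2) exterior [of x t] by (auto simp: half_space_def not_le [symmetric])
qed

lemma v_le_M:
  assumes "x $ k < l" "tbar \<le> t"
  shows "v x t \<le> M"
proof (cases "0 < v x t")
  case True
  then show ?thesis
    using v_posD [OF assms True] w_bounded [of x t] assms by auto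
next
  case False
  then show ?thesis
    using M v_nonneg [of x t] by linarith
qed

lemma w_tail_integrable: "tbar \<le> t \<Longrightarrow> tail_integrable s (\<lambda>x. w x t)"
  using tail_integrable_L_2s [OF s(1) w_L2s] .

lemma w_continuous_at:
  assumes "x \<in> \<Omega>" "tbar \<le> t"
  shows "isCont (\<lambda>y. w y t) x"
proof -
  obtain g where "GDERIV (\<lambda>y. w y t) x :> g"
    using w_C11 [OF assms(2)] assms(1) unfolding C11_loc_def by blast
  then show ?thesis
    using has_derivative_continuous by (auto simp: gderiv_def)
qed

text \<open>
  In \<open>\<Omega>\<close> this is differentiability of \<open>w\<close>. At the other points of the half space \<open>v\<close> vanishes, and lower semicontinuity of \<open>w\<close>
  keeps \<open>v\<close> small nearby.
\<close>

lemma v_continuous_on: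
  assumes t: "tbar \<le> t"
  shows "continuous_on {x. x $ k < l} (\<lambda>x. v x t)"
  unfolding continuous_on_def
proof (intro ballI)
  fix x
  assume x: "x \<in> {x. x $ k < l}"
  show "((\<lambda>y. v y t) \<longlongrightarrow> v x t) (at x within {x. x $ k < l})"
  proof (cases "x \<in> \<Omega>")
    case True
    then have "((\<lambda>y. w y t) \<longlongrightarrow> w x t) (at x)"
      using w_continuous_at [OF True t] by (simp add: isCont_def)
    then have "((\<lambda>y. w y t) \<longlongrightarrow> w x t) (at x within {x. x $ k < l})"
      by (rule tendsto_within_subset) auto
    then show ?thesis
      unfolding v_def by (intro tendsto_max tendsto_minus tendsto_const)
  next
    case False
    then have w0: "0 \<le> w x t"
      using exterior [of x t] x t by (auto simp: half_space_def)
    then have vx: "v x t = 0"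
      by (simp add: v_def)
    have *: "\<forall>\<^sub>F y in at x within {x. x $ k < l}. v y t < e" if e: "0 < e" for e
    proof (cases "x \<in> closure \<Omega>")
      case True
      then have "\<forall>\<^sub>F y in at x within closure \<Omega>. - e < w y t"
        using w_lsc [OF t] w0 e unfolding lower_semicont_on_def by force
      then have "\<forall>\<^sub>F y in at x. y \<in> closure \<Omega> \<longrightarrow> - e < w y t"
        by (simp add: eventually_at_filter)
      then have "\<forall>\<^sub>F y in at x within {x. x $ k < l}. y \<in> closure \<Omega> \<longrightarrow> - e < w y t"
        by (rule filter_leD [OF at_le, rotated]) simp
      moreover have "\<forall>\<^sub>F y in at x within {x. x $ k < l}. y $ k < l"
        by (auto simp: eventually_at_filter)
      ultimately show ?thesis
      proof eventually_elim
        case (elim y)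
        show ?case
        proof (cases "y \<in> closure \<Omega>")
          case True
          then show ?thesis
            using elim e by (auto simp: v_def)
        next
          case False
          then have "y \<notin> \<Omega>"
            using closure_subset by blast
          then have "0 \<le> w y t"
            using exterior [of y t] elim t by (auto simp: half_space_def)
          then show ?thesis
            using e by (simp add: v_def)
        qed
      qed
    next
      case False
      then have "\<forall>\<^sub>F y in at x. y \<in> - closure \<Omega>"
        using open_Compl [OF closed_closure] by (intro eventually_at_in_open') auto
      then have "\<forall>\<^sub>F y in at x within {x. x $ k < l}. y \<in> - closure \<Omega>"
        by (rule filter_leD [OF at_le, rotated]) simp
      moreover have "\<forall>\<^sub>F y in at x within {x. x $ k < l}. y $ k < l"
        by (auto simp: eventually_at_filter)
      ultimately show ?thesis
      proof eventually_elim
        case (elim y)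
        then have "y \<notin> \<Omega>"
          using closure_subset by blast
        then have "0 \<le> w y t"
          using exterior [of y t] elim t by (auto simp: half_space_def)
        then show ?case
          using e by (simp add: v_def)
      qed
    qed
    show ?thesis
      unfolding vx
    proof (rule order_tendstoI)
      fix a :: real
      assume "a < 0"
      then show "\<forall>\<^sub>F y in at x within {x. x $ k < l}. a < v y t"
        by (intro always_eventually allI) (meson less_le_trans v_nonneg)
    qed (rule *)
  qed
qed

lemma v_lipschitz_in_time:
  obtains B where "0 \<le> B" "\<And>t t'. tbar \<le> t \<Longrightarrow> t \<le> T \<Longrightarrow> tbar \<le> t' \<Longrightarrow> t' \<le> T \<Longrightarrow> \<bar>v x t - v x t'\<bar> \<le> B * \<bar>t - t'\<bar>"
proof -
  obtain f' where f': "\<And>t. tbar \<le> t \<Longrightarrow> (w x has_real_derivative f' t) (at t within {tbar..})"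
    and cont: "continuous_on {tbar..} f'"
    using w_time [of x] unfolding C1_on_def by auto
  have "compact (f' ` {tbar..T})"
    by (intro compact_continuous_image continuous_on_subset [OF cont]) auto
  then obtain B where B: "0 < B" "\<And>t. t \<in> {tbar..T} \<Longrightarrow> \<bar>f' t\<bar> \<le> B"
    using compact_imp_bounded [of "f' ` {tbar..T}"] unfolding bounded_pos by auto
  have wB: "\<bar>w x t - w x t'\<bar> \<le> B * \<bar>t - t'\<bar>"
    if "tbar \<le> t" "t \<le> T" "tbar \<le> t'" "t' \<le> T" for t t'
  proof -
    have "norm (w x t - w x t') \<le> B * norm (t - t')"
    proof (rule field_differentiable_bound [of "{tbar..T}"])
      show "(w x has_field_derivative f' z) (at z within {tbar..T})" if "z \<in> {tbar..T}" for z
        using f' [of z] that by (auto intro: DERIV_subset)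
    qed (use B that in auto)
    then show ?thesis
      by simp
  qed
  have vw: "\<bar>v x t - v x t'\<bar> \<le> \<bar>w x t - w x t'\<bar>" for t t'
    unfolding v_def by linarith
  show ?thesis
  proof (rule that)
    show "0 \<le> B"
      using B by simp
    show "\<bar>v x t - v x t'\<bar> \<le> B * \<bar>t - t'\<bar>" if "tbar \<le> t" "t \<le> T" "tbar \<le> t'" "t' \<le> T" for t t'
      using vw wB [OF that] by (rule order_trans)
  qed
qed

lemma v_time_tendsto:
  assumes "tbar \<le> t" "\<And>i. tbar \<le> S i" "S \<longlonglongrightarrow> t"
  shows "(\<lambda>i. v x (S i)) \<longlonglongrightarrow> v x t"
proof -
  obtain f' where f': "\<And>t. tbar \<le> t \<Longrightarrow> (w x has_real_derivative f' t) (at t within {tbar..})"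
    using w_time [of x] unfolding C1_on_def by auto
  then have "continuous_on {tbar..} (w x)"
    by (intro DERIV_continuous_on) auto
  then have "(\<lambda>i. w x (S i)) \<longlonglongrightarrow> w x t"
    by (rule continuous_on_tendsto_compose) (use assms in auto)
  then show ?thesis
    unfolding v_def by (intro tendsto_intros)
qed

text \<open>
  The maximum principle in the form needed for \<open>right_usc_comparison\<close>. At the maximum of \<open>v - H\<close>, the fractional
  Laplacian of \<open>w\<close> is at most \<open>C * b\<close>, and the zero-order term contributes more than \<open>\<sigma> * v\<close> to
  \<open>\<partial>\<^sub>t w\<close>. The function \<open>h\<close> is the barrier at \<open>x\<close> as a function of time, and \<open>H\<close> is a spatial extension of the barrier
  at time \<open>t\<close>; the extension beyond the hyperplane may be chosen freely within \<open>Hpos\<close>.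
\<close>

lemma decrease_at_touching_point:
  assumes x: "x $ k < l" and t: "tbar < t"
    and H: "tail_integrable s H"
    and Hpos: "\<And>y. y $ k < l \<Longrightarrow> 0 \<le> H y + H (reflect k l y)"
    and Hx: "0 \<le> H x" "H x < v x t"
    and touch: "\<And>y. y $ k < l \<Longrightarrow> v y t - H y \<le> v x t - H x"
    and \<epsilon>0: "0 < \<epsilon>0" and b: "\<And>\<epsilon>. 0 < \<epsilon> \<Longrightarrow> \<epsilon> < \<epsilon>0 \<Longrightarrow> trunc_diffusion s H x \<epsilon> \<le> b"
    and h: "(h has_real_derivative h') (at t)" and h': "C * b - \<sigma> * v x t \<le> h'"
  shows "\<exists>\<eta>>0. \<forall>r. t - \<eta> < r \<and> r < t \<and> tbar \<le> r \<longrightarrow> v x t - h t < v x r - h r"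
proof -
  have v0: "0 < v x t" and t': "tbar \<le> t"
    using Hx t by auto
  have x\<Omega>: "x \<in> \<Omega>" and wx: "w x t = - v x t"
    using v_posD [OF x t' v0] by auto
  have w_ge: "- v y t \<le> w y t" for y
    by (simp add: v_def)
  have L: "frac_laplacian s (\<lambda>y. w y t) x \<le> C * b"
    unfolding C
  proof (rule frac_laplacian_at_touching_point [where ?\<epsilon>0.0 = \<epsilon>0, OF s w_tail_integrable [OF t'] w_C11 [OF t'] \<Omega>_open x\<Omega> x _ H Hpos])
    show "w y t = - w (reflect k l y) t" if "y $ k < l" for y
      using antisym [of y t] that t' by (simp add: half_space_def)
    show "w x t + H x \<le> w y t + H y" if "y $ k < l" for y
      using touch [OF that] w_ge [of y] wx by linarith
  qed (use Hx wx C_pos C \<epsilon>0 b in auto)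
  define d where "d = vector_derivative (w x) (at t within {tbar..})"
  have "(w x has_vector_derivative d) (at t within {tbar..})"
  proof -
    obtain f' where "(w x has_real_derivative f') (at t within {tbar..})"
      using w_time [of x] t' unfolding C1_on_def by auto
    then show ?thesis
      unfolding d_def using vector_derivative_works has_real_derivative_iff_has_vector_derivative
        differentiableI_vector by metis
  qed
  then have d: "(w x has_real_derivative d) (at t within {tbar..})"
    by (simp add: has_real_derivative_iff_has_vector_derivative)
  have "c x t < - \<sigma>"
    using c_neg [OF x\<Omega> t'] wx v0 by simp
  then have "\<sigma> * v x t < c x t * w x t"
    using v0 mult_strict_right_mono [of "\<sigma>" "- c x t" "v x t"] by (simp add: wx)
  then have "0 < d + h'"
    using equation [OF x\<Omega> t'] L h' unfolding d_def by linarith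
  moreover have "((\<lambda>r. w x r + h r) has_real_derivative d + h') (at t within {tbar..})"
    using d h by (intro DERIV_add) (auto intro: has_field_derivative_at_within)
  ultimately obtain \<eta> where \<eta>: "0 < \<eta>"
    "\<And>e. 0 < e \<Longrightarrow> t - e \<in> {tbar..} \<Longrightarrow> e < \<eta> \<Longrightarrow> w x (t - e) + h (t - e) < w x t + h t"
    using has_real_derivative_pos_inc_left by meson
  show ?thesis
  proof (intro exI [of _ \<eta>] conjI allI impI)
    fix r
    assume r: "t - \<eta> < r \<and> r < t \<and> tbar \<le> r"
    then have "w x r + h r < w x t + h t"
      using \<eta>(2) [of "t - r"] by auto
    moreover have "- w x r \<le> v x r"
      by (simp add: v_def)
    ultimately show "v x t - h t < v x r - h r"
      using wx by linarith
  qed (rule \<eta>(1))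
qed

text \<open>
  The points of space-time at which \<open>max \<delta> v\<close> is not upper semicontinuous as the time decreases to \<open>t\<close>. The
  truncation at \<open>\<delta>\<close> makes the boundary of \<open>\<Omega>\<close> harmless, since \<open>v\<close> vanishes there.
\<close>

definition spikes :: "real \<Rightarrow> ((real ^ 'n) \<times> real) set"
  where "spikes \<delta> = {(x, t). x $ k < l \<and> tbar \<le> t \<and>
    (\<exists>\<theta>>0. \<forall>\<eta>>0. \<exists>y r. dist y x < \<eta> \<and> y $ k < l \<and> t \<le> r \<and> r < t + \<eta> \<and> max \<delta> (v x t) + \<theta> \<le> v y r)}"

lemma right_usc_off_spikes:
  assumes nb: "(x, t) \<notin> spikes \<delta>" and x: "x $ k < l" and t: "tbar \<le> t"
    and X: "\<And>i. X i $ k < l" "X \<longlonglongrightarrow> x" and S: "\<And>i. t < S i" "S \<longlonglongrightarrow> t"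
    and h: "(\<lambda>i. h (X i) (S i)) \<longlonglongrightarrow> h x t" "\<delta> \<le> h x t"
    and \<gamma>: "0 < \<gamma>" "\<And>i. \<gamma> \<le> v (X i) (S i) - h (X i) (S i)"
  shows "\<gamma> \<le> v x t - h x t"
proof -
  have "\<gamma> + h x t \<le> max \<delta> (v x t)"
  proof (rule field_le_epsilon)
    fix \<theta> :: real
    assume \<theta>: "0 < \<theta>"
    have "\<not> (\<forall>\<eta>>0. \<exists>y r. dist y x < \<eta> \<and> y $ k < l \<and> t \<le> r \<and> r < t + \<eta> \<and> max \<delta> (v x t) + \<theta> / 2 \<le> v y r)"
      using nb x t half_gt_zero [OF \<theta>] unfolding spikes_def by blast
    then obtain \<eta> where \<eta>: "0 < \<eta>"
      "\<And>y r. dist y x < \<eta> \<Longrightarrow> y $ k < l \<Longrightarrow> t \<le> r \<Longrightarrow> r < t + \<eta> \<Longrightarrow> v y r < max \<delta> (v x t) + \<theta> / 2"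
      by (meson not_le)
    have "\<forall>\<^sub>F i in sequentially. dist (X i) x < \<eta>"
      using X(2) \<eta>(1) by (rule tendstoD)
    moreover have "\<forall>\<^sub>F i in sequentially. S i < t + \<eta>"
      using S(2) \<eta>(1) by (intro order_tendstoD(2) [OF S(2)]) auto
    moreover have "\<forall>\<^sub>F i in sequentially. h x t - \<theta> / 2 < h (X i) (S i)"
      using h(1) \<theta> by (intro order_tendstoD(1) [OF h(1)]) auto
    ultimately have "\<forall>\<^sub>F i in sequentially. \<gamma> + h x t \<le> max \<delta> (v x t) + \<theta>"
    proof eventually_elim
      case (elim i)
      then have "v (X i) (S i) < max \<delta> (v x t) + \<theta> / 2"
        using \<eta>(2) [of "X i" "S i"] X(1) S(1) [of i] by auto
      then show ?case
        using \<gamma>(2) [of i] elim by linarith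
    qed
    then show "\<gamma> + h x t \<le> max \<delta> (v x t) + \<theta>"
      by simp
  qed
  then show ?thesis
    using h(2) \<gamma>(1) by linarith
qed

end

section \<open>No spike emerges from a region without spikes\<close>

text \<open>
  Semiconcave because it is a minimum of a constant and a paraboloid; vanishes at the centre and equals \<open>1\<close> off the
  ball. Multiplied by \<open>M\<close>, it keeps a barrier above \<open>v\<close> outside the ball.
\<close>

definition quad_cutoff :: "'a::real_inner \<Rightarrow> real \<Rightarrow> 'a \<Rightarrow> real"
  where "quad_cutoff a \<rho> y = min 1 ((norm (y - a) / \<rho>)\<^sup>2)"

lemma quad_cutoff_bounds: "0 \<le> quad_cutoff a \<rho> y" "quad_cutoff a \<rho> y \<le> 1"
  by (auto simp: quad_cutoff_def)

lemma quad_cutoff_outside: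
  assumes "0 < \<rho>" "y \<notin> ball a \<rho>"
  shows "quad_cutoff a \<rho> y = 1"
proof -
  have "1 \<le> norm (y - a) / \<rho>"
    using assms by (simp add: dist_norm norm_minus_commute)
  then have "1 \<le> (norm (y - a) / \<rho>)\<^sup>2"
    by (rule one_le_power)
  then show ?thesis
    by (simp add: quad_cutoff_def)
qed

lemma quad_cutoff_continuous: "0 < \<rho> \<Longrightarrow> continuous_on S (quad_cutoff a \<rho>)"
  unfolding quad_cutoff_def [abs_def] by (intro continuous_intros) auto

lemma quad_cutoff_second_diff:
  assumes "0 < \<rho>"
  shows "second_diff (quad_cutoff a \<rho>) x z \<le> 2 / \<rho>\<^sup>2 * (norm z)\<^sup>2"
proof (cases "quad_cutoff a \<rho> x = 1")
  case True
  then have "second_diff (quad_cutoff a \<rho>) x z \<le> 0"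
    using quad_cutoff_bounds(2) [of a \<rho> "x + z"] quad_cutoff_bounds(2) [of a \<rho> "x - z"]
    by (simp add: second_diff_def)
  also have "0 \<le> 2 / \<rho>\<^sup>2 * (norm z)\<^sup>2"
    by simp
  finally show ?thesis .
next
  case False
  then have x: "quad_cutoff a \<rho> x = (norm (x - a))\<^sup>2 / \<rho>\<^sup>2"
    by (auto simp: quad_cutoff_def min_def power_divide split: if_splits)
  have le: "quad_cutoff a \<rho> y \<le> (norm (y - a))\<^sup>2 / \<rho>\<^sup>2" for y
    by (auto simp: quad_cutoff_def power_divide)
  have "(norm (x + z - a))\<^sup>2 + (norm (x - z - a))\<^sup>2 = 2 * (norm (x - a))\<^sup>2 + 2 * (norm z)\<^sup>2"
    by (simp add: power2_norm_eq_inner inner_simps inner_commute algebra_simps)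
  then have "(norm (x + z - a))\<^sup>2 / \<rho>\<^sup>2 + (norm (x - z - a))\<^sup>2 / \<rho>\<^sup>2
      = 2 * ((norm (x - a))\<^sup>2 / \<rho>\<^sup>2) + 2 / \<rho>\<^sup>2 * (norm z)\<^sup>2"
    by (simp add: add_divide_distrib [symmetric])
  then show ?thesis
    using le [of "x + z"] le [of "x - z"] unfolding second_diff_def x by linarith
qed

context half_space_supersolution
begin

text \<open>
  Without the jumps shorter than \<open>\<epsilon>\<close> the fractional diffusion has a finite total rate, as \<open>jump_kernel\<close> requires.
\<close>

definition rate :: "real \<Rightarrow> real ^ 'n \<Rightarrow> real"
  where "rate \<epsilon> z = C * (indicator (- ball 0 \<epsilon>) z * kernel s z)"

definition \<Lambda> :: "real \<Rightarrow> real"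
  where "\<Lambda> \<epsilon> = (LINT z|lborel. rate \<epsilon> z)"

lemma jump_kernel_rate: "0 < \<epsilon> \<Longrightarrow> jump_kernel (rate \<epsilon>) (\<Lambda> \<epsilon>)"
proof
  assume \<epsilon>: "0 < \<epsilon>"
  show "0 \<le> rate \<epsilon> z" for z
    using C_pos by (simp add: rate_def)
  obtain c where "\<And>r. 0 < r \<Longrightarrow> integrable lborel (\<lambda>z::real ^ 'n. indicator (- ball 0 r) z * kernel s z)"
    using kernel_tail_bound [OF s(1)] by metis
  then show "integrable lborel (rate \<epsilon>)"
    unfolding rate_def [abs_def] using \<epsilon> by (intro integrable_mult_right)
qed (simp add: \<Lambda>_def)

lemma rate_integral:
  assumes "continuous_on UNIV u"
  shows "(LINT z|lborel. rate \<epsilon> z * (u (x + z) - u x)) = C * trunc_diffusion s u x \<epsilon>"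
  unfolding trunc_diffusion_lborel [OF assms] rate_def by (simp add: mult.assoc)

text \<open>
  One Euler step of the diffusion is a barrier. The error rate \<open>E\<close> collects the diffusion \<open>C\<chi>\<close> of the cutoff, the
  jumps shorter than \<open>\<epsilon>\<close>, controlled by semiconcavity of \<open>f\<close>, and the consistency error of the step.
\<close>

lemma spike_step:
  assumes ball_half: "\<And>y. y \<in> cball a \<rho> \<Longrightarrow> y $ k < l" and \<rho>: "0 < \<rho>"
    and t: "tbar \<le> t1" "t1 \<le> t2"
    and nb: "\<And>y t. y \<in> cball a \<rho> \<Longrightarrow> t1 \<le> t \<Longrightarrow> t < t2 \<Longrightarrow> (y, t) \<notin> spikes \<delta>"
    and \<delta>: "0 < \<delta>" "\<delta> \<le> b0"
    and f: "continuous_on UNIV f" "\<And>y. 0 \<le> f y" "\<And>y. f y \<le> M"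
    and cf: "0 \<le> cf" "\<And>x z. second_diff f x z \<le> cf * (norm z)\<^sup>2"
    and \<epsilon>: "0 < \<epsilon>" and \<tau>: "(t2 - t1) * \<Lambda> \<epsilon> \<le> 1"
    and near: "integrable lborel (\<lambda>z::real ^ 'n. indicator (ball 0 \<epsilon>) z * ((norm z)\<^sup>2 * kernel s z))"
      "(LINT z::real ^ 'n|lborel. indicator (ball 0 \<epsilon>) z * ((norm z)\<^sup>2 * kernel s z)) \<le> e2"
    and \<chi>: "0 \<le> C\<chi>" "\<And>x \<epsilon>'. 0 < \<epsilon>' \<Longrightarrow> \<epsilon>' \<le> \<rho> \<Longrightarrow> trunc_diffusion s (quad_cutoff a \<rho>) x \<epsilon>' \<le> C\<chi>"
    and E: "0 \<le> E" "C * (M * C\<chi> + cf * e2 / 2) + 2 * (t2 - t1) * (\<Lambda> \<epsilon>)\<^sup>2 * M \<le> E"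
    and init: "\<And>y. y \<in> cball a \<rho> \<Longrightarrow> v y t1 \<le> b0 + M * quad_cutoff a \<rho> y + f y"
    and y: "y \<in> cball a \<rho>"
  shows "v y t2 \<le> b0 + E * (t2 - t1) + M * quad_cutoff a \<rho> y + jump_avg (rate \<epsilon>) (t2 - t1) f y"
proof -
  interpret jump_kernel "rate \<epsilon>" "\<Lambda> \<epsilon>"
    using \<epsilon> by (rule jump_kernel_rate)
  define G where "G y = (LINT z|lborel. rate \<epsilon> z * (f (y + z) - f y))" for y
  have J: "jump_avg (rate \<epsilon>) r f y = f y + r * G y" for r y
    by (simp add: jump_avg_def G_def)
  have fM: "\<And>y. \<bar>f y\<bar> \<le> M"
    using f by auto
  have G_cont: "continuous_on UNIV G"
  proof -
    have "continuous_on UNIV (\<lambda>y. jump_avg (rate \<epsilon>) 1 f y - f y)"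
      by (intro continuous_intros f jump_avg_continuous [OF f(1) fM])
    then show ?thesis
      by (simp add: J)
  qed
  define h where "h y t = (b0 + E * (t - t1)) + M * quad_cutoff a \<rho> y + jump_avg (rate \<epsilon>) (t - t1) f y" for y t
  have h_cont: "continuous_on UNIV (\<lambda>y. h y t)" for t
    unfolding h_def J by (intro continuous_intros f G_cont quad_cutoff_continuous \<rho>)
  have \<tau>': "(t - t1) * \<Lambda> \<epsilon> \<le> 1" if "t \<le> t2" for t
    using that \<tau> mass_nonneg mult_right_mono [of "t - t1" "t2 - t1" "\<Lambda> \<epsilon>"] by linarith
  have J_bounds: "0 \<le> jump_avg (rate \<epsilon>) (t - t1) f y" "jump_avg (rate \<epsilon>) (t - t1) f y \<le> M"
    if "t1 \<le> t" "t \<le> t2" for t y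
    using jump_avg_nonneg [OF f _ \<tau>'] jump_avg_le [OF f _ \<tau>'] that by auto
  have M\<chi>: "0 \<le> M * quad_cutoff a \<rho> y" "M * quad_cutoff a \<rho> y \<le> M" for y
    using M quad_cutoff_bounds [of a \<rho> y] by (auto intro: mult_left_le)
  have h_ge: "b0 + M * quad_cutoff a \<rho> y \<le> h y t" if "t1 \<le> t" "t \<le> t2" for y t
    using J_bounds(1) [OF that, of y] E(1) that by (simp add: h_def)
  have h_ge_b0: "b0 \<le> h y t" if "t1 \<le> t" "t \<le> t2" for y t
    using h_ge [OF that, of y] M\<chi>(1) [of y] by linarith
  have "v y t2 - h y t2 \<le> 0"
  proof (rule right_usc_comparison [of "cball a \<rho>" t1 t2 "\<lambda>y t. v y t - h y t"])
    show "compact (cball a \<rho>)"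
      by simp
    show "continuous_on (cball a \<rho>) (\<lambda>y. v y t - h y t)" if "t1 \<le> t" "t \<le> t2" for t
    proof (intro continuous_on_diff)
      show "continuous_on (cball a \<rho>) (\<lambda>y. v y t)"
        using v_continuous_on [of t] that t ball_half by (auto intro: continuous_on_subset)
      show "continuous_on (cball a \<rho>) (\<lambda>y. h y t)"
        using h_cont by (rule continuous_on_subset) auto
    qed
    show "v x t1 - h x t1 \<le> 0" if "x \<in> cball a \<rho>" for x
      using init [OF that] by (simp add: h_def J)
  next
    fix x t X S \<gamma>
    assume x: "x \<in> cball a \<rho>" and t': "t1 \<le> t" "t < t2" and X: "\<And>i. X i \<in> cball a \<rho>" "X \<longlonglongrightarrow> x"
      and S: "\<And>i::nat. t < S i" "S \<longlonglongrightarrow> t" and \<gamma>: "0 < \<gamma>" "\<And>i. \<gamma> \<le> v (X i) (S i) - h (X i) (S i)"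
    show "\<gamma> \<le> v x t - h x t"
    proof (rule right_usc_off_spikes [OF nb [OF x t'] _ _ _ X(2) S _ _ \<gamma>])
      have lim: "(\<lambda>i. u (X i)) \<longlonglongrightarrow> u x" if "continuous_on UNIV u" for u :: "real ^ 'n \<Rightarrow> real"
        using continuous_on_tendsto_compose [OF that X(2)] by auto
      show "(\<lambda>i. h (X i) (S i)) \<longlonglongrightarrow> h x t"
        unfolding h_def J
        by (intro tendsto_intros S(2) lim f(1) G_cont quad_cutoff_continuous \<rho>)
      show "\<delta> \<le> h x t"
        using h_ge_b0 [of t x] t' \<delta> by auto
    qed (use x X ball_half t t' in auto)
  next
    fix x t
    assume x: "x \<in> cball a \<rho>" and t': "t1 < t" "t \<le> t2" and pos: "0 < v x t - h x t"
      and mx: "\<And>y. y \<in> cball a \<rho> \<Longrightarrow> v y t - h y t \<le> v x t - h x t"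
    have t1t: "t1 \<le> t"
      using t' by simp
    define F where "F = jump_avg (rate \<epsilon>) (t - t1) f"
    have F_cont: "continuous_on UNIV F"
      unfolding F_def by (rule jump_avg_continuous [OF f(1) fM])
    have F_bd: "\<bar>F y\<bar> \<le> M" for y
      using J_bounds [OF t1t t'(2), of y] by (simp add: F_def)
    have F_int: "tail_integrable s F"
      by (rule tail_integrable_continuous_bounded [OF s(1) F_cont F_bd])
    have \<chi>_int: "tail_integrable s (\<lambda>y. (b0 + E * (t - t1)) + M * quad_cutoff a \<rho> y)"
    proof (rule tail_integrable_continuous_bounded [OF s(1)])
      show "\<bar>(b0 + E * (t - t1)) + M * quad_cutoff a \<rho> y\<bar> \<le> \<bar>b0 + E * (t - t1)\<bar> + M" for y
        using M\<chi> [of y] by linarith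
    qed (intro continuous_intros quad_cutoff_continuous \<rho>)
    have H_eq: "(\<lambda>y. h y t) = (\<lambda>y. ((b0 + E * (t - t1)) + M * quad_cutoff a \<rho> y) + F y)"
      by (simp add: h_def F_def)
    have H_int: "tail_integrable s (\<lambda>y. h y t)"
      unfolding H_eq by (rule tail_integrable_add [OF \<chi>_int F_int])
    define b where "b = M * C\<chi> + (cf * e2 / 2 + trunc_diffusion s F x \<epsilon>)"
    have "\<exists>\<eta>>0. \<forall>r. t - \<eta> < r \<and> r < t \<and> tbar \<le> r \<longrightarrow> v x t - h x t < v x r - h x r"
    proof (rule decrease_at_touching_point [OF _ _ H_int])
      show "x $ k < l"
        using ball_half x by blast
      show "tbar < t"
        using t t' by simp
      show "0 \<le> h y t + h (reflect k l y) t" for y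
        using h_ge_b0 [OF t1t t'(2), of y] h_ge_b0 [OF t1t t'(2), of "reflect k l y"] \<delta> by linarith
      show "0 \<le> h x t" "h x t < v x t"
        using h_ge_b0 [OF t1t t'(2), of x] \<delta> pos by linarith+
      show "v y t - h y t \<le> v x t - h x t" if yk: "y $ k < l" for y
      proof (cases "y \<in> cball a \<rho>")
        case True
        then show ?thesis
          by (rule mx)
      next
        case False
        then have "quad_cutoff a \<rho> y = 1"
          using \<rho> by (intro quad_cutoff_outside) auto
        then have "M \<le> h y t"
          using h_ge [OF t1t t'(2), of y] \<delta> by simp
        moreover have "v y t \<le> M"
          using v_le_M [OF yk] t t1t by simp
        ultimately show ?thesis
          using pos by linarith
      qed
      show "0 < min \<epsilon> \<rho>"
        using \<epsilon> \<rho> by simp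
      show "trunc_diffusion s (\<lambda>y. h y t) x \<epsilon>' \<le> b" if \<epsilon>': "0 < \<epsilon>'" "\<epsilon>' < min \<epsilon> \<rho>" for \<epsilon>'
      proof -
        have "trunc_diffusion s (\<lambda>y. h y t) x \<epsilon>'
            = M * trunc_diffusion s (quad_cutoff a \<rho>) x \<epsilon>' + trunc_diffusion s F x \<epsilon>'"
          unfolding H_eq trunc_diffusion_add [OF s(1) \<chi>_int F_int \<epsilon>'(1)] trunc_diffusion_affine ..
        moreover have "M * trunc_diffusion s (quad_cutoff a \<rho>) x \<epsilon>' \<le> M * C\<chi>"
          using \<chi>(2) [OF \<epsilon>'(1), of x] \<epsilon>' M by (intro mult_left_mono) auto
        moreover have "trunc_diffusion s F x \<epsilon>' \<le> cf * e2 / 2 + trunc_diffusion s F x \<epsilon>"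
        proof (rule trunc_diffusion_near_le [OF s(1) F_int \<epsilon>'(1) _ cf(1) _ near])
          show "second_diff F x z \<le> cf * (norm z)\<^sup>2" for z
            unfolding F_def by (rule jump_avg_second_diff [OF f(1) fM cf(2)]) (use t1t \<tau>' t' in auto)
        qed (use \<epsilon>' in auto)
        ultimately show ?thesis
          unfolding b_def by linarith
      qed
      show "((\<lambda>r. h x r) has_real_derivative (E + G x)) (at t)"
        unfolding h_def J by (auto intro!: derivative_eq_intros)
      have "C * trunc_diffusion s F x \<epsilon> \<le> G x + 2 * (t - t1) * (\<Lambda> \<epsilon>)\<^sup>2 * M"
        using jump_avg_generator_le [OF f, of "t - t1" x] t1t
        unfolding F_def [symmetric] rate_integral [OF F_cont] by (simp add: G_def)
      moreover have "2 * (t - t1) * (\<Lambda> \<epsilon>)\<^sup>2 * M \<le> 2 * (t2 - t1) * (\<Lambda> \<epsilon>)\<^sup>2 * M"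
        using t' M by (intro mult_right_mono) auto
      moreover have "0 \<le> \<sigma> * v x t"
        using \<sigma> by simp
      moreover have "C * b = C * (M * C\<chi> + cf * e2 / 2) + C * trunc_diffusion s F x \<epsilon>"
        by (simp add: b_def algebra_simps)
      ultimately show "C * b - \<sigma> * v x t \<le> E + G x"
        using E(2) by linarith
    qed
    then show "\<exists>\<eta>>0. \<forall>r. t - \<eta> < r \<and> r < t \<and> t1 \<le> r \<longrightarrow> v x t - h x t < v x r - h x r"
      using t by (meson order_trans)
  qed (use y t in auto)
  then show ?thesis
    by (simp add: h_def)
qed


text \<open>
  Over \<open>K\<close> steps the supremum of the averages decays like \<open>exp (- \<Lambda>A * (t2 - t1))\<close>, up to the
  amount that the mass \<open>m\<close> can contribute.
\<close>

lemma spike_iterate: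
  fixes K :: nat and f :: "real ^ 'n \<Rightarrow> real"
  assumes ball_half: "\<And>y. y \<in> cball a \<rho> \<Longrightarrow> y $ k < l" and \<rho>: "0 < \<rho>"
    and t: "tbar \<le> t1" "t1 \<le> t2"
    and nb: "\<And>y t. y \<in> cball a \<rho> \<Longrightarrow> t1 \<le> t \<Longrightarrow> t < t2 \<Longrightarrow> (y, t) \<notin> spikes \<delta>"
    and \<delta>: "0 < \<delta>" "\<delta> \<le> b0"
    and f: "continuous_on UNIV f" "\<And>y. 0 \<le> f y" "\<And>y. f y \<le> M"
    and cf: "0 \<le> cf" "\<And>x z. second_diff f x z \<le> cf * (norm z)\<^sup>2"
    and m: "(\<integral>\<^sup>+y. ennreal (f y) \<partial>lborel) \<le> ennreal m" "0 \<le> m"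
    and \<epsilon>: "0 < \<epsilon>"
    and near: "integrable lborel (\<lambda>z::real ^ 'n. indicator (ball 0 \<epsilon>) z * ((norm z)\<^sup>2 * kernel s z))"
      "(LINT z::real ^ 'n|lborel. indicator (ball 0 \<epsilon>) z * ((norm z)\<^sup>2 * kernel s z)) \<le> e2"
    and \<chi>: "0 \<le> C\<chi>" "\<And>x \<epsilon>'. 0 < \<epsilon>' \<Longrightarrow> \<epsilon>' \<le> \<rho> \<Longrightarrow> trunc_diffusion s (quad_cutoff a \<rho>) x \<epsilon>' \<le> C\<chi>"
    and P: "\<And>z. z \<in> - ball 0 r \<Longrightarrow> rate \<epsilon> z \<le> P" "0 \<le> P"
    and \<Lambda>A: "0 \<le> \<Lambda>A" "\<Lambda>A \<le> (LINT z|lborel. indicator (- ball 0 r) z * rate \<epsilon> z)"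
    and init: "\<And>y. y \<in> cball a \<rho> \<Longrightarrow> v y t1 \<le> b0 + M * quad_cutoff a \<rho> y + f y"
    and K: "0 < K" "\<tau> = (t2 - t1) / real K" "\<tau> * \<Lambda> \<epsilon> \<le> 1" "\<tau> * \<Lambda>A \<le> 1"
    and y: "y \<in> cball a \<rho>"
  shows "v y t2 \<le> b0 + (C * (M * C\<chi> + cf * e2 / 2) + 2 * \<tau> * (\<Lambda> \<epsilon>)\<^sup>2 * M) * (t2 - t1) + M * quad_cutoff a \<rho> y
    + (exp (- \<Lambda>A * (t2 - t1)) * M + (t2 - t1) * (P * m))"
proof -
  interpret jump_kernel "rate \<epsilon>" "\<Lambda> \<epsilon>"
    using \<epsilon> by (rule jump_kernel_rate)
  define T where "T = jump_avg (rate \<epsilon>) \<tau>"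
  define E where "E = C * (M * C\<chi> + cf * e2 / 2) + 2 * \<tau> * (\<Lambda> \<epsilon>)\<^sup>2 * M"
  have \<tau>0: "0 \<le> \<tau>"
    using K t by simp
  have e2: "0 \<le> e2"
    using near(2) by (rule order_trans [rotated]) (auto intro!: Bochner_Integration.integral_nonneg)
  have E0: "0 \<le> E"
    unfolding E_def using C_pos M \<chi>(1) cf(1) e2 \<tau>0 by (intro add_nonneg_nonneg mult_nonneg_nonneg) auto
  have iter: "continuous_on UNIV ((T ^^ i) f) \<and> (\<forall>y. 0 \<le> (T ^^ i) f y) \<and> (\<forall>y. (T ^^ i) f y \<le> M)
      \<and> (\<forall>x z. second_diff ((T ^^ i) f) x z \<le> cf * (norm z)\<^sup>2)
      \<and> (\<integral>\<^sup>+y. ennreal ((T ^^ i) f y) \<partial>lborel) \<le> ennreal m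
      \<and> (\<forall>y. (T ^^ i) f y \<le> (1 - \<tau> * \<Lambda>A) ^ i * M + real i * (\<tau> * (P * m)))
      \<and> (i \<le> K \<longrightarrow> (\<forall>y\<in>cball a \<rho>. v y (t1 + real i * \<tau>)
          \<le> b0 + E * (real i * \<tau>) + M * quad_cutoff a \<rho> y + (T ^^ i) f y))" for i
  proof (induction i)
    case 0
    then show ?case
      using f cf m init by auto
  next
    case (Suc i)
    define g where "g = (T ^^ i) f"
    have g: "continuous_on UNIV g" "\<And>y. 0 \<le> g y" "\<And>y. g y \<le> M"
      "\<And>x z. second_diff g x z \<le> cf * (norm z)\<^sup>2" "(\<integral>\<^sup>+y. ennreal (g y) \<partial>lborel) \<le> ennreal m"
      "\<And>y. g y \<le> (1 - \<tau> * \<Lambda>A) ^ i * M + real i * (\<tau> * (P * m))"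
      and gv: "\<And>y. i \<le> K \<Longrightarrow> y \<in> cball a \<rho> \<Longrightarrow> v y (t1 + real i * \<tau>)
          \<le> b0 + E * (real i * \<tau>) + M * quad_cutoff a \<rho> y + g y"
      using Suc unfolding g_def by auto
    have gM: "\<And>y. \<bar>g y\<bar> \<le> M"
      using g by auto
    have Suc_eq: "(T ^^ Suc i) f = jump_avg (rate \<epsilon>) \<tau> g"
      by (simp add: g_def T_def)
    have decay: "jump_avg (rate \<epsilon>) \<tau> g y \<le> (1 - \<tau> * \<Lambda>A) ^ Suc i * M + real (Suc i) * (\<tau> * (P * m))" for y
    proof -
      have "jump_avg (rate \<epsilon>) \<tau> g y
          \<le> (1 - \<tau> * \<Lambda>A) * ((1 - \<tau> * \<Lambda>A) ^ i * M + real i * (\<tau> * (P * m))) + \<tau> * (P * m)"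
        by (rule jump_avg_sup_decay [OF g(1,2,6) \<tau>0 K(3) _ P \<Lambda>A(2) g(5) m(2)]) auto
      also have "\<dots> = (1 - \<tau> * \<Lambda>A) ^ Suc i * M + (1 - \<tau> * \<Lambda>A) * (real i * (\<tau> * (P * m))) + \<tau> * (P * m)"
        by (simp add: algebra_simps)
      also have "(1 - \<tau> * \<Lambda>A) * (real i * (\<tau> * (P * m))) \<le> 1 * (real i * (\<tau> * (P * m)))"
        using \<tau>0 \<Lambda>A(1) P(2) m(2) by (intro mult_right_mono) auto
      finally show ?thesis
        by (simp add: algebra_simps)
    qed
    have step: "v y (t1 + real (Suc i) * \<tau>)
        \<le> b0 + E * (real (Suc i) * \<tau>) + M * quad_cutoff a \<rho> y + jump_avg (rate \<epsilon>) \<tau> g y"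
      if i: "Suc i \<le> K" and y: "y \<in> cball a \<rho>" for y
    proof -
      have le: "t1 + real (Suc i) * \<tau> \<le> t2"
      proof -
        have "real (Suc i) * \<tau> \<le> real K * \<tau>"
          using i \<tau>0 by (intro mult_right_mono) auto
        then show ?thesis
          using K by simp
      qed
      have diff: "(t1 + real (Suc i) * \<tau>) - (t1 + real i * \<tau>) = \<tau>"
        by (simp add: algebra_simps)
      have "v y (t1 + real (Suc i) * \<tau>) \<le> (b0 + E * (real i * \<tau>))
          + E * ((t1 + real (Suc i) * \<tau>) - (t1 + real i * \<tau>)) + M * quad_cutoff a \<rho> y
          + jump_avg (rate \<epsilon>) ((t1 + real (Suc i) * \<tau>) - (t1 + real i * \<tau>)) g y"
      proof (rule spike_step [OF ball_half \<rho> _ _ nb \<delta>(1) _ g(1-3) cf(1) g(4) \<epsilon> _ near \<chi> E0 _ _ y])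
        show "tbar \<le> t1 + real i * \<tau>"
          using t(1) \<tau>0 by (simp add: add_increasing2)
        show "\<delta> \<le> b0 + E * (real i * \<tau>)"
          using \<delta>(2) E0 \<tau>0 by (simp add: add_increasing2)
        show "t1 \<le> t" if "t1 + real i * \<tau> \<le> t" for t
          using that mult_nonneg_nonneg [OF of_nat_0_le_iff [of i] \<tau>0] by linarith
        show "v y (t1 + real i * \<tau>) \<le> b0 + E * (real i * \<tau>) + M * quad_cutoff a \<rho> y + g y"
          if "y \<in> cball a \<rho>" for y
          using gv i that by simp
      qed (use diff K le \<tau>0 in \<open>auto simp: E_def\<close>)
      then show ?thesis
        unfolding diff by (simp add: algebra_simps)
    qed
    show ?case
      unfolding Suc_eq
    proof (intro conjI allI impI ballI)
      show "continuous_on UNIV (jump_avg (rate \<epsilon>) \<tau> g)"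
        by (rule jump_avg_continuous [OF g(1) gM])
      show "0 \<le> jump_avg (rate \<epsilon>) \<tau> g y" "jump_avg (rate \<epsilon>) \<tau> g y \<le> M" for y
        using jump_avg_nonneg [OF g(1-3) \<tau>0 K(3)] jump_avg_le [OF g(1-3) \<tau>0 K(3)] by auto
      show "second_diff (jump_avg (rate \<epsilon>) \<tau> g) x z \<le> cf * (norm z)\<^sup>2" for x z
        by (rule jump_avg_second_diff [OF g(1) gM g(4) \<tau>0 K(3)])
      show "(\<integral>\<^sup>+y. ennreal (jump_avg (rate \<epsilon>) \<tau> g y) \<partial>lborel) \<le> ennreal m"
        using jump_avg_mass [OF g(1-3) \<tau>0 K(3)] g(5) by simp
    qed (use decay step in auto)
  qed
  have K\<tau>: "real K * \<tau> = t2 - t1"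
    using K by simp
  have "(1 - \<tau> * \<Lambda>A) ^ K \<le> exp (- \<tau> * \<Lambda>A) ^ K"
    using K(4) exp_ge_add_one_self [of "- \<tau> * \<Lambda>A"] by (intro power_mono) auto
  also have "\<dots> = exp (- \<Lambda>A * (t2 - t1))"
    unfolding K\<tau> [symmetric] by (simp add: exp_of_nat_mult [symmetric] mult_ac)
  finally have "(1 - \<tau> * \<Lambda>A) ^ K * M \<le> exp (- \<Lambda>A * (t2 - t1)) * M"
    using M by (intro mult_right_mono) auto
  moreover have "(T ^^ K) f y \<le> (1 - \<tau> * \<Lambda>A) ^ K * M + real K * (\<tau> * (P * m))"
    using iter [of K] by blast
  moreover have "real K * (\<tau> * (P * m)) = (t2 - t1) * (P * m)"
    unfolding K\<tau> [symmetric] by (rule mult.assoc [symmetric])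
  moreover have "v y t2 \<le> b0 + E * (t2 - t1) + M * quad_cutoff a \<rho> y + (T ^^ K) f y"
    using iter [of K] y by (auto simp: K\<tau>)
  ultimately show ?thesis
    unfolding E_def by linarith
qed

text \<open>
  First the length of the steps and then \<open>\<epsilon>\<close> tends to \<open>0\<close> in \<open>spike_iterate\<close>. This order matters: the total rate
  \<open>\<Lambda> \<epsilon>\<close> is unbounded as \<open>\<epsilon>\<close> tends to \<open>0\<close>. What remains does not depend on the semiconcavity constant of \<open>f\<close>.
\<close>

lemma spike_smoothing:
  fixes f :: "real ^ 'n \<Rightarrow> real"
  assumes ball_half: "\<And>y. y \<in> cball a \<rho> \<Longrightarrow> y $ k < l" and \<rho>: "0 < \<rho>"
    and t: "tbar \<le> t1" "t1 \<le> t2"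
    and nb: "\<And>y t. y \<in> cball a \<rho> \<Longrightarrow> t1 \<le> t \<Longrightarrow> t < t2 \<Longrightarrow> (y, t) \<notin> spikes \<delta>"
    and \<delta>: "0 < \<delta>" "\<delta> \<le> b0"
    and f: "continuous_on UNIV f" "\<And>y. 0 \<le> f y" "\<And>y. f y \<le> M"
    and cf: "0 \<le> cf" "\<And>x z. second_diff f x z \<le> cf * (norm z)\<^sup>2"
    and m: "(\<integral>\<^sup>+y. ennreal (f y) \<partial>lborel) \<le> ennreal m" "0 \<le> m"
    and \<chi>: "0 \<le> C\<chi>" "\<And>x \<epsilon>'. 0 < \<epsilon>' \<Longrightarrow> \<epsilon>' \<le> \<rho> \<Longrightarrow> trunc_diffusion s (quad_cutoff a \<rho>) x \<epsilon>' \<le> C\<chi>"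
    and r: "0 < r"
    and P: "\<And>z::real ^ 'n. z \<in> - ball 0 r \<Longrightarrow> C * kernel s z \<le> P" "0 \<le> P"
    and \<Lambda>A: "0 \<le> \<Lambda>A" "\<Lambda>A \<le> C * (LINT z::real ^ 'n|lborel. indicator (- ball 0 r) z * kernel s z)"
    and init: "\<And>y. y \<in> cball a \<rho> \<Longrightarrow> v y t1 \<le> b0 + M * quad_cutoff a \<rho> y + f y"
    and y: "y \<in> cball a \<rho>"
  shows "v y t2 \<le> b0 + C * M * C\<chi> * (t2 - t1) + M * quad_cutoff a \<rho> y
    + (exp (- \<Lambda>A * (t2 - t1)) * M + (t2 - t1) * (P * m))"
proof -
  obtain c2 where c2: "0 \<le> c2"
    "\<And>r. 0 < r \<Longrightarrow> integrable lborel (\<lambda>z::real ^ 'n. indicator (ball 0 r) z * ((norm z)\<^sup>2 * kernel s z))"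
    "\<And>r. 0 < r \<Longrightarrow> (LINT z::real ^ 'n|lborel. indicator (ball 0 r) z * ((norm z)\<^sup>2 * kernel s z)) \<le> c2 * r powr (2 - 2 * s)"
    by (rule kernel_near_bound [OF s(2,1)], rule that)
  define R where "R e = b0 + (C * (M * C\<chi> + cf * e / 2)) * (t2 - t1) + M * quad_cutoff a \<rho> y
    + (exp (- \<Lambda>A * (t2 - t1)) * M + (t2 - t1) * (P * m))" for e
  have fixed_\<epsilon>: "v y t2 \<le> R (c2 * \<epsilon> powr (2 - 2 * s))" if \<epsilon>: "0 < \<epsilon>" "\<epsilon> < r" for \<epsilon>
  proof (rule tendsto_lowerbound [OF _ _ trivial_limit_sequentially])
    define \<tau> where "\<tau> K = (t2 - t1) / real K" for K
    have \<tau>: "\<tau> \<longlonglongrightarrow> 0"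
      unfolding \<tau>_def by (rule lim_const_over_n)
    have "(\<lambda>K. R (c2 * \<epsilon> powr (2 - 2 * s)) + 2 * \<tau> K * (\<Lambda> \<epsilon>)\<^sup>2 * M * (t2 - t1)) \<longlonglongrightarrow>
      R (c2 * \<epsilon> powr (2 - 2 * s)) + 2 * 0 * (\<Lambda> \<epsilon>)\<^sup>2 * M * (t2 - t1)"
      by (intro tendsto_intros \<tau>)
    then show "(\<lambda>K. R (c2 * \<epsilon> powr (2 - 2 * s)) + 2 * \<tau> K * (\<Lambda> \<epsilon>)\<^sup>2 * M * (t2 - t1)) \<longlonglongrightarrow>
      R (c2 * \<epsilon> powr (2 - 2 * s))"
      by simp
    have small: "\<forall>\<^sub>F K in sequentially. \<tau> K * q < 1" for q
    proof -
      have "(\<lambda>K. \<tau> K * q) \<longlonglongrightarrow> 0 * q"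
        by (intro tendsto_intros \<tau>)
      then show ?thesis
        by (rule order_tendstoD) simp
    qed
    have "\<forall>\<^sub>F K in sequentially. 0 < K"
      by (rule eventually_gt_at_top)
    then show "\<forall>\<^sub>F K in sequentially. v y t2 \<le> R (c2 * \<epsilon> powr (2 - 2 * s)) + 2 * \<tau> K * (\<Lambda> \<epsilon>)\<^sup>2 * M * (t2 - t1)"
      using small [of "\<Lambda> \<epsilon>"] small [of \<Lambda>A]
    proof eventually_elim
      case (elim K)
      have rate_r: "(\<lambda>z. indicator (- ball 0 r) z * rate \<epsilon> z) = (\<lambda>z. C * (indicator (- ball 0 r) z * kernel s z))"
        using \<epsilon> by (auto simp: rate_def indicator_def fun_eq_iff)
      have "v y t2 \<le> b0 + (C * (M * C\<chi> + cf * (c2 * \<epsilon> powr (2 - 2 * s)) / 2) + 2 * \<tau> K * (\<Lambda> \<epsilon>)\<^sup>2 * M) * (t2 - t1)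
          + M * quad_cutoff a \<rho> y + (exp (- \<Lambda>A * (t2 - t1)) * M + (t2 - t1) * (P * m))"
      proof (rule spike_iterate [OF ball_half \<rho> t nb \<delta> f cf m \<epsilon>(1) c2(2) [OF \<epsilon>(1)] c2(3) [OF \<epsilon>(1)] \<chi> _ P(2) \<Lambda>A(1) _ init elim(1) _ _ _ y])
        show "rate \<epsilon> z \<le> P" if "z \<in> - ball 0 r" for z
          using P(1) [OF that] that \<epsilon> by (simp add: rate_def)
        show "\<Lambda>A \<le> (LINT z|lborel. indicator (- ball 0 r) z * rate \<epsilon> z)"
          unfolding rate_r using \<Lambda>A(2) by simp
      qed (use elim in \<open>auto simp: \<tau>_def\<close>)
      then show ?case
        unfolding R_def by (simp add: algebra_simps)
    qed
  qed
  have "v y t2 \<le> R (c2 * 0)"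
  proof (rule tendsto_lowerbound [OF _ _ trivial_limit_at_right_real])
    have "\<forall>\<^sub>F \<epsilon> in at_right 0. (0::real) \<le> \<epsilon>"
      using eventually_at_right_less [of "0::real"] by eventually_elim simp
    then have "((\<lambda>\<epsilon>::real. \<epsilon> powr (2 - 2 * s)) \<longlongrightarrow> 0 powr (2 - 2 * s)) (at_right 0)"
      using s by (intro tendsto_powr' tendsto_const tendsto_ident_at) auto
    then have "((\<lambda>\<epsilon>::real. \<epsilon> powr (2 - 2 * s)) \<longlongrightarrow> 0) (at_right 0)"
      by simp
    then show "((\<lambda>\<epsilon>. R (c2 * \<epsilon> powr (2 - 2 * s))) \<longlongrightarrow> R (c2 * 0)) (at_right 0)"
      unfolding R_def by (intro tendsto_intros) auto
    show "\<forall>\<^sub>F \<epsilon> in at_right 0. v y t2 \<le> R (c2 * \<epsilon> powr (2 - 2 * s))"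
      unfolding eventually_at_right_field using fixed_\<epsilon> r by (intro exI [of _ r]) auto
  qed
  then show ?thesis
    by (simp add: R_def mult.assoc)
qed

text \<open>
  Start the barrier at a time \<open>t1\<close> slightly after \<open>t0\<close>, with \<open>f\<close> the excess of \<open>v\<close> over \<open>A\<close> at time \<open>t1\<close>. By
  dominated convergence the mass of the excess tends to \<open>0\<close> as \<open>t1\<close> decreases to \<open>t0\<close>, however large its supremum
  and its derivatives are. By \<open>spike_smoothing\<close> with a small radius \<open>r\<close>, hence a large \<open>\<Lambda>A\<close>, nothing of it is left at
  the fixed time \<open>t2\<close>. The term with \<open>B\<close> accounts for what enters the ball from outside.
\<close>

lemma no_spike_emergence:
  assumes ball_half: "\<And>y. y \<in> cball a \<rho> \<Longrightarrow> y $ k < l" and \<rho>: "0 < \<rho>" and \<delta>: "0 < \<delta>"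
  shows "\<exists>B\<ge>0. \<forall>t0 t2 A. tbar \<le> t0 \<longrightarrow> t0 < t2 \<longrightarrow> \<delta> \<le> A \<longrightarrow>
      (\<forall>y\<in>cball a \<rho>. \<forall>t. t0 < t \<longrightarrow> t < t2 \<longrightarrow> (y, t) \<notin> spikes \<delta>) \<longrightarrow>
      (\<forall>y\<in>cball a \<rho>. v y t0 \<le> A) \<longrightarrow>
      (\<forall>y\<in>cball a \<rho>. v y t2 \<le> A + M * quad_cutoff a \<rho> y + B * (t2 - t0))"
proof -
  define p where "p = real CARD('n) + 2 * s"
  obtain c1 where c1: "0 \<le> c1"
    "\<And>r. 0 < r \<Longrightarrow> integrable lborel (\<lambda>z::real ^ 'n. indicator (- ball 0 r) z * kernel s z)"
    "\<And>r. 0 < r \<Longrightarrow> (LINT z::real ^ 'n|lborel. indicator (- ball 0 r) z * kernel s z) \<le> c1 * r powr (- 2 * s)"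
    by (rule kernel_tail_bound [OF s(1)], rule that)
  obtain c2 where c2: "0 \<le> c2"
    "\<And>r. 0 < r \<Longrightarrow> integrable lborel (\<lambda>z::real ^ 'n. indicator (ball 0 r) z * ((norm z)\<^sup>2 * kernel s z))"
    "\<And>r. 0 < r \<Longrightarrow> (LINT z::real ^ 'n|lborel. indicator (ball 0 r) z * ((norm z)\<^sup>2 * kernel s z)) \<le> c2 * r powr (2 - 2 * s)"
    by (rule kernel_near_bound [OF s(2,1)], rule that)
  obtain c3 where c3: "0 < c3"
    "\<And>d. 0 < d \<Longrightarrow> c3 * d powr (- 2 * s) \<le> (LINT z::real ^ 'n|lborel. indicator {z. d \<le> z $ k} z * kernel s z)"
    by (rule kernel_half_space_bound [OF s(1)], rule that)
  have tail_ge: "c3 * r powr (- 2 * s) \<le> (LINT z::real ^ 'n|lborel. indicator (- ball 0 r) z * kernel s z)"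
    if r: "0 < r" for r
  proof -
    have "(LINT z::real ^ 'n|lborel. indicator {z. r \<le> z $ k} z * kernel s z)
        \<le> (LINT z::real ^ 'n|lborel. indicator (- ball 0 r) z * kernel s z)"
    proof (rule integral_mono')
      fix z :: "real ^ 'n"
      show "indicator {z. r \<le> z $ k} z * kernel s z \<le> indicator (- ball 0 r) z * kernel s z"
        using component_le_norm_cart [of z k] by (auto simp: indicator_def)
    qed (use c1 r in auto)
    then show ?thesis
      using c3(2) [OF r] by linarith
  qed
  define C\<chi> where "C\<chi> = 2 / \<rho>\<^sup>2 * (c2 * \<rho> powr (2 - 2 * s)) / 2 + 1 * (c1 * \<rho> powr (- 2 * s))"
  have C\<chi>0: "0 \<le> C\<chi>"
    unfolding C\<chi>_def using c1(1) c2(1) by simp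
  have \<chi>_int: "tail_integrable s (quad_cutoff a \<rho>)"
  proof (rule tail_integrable_continuous_bounded [OF s(1) quad_cutoff_continuous [OF \<rho>]])
    show "\<bar>quad_cutoff a \<rho> x\<bar> \<le> 1" for x
      using quad_cutoff_bounds [of a \<rho> x] by simp
  qed
  have \<chi>: "trunc_diffusion s (quad_cutoff a \<rho>) x \<epsilon> \<le> C\<chi>" if \<epsilon>: "0 < \<epsilon>" "\<epsilon> \<le> \<rho>" for x \<epsilon>
  proof -
    have "trunc_diffusion s (quad_cutoff a \<rho>) x \<epsilon>
        \<le> 2 / \<rho>\<^sup>2 * (c2 * \<rho> powr (2 - 2 * s)) / 2 + trunc_diffusion s (quad_cutoff a \<rho>) x \<rho>"
      by (rule trunc_diffusion_near_le [OF s(1) \<chi>_int \<epsilon> _ _ c2(2,3)])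
        (use quad_cutoff_second_diff [OF \<rho>] \<rho> in auto)
    also have "trunc_diffusion s (quad_cutoff a \<rho>) x \<rho> \<le> 1 * (c1 * \<rho> powr (- 2 * s))"
    proof (rule trunc_diffusion_far_le [OF s(1) \<chi>_int \<rho> _ _ c1(3)])
      show "quad_cutoff a \<rho> y \<le> quad_cutoff a \<rho> x + 1" for y
        using quad_cutoff_bounds(2) [of a \<rho> y] quad_cutoff_bounds(1) [of a \<rho> x] by linarith
    qed (use \<rho> in auto)
    finally show ?thesis
      by (simp add: C\<chi>_def)
  qed
  define B where "B = C * M * C\<chi>"
  have B: "0 \<le> B"
    using C_pos M C\<chi>0 by (simp add: B_def)
  have "v y t2 \<le> A + M * quad_cutoff a \<rho> y + B * (t2 - t0)"
    if t: "tbar \<le> t0" "t0 < t2" and A: "\<delta> \<le> A"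
      and nb: "\<And>y t. y \<in> cball a \<rho> \<Longrightarrow> t0 < t \<Longrightarrow> t < t2 \<Longrightarrow> (y, t) \<notin> spikes \<delta>"
      and init: "\<And>y. y \<in> cball a \<rho> \<Longrightarrow> v y t0 \<le> A" and y: "y \<in> cball a \<rho>" for t0 t2 A y
  proof (rule field_le_epsilon)
    fix \<theta> :: real
    assume \<theta>: "0 < \<theta>"
    define d where "d = (t2 - t0) / 2"
    have d: "0 < d"
      using t by (simp add: d_def)
    \<comment> \<open>The damping rate that reduces \<open>M\<close> to \<open>\<theta> / 3\<close> within time \<open>d\<close>; the jump radius \<open>r\<close> below realizes it.\<close>
    define L where "L = max 1 (ln (3 * M / \<theta>) / d)"
    have L: "0 < L" "exp (- L * d) * M \<le> \<theta> / 3"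
    proof -
      have "ln (3 * M / \<theta>) \<le> L * d"
        using d by (simp add: L_def pos_divide_le_eq [symmetric])
      then have "exp (ln (3 * M / \<theta>)) \<le> exp (L * d)"
        by simp
      then have "3 * M / \<theta> \<le> exp (L * d)"
        using M \<theta> by simp
      then show "exp (- L * d) * M \<le> \<theta> / 3"
        using \<theta> by (simp add: exp_minus field_simps)
    qed (simp add: L_def)
    define r where "r = (L / (C * c3)) powr (- 1 / (2 * s))"
    have r: "0 < r" "C * (c3 * r powr (- 2 * s)) = L"
    proof -
      show "0 < r"
        using L C_pos c3(1) by (simp add: r_def)
      have "r powr (- 2 * s) = L / (C * c3)"
        using L C_pos c3(1) s by (simp add: r_def powr_powr)
      then show "C * (c3 * r powr (- 2 * s)) = L"
        using C_pos c3(1) by simp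
    qed
    have L_le: "L \<le> C * (LINT z::real ^ 'n|lborel. indicator (- ball 0 r) z * kernel s z)"
      using mult_left_mono [OF tail_ge [OF r(1)], of C] C_pos r(2) by linarith
    define P where "P = C * r powr (- p)"
    have P0: "0 < P"
      using C_pos r by (simp add: P_def)
    have P: "C * kernel s z \<le> P" if "z \<in> - ball 0 r" for z :: "real ^ 'n"
    proof -
      have "norm z powr (- p) \<le> r powr (- p)"
        using that r s by (intro powr_mono2') (auto simp: p_def)
      moreover have "kernel s z = norm z powr (- p)"
        by (simp add: kernel_def p_def powr_minus_divide del: minus_add_distrib)
      ultimately show ?thesis
        unfolding P_def using C_pos by (intro mult_left_mono) auto
    qed
    \<comment> \<open>A mass that contributes at most \<open>\<theta> / 3\<close> up to time \<open>t2\<close>.\<close>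
    define m where "m = \<theta> / (3 * (t2 - t0) * P)"
    have m0: "0 < m"
      using \<theta> t P0 by (simp add: m_def)
    define g where "g t1 y = (if y \<in> cball a \<rho> then max 0 (v y t1 - A - M * quad_cutoff a \<rho> y) else 0)" for t1 y
    have g0: "0 \<le> g t1 y" for t1 y
      by (simp add: g_def)
    have gM: "g t1 y \<le> M * indicator (cball a \<rho>) y" if "tbar \<le> t1" for t1 y
    proof -
      have "0 \<le> M * quad_cutoff a \<rho> y"
        using M quad_cutoff_bounds(1) [of a \<rho> y] by simp
      then have "y \<in> cball a \<rho> \<Longrightarrow> v y t1 - A - M * quad_cutoff a \<rho> y \<le> M"
        using v_le_M [OF ball_half that, of y] A \<delta> by auto
      then show ?thesis
        using M by (auto simp: g_def)
    qed
    have g_cont: "continuous_on UNIV (g t1)" if t1: "tbar \<le> t1" for t1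
    proof -
      have "continuous_on (cball a \<rho> \<union> - ball a \<rho>) (g t1)"
        unfolding g_def
      proof (rule continuous_on_cases)
        show "continuous_on (cball a \<rho>) (\<lambda>y. max 0 (v y t1 - A - M * quad_cutoff a \<rho> y))"
          using v_continuous_on [OF t1] ball_half
          by (intro continuous_intros quad_cutoff_continuous \<rho>) (auto intro: continuous_on_subset)
        show "\<forall>y. y \<in> cball a \<rho> \<and> y \<notin> cball a \<rho> \<or> y \<in> - ball a \<rho> \<and> y \<in> cball a \<rho> \<longrightarrow>
            max 0 (v y t1 - A - M * quad_cutoff a \<rho> y) = 0"
        proof (intro allI impI)
          fix y
          assume "y \<in> cball a \<rho> \<and> y \<notin> cball a \<rho> \<or> y \<in> - ball a \<rho> \<and> y \<in> cball a \<rho>"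
          then have "y \<in> cball a \<rho>" "quad_cutoff a \<rho> y = 1"
            using quad_cutoff_outside [OF \<rho>, of y a] by auto
          then show "max 0 (v y t1 - A - M * quad_cutoff a \<rho> y) = 0"
            using v_le_M [OF ball_half t1, of y] A \<delta> by auto
        qed
      qed auto
      moreover have "cball a \<rho> \<union> - ball a \<rho> = UNIV"
        by auto
      ultimately show ?thesis
        by simp
    qed
    have g_meas: "g t1 \<in> borel_measurable lborel" if "tbar \<le> t1" for t1
      using borel_measurable_continuous_onI [OF g_cont [OF that]] by simp
    define S where "S i = t0 + d * inverse (real (Suc i))" for i
    have S: "t0 < S i" "S i \<le> t0 + d" "tbar \<le> S i" for i
    proof -
      have "inverse (real (Suc i)) \<le> 1"
        by (simp add: field_simps)
      then show "S i \<le> t0 + d"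
        using d mult_left_mono [of "inverse (real (Suc i))" 1 d] by (simp add: S_def)
      show "t0 < S i"
        using d by (simp add: S_def)
      then show "tbar \<le> S i"
        using t by simp
    qed
    have S_lim: "S \<longlonglongrightarrow> t0"
    proof -
      have "S \<longlonglongrightarrow> t0 + d * 0"
        unfolding S_def by (intro tendsto_intros LIMSEQ_inverse_real_of_nat)
      then show ?thesis
        by simp
    qed
    have ball_int: "integrable lborel (\<lambda>y::real ^ 'n. M * indicator (cball a \<rho>) y)"
      using emeasure_lborel_cball_finite [of a \<rho>]
      by (intro integrable_mult_right integrable_real_indicator) auto
    have "(\<lambda>i. LINT y|lborel. g (S i) y) \<longlonglongrightarrow> (LINT y|lborel. g t0 y)"
    proof (rule integral_dominated_convergence [OF g_meas g_meas ball_int])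
      show "AE y in lborel. (\<lambda>i. g (S i) y) \<longlonglongrightarrow> g t0 y"
      proof (intro always_eventually allI)
        fix y
        have "(\<lambda>i. v y (S i)) \<longlonglongrightarrow> v y t0"
          using t(1) S(3) S_lim by (rule v_time_tendsto)
        then show "(\<lambda>i. g (S i) y) \<longlonglongrightarrow> g t0 y"
          unfolding g_def by (cases "y \<in> cball a \<rho>") (auto intro!: tendsto_intros)
      qed
      show "AE y in lborel. norm (g (S i) y) \<le> M * indicator (cball a \<rho>) y" for i
        using g0 gM [OF S(3)] by (intro always_eventually allI) (simp add: abs_of_nonneg)
    qed (use t S in auto)
    moreover have "(LINT y|lborel. g t0 y) = 0"
    proof -
      have "g t0 y = 0" for y
      proof -
        have "0 \<le> M * quad_cutoff a \<rho> y"
          using M quad_cutoff_bounds(1) [of a \<rho> y] by simp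
        then show ?thesis
          using init [of y] by (auto simp: g_def)
      qed
      then show ?thesis
        by simp
    qed
    ultimately have "\<forall>\<^sub>F i in sequentially. (LINT y|lborel. g (S i) y) < m"
      using m0 by (intro order_tendstoD(2)) auto
    then obtain i where i: "(LINT y|lborel. g (S i) y) < m"
      using eventually_happens' [OF sequentially_bot] by blast
    define t1 where "t1 = S i"
    have t1: "t0 < t1" "t1 \<le> t0 + d" "tbar \<le> t1"
      using S by (auto simp: t1_def)
    have t1_t2: "t1 < t2" "d \<le> t2 - t1" "t2 - t1 \<le> t2 - t0"
      using t1 d by (auto simp: d_def field_simps)
    have gM': "g t1 y \<le> M" for y
      using gM [OF t1(3), of y] M by (cases "y \<in> cball a \<rho>") auto
    have g_int: "integrable lborel (g t1)"
      by (rule Bochner_Integration.integrable_bound [OF ball_int g_meas [OF t1(3)]])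
        (use g0 gM [OF t1(3)] M in \<open>auto simp: abs_of_nonneg\<close>)
    have "(\<integral>\<^sup>+y. ennreal (g t1 y) \<partial>lborel) = ennreal (LINT y|lborel. g t1 y)"
      by (rule nn_integral_eq_integral [OF g_int]) (use g0 in auto)
    then have g_mass: "(\<integral>\<^sup>+y. ennreal (g t1 y) \<partial>lborel) \<le> ennreal m"
      using i by (simp add: t1_def ennreal_leI)
    have g_uc: "uniformly_continuous_on UNIV (g t1)"
      by (rule uniformly_continuous_on_UNIV_compact_support [OF g_cont [OF t1(3)], of a \<rho>]) (simp add: g_def)
    obtain n where n: "0 \<le> n" "\<And>y. g t1 y \<le> inf_conv n (g t1) y + \<theta> / 3"
      using inf_conv_approx [of "g t1" M "\<theta> / 3"] g0 gM' g_uc \<theta> by auto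
    define f where "f = inf_conv n (g t1)"
    have f_le: "f y \<le> g t1 y" and f0: "0 \<le> f y" for y
      unfolding f_def using inf_conv_le [of "g t1" n, OF g0 n(1)] inf_conv_nonneg [of "g t1" n, OF g0 n(1)] by auto
    have "v y t2 \<le> (A + \<theta> / 3) + C * M * C\<chi> * (t2 - t1) + M * quad_cutoff a \<rho> y
      + (exp (- L * (t2 - t1)) * M + (t2 - t1) * (P * m))"
    proof (rule spike_smoothing [where \<delta> = \<delta> and f = f and cf = "2 * n" and r = r, OF ball_half \<rho> t1(3)])
      show "t1 \<le> t2" "0 < \<delta>" "\<delta> \<le> A + \<theta> / 3"
        using t1_t2 \<delta> A \<theta> by auto
      show "(y, t) \<notin> spikes \<delta>" if "y \<in> cball a \<rho>" "t1 \<le> t" "t < t2" for y t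
        using nb that t1 by auto
      show "continuous_on UNIV f"
        unfolding f_def by (rule inf_conv_continuous [OF g0 n(1) g_uc])
      show "f y \<le> M" for y
        using f_le gM' order_trans by blast
      show "second_diff f x z \<le> 2 * n * (norm z)\<^sup>2" for x z
        unfolding f_def by (rule inf_conv_second_diff [OF g0 n(1)])
      show "(\<integral>\<^sup>+y. ennreal (f y) \<partial>lborel) \<le> ennreal m"
        using g_mass by (rule order_trans [rotated]) (intro nn_integral_mono ennreal_leI f_le)
      show "v y t1 \<le> A + \<theta> / 3 + M * quad_cutoff a \<rho> y + f y" if "y \<in> cball a \<rho>" for y
        using n(2) [of y] that by (auto simp: g_def f_def)
    qed (use C\<chi>0 \<chi> r P P0 L L_le m0 f0 n y in auto)
    moreover have "C * M * C\<chi> * (t2 - t1) \<le> B * (t2 - t0)"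
      using t1_t2 B by (simp add: B_def [symmetric] mult_left_mono)
    moreover have "exp (- L * (t2 - t1)) * M \<le> \<theta> / 3"
    proof -
      have "exp (- L * (t2 - t1)) * M \<le> exp (- L * d) * M"
        using L t1_t2 M by (intro mult_right_mono) auto
      then show ?thesis
        using L(2) by linarith
    qed
    moreover have "(t2 - t1) * (P * m) \<le> \<theta> / 3"
    proof -
      have "(t2 - t1) * (P * m) \<le> (t2 - t0) * (P * m)"
        using t1_t2 P0 m0 by (intro mult_right_mono) auto
      also have "\<dots> = \<theta> / 3"
      proof -
        define u where "u = (t2 - t0) * P"
        have "0 < u"
          using t P0 by (simp add: u_def)
        moreover have "(t2 - t0) * (P * m) = u * (\<theta> / (3 * u))"
          by (simp only: m_def u_def mult.assoc)
        ultimately show ?thesis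
          by simp
      qed
      finally show ?thesis .
    qed
    ultimately show "v y t2 \<le> A + M * quad_cutoff a \<rho> y + B * (t2 - t0) + \<theta>"
      by linarith
  qed
  then show ?thesis
    using B by (intro exI [of _ B] conjI allI impI ballI) auto
qed

end

section \<open>The negative part is jointly upper semicontinuous to the right\<close>

text \<open>
  An intersection of a closed and an open set is completely metrizable, so Baire's theorem applies in it.
\<close>

lemma locally_closed_Baire_portion:
  fixes Cl U :: "'a::complete_space set"
  assumes "closed Cl" "open U" and ne: "Cl \<inter> U \<noteq> {}"
    and \<F>: "countable \<F>" "Cl \<inter> U \<subseteq> \<Union>\<F>"
    and cl: "\<And>S. S \<in> \<F> \<Longrightarrow> Cl \<inter> U \<inter> closure (Cl \<inter> U \<inter> S) \<subseteq> S"
  obtains S V where "S \<in> \<F>" "open V" "V \<inter> (Cl \<inter> U) \<noteq> {}" "V \<inter> (Cl \<inter> U) \<subseteq> S"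
proof -
  define E where "E = Cl \<inter> U"
  define \<G> where "\<G> = (\<lambda>S. E \<inter> S) ` \<F>"
  have cm: "completely_metrizable_space (top_of_set E)"
  proof -
    have "completely_metrizable_space (top_of_set U)"
      using assms(2) by (simp add: completely_metrizable_space_openin completely_metrizable_space_euclidean open_openin [symmetric])
    then have "completely_metrizable_space (subtopology (top_of_set U) (U \<inter> Cl))"
      by (rule completely_metrizable_space_closedin) (use assms(1) in \<open>auto simp: closedin_closed\<close>)
    then show ?thesis
      by (simp add: subtopology_subtopology E_def Int_ac)
  qed
  have "\<exists>T\<in>\<G>. (top_of_set E) interior_of T \<noteq> {}"
  proof (rule ccontr)
    assume "\<not> (\<exists>T\<in>\<G>. (top_of_set E) interior_of T \<noteq> {})"
    then have "(top_of_set E) interior_of (\<Union>\<G>) = {}"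
    proof (intro Baire_category_alt)
      fix T
      assume T: "T \<in> \<G>" and nint: "\<not> (\<exists>T\<in>\<G>. (top_of_set E) interior_of T \<noteq> {})"
      then obtain S where S: "S \<in> \<F>" "T = E \<inter> S"
        by (auto simp: \<G>_def)
      have "T = E \<inter> closure T"
        using cl [OF S(1)] closure_subset [of T] S(2) by (auto simp: E_def)
      then have "closedin (top_of_set E) T"
        by (metis closed_closure closedin_closed)
      then show "closedin (top_of_set E) T \<and> (top_of_set E) interior_of T = {}"
        using nint T by blast
    qed (use cm \<F> in \<open>auto simp: \<G>_def\<close>)
    moreover have "\<Union>\<G> = E"
      using \<F>(2) by (auto simp: \<G>_def E_def)
    moreover have "(top_of_set E) interior_of E = E"
      using interior_of_topspace [of "top_of_set E"] by simp
    ultimately show False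
      using ne by (simp add: E_def)
  qed
  then obtain S x where S: "S \<in> \<F>" "x \<in> (top_of_set E) interior_of (E \<inter> S)"
    by (auto simp: \<G>_def)
  then obtain T where T: "openin (top_of_set E) T" "x \<in> T" "T \<subseteq> E \<inter> S"
    by (auto simp: interior_of_def)
  then obtain V where "open V" "T = E \<inter> V"
    by (auto simp: openin_open)
  then show ?thesis
    using that [OF S(1), of V] T by (auto simp: E_def)
qed

context half_space_supersolution
begin

text \<open>
  The truncation at \<open>\<delta>\<close> is what gives a linear bound also at points off \<open>\<Omega>\<close>, where \<open>v\<close> is merely continuous and
  vanishes.
\<close>

lemma v_spatial_growth:
  assumes x: "x $ k < l" and t: "tbar \<le> t" and \<delta>: "0 < \<delta>"
  obtains n where "0 \<le> n" "\<And>y. y $ k < l \<Longrightarrow> v y t \<le> max \<delta> (v x t + n * norm (y - x))"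
proof -
  have "\<exists>d L. 0 < d \<and> 0 \<le> L \<and> (\<forall>y. y $ k < l \<longrightarrow> norm (y - x) < d \<longrightarrow> v y t \<le> max \<delta> (v x t + L * norm (y - x)))"
  proof (cases "x \<in> \<Omega>")
    case True
    then obtain g where "GDERIV (\<lambda>y. w y t) x :> g"
      using w_C11 [OF t] unfolding C11_loc_def by blast
    then have "((\<lambda>y. w y t) has_derivative (\<lambda>h. h \<bullet> g)) (at x)"
      by (simp add: gderiv_def)
    then obtain d where d: "0 < d" "\<And>y. norm (y - x) < d \<Longrightarrow> norm (w y t - w x t - (y - x) \<bullet> g) \<le> 1 * norm (y - x)"
      unfolding has_derivative_at_alt by (metis zero_less_one)
    have "v y t \<le> v x t + (1 + norm g) * norm (y - x)" if "norm (y - x) < d" for y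
    proof -
      have "\<bar>(y - x) \<bullet> g\<bar> \<le> norm (y - x) * norm g"
        by (rule Cauchy_Schwarz_ineq2)
      moreover have "\<bar>w y t - w x t - (y - x) \<bullet> g\<bar> \<le> norm (y - x)"
        using d(2) [OF that] by simp
      ultimately have "\<bar>w y t - w x t\<bar> \<le> (1 + norm g) * norm (y - x)"
        by (simp add: algebra_simps)
      then show ?thesis
        unfolding v_def by linarith
    qed
    then have "0 < d \<and> 0 \<le> 1 + norm g \<and> (\<forall>y. y $ k < l \<longrightarrow> norm (y - x) < d \<longrightarrow> v y t \<le> max \<delta> (v x t + (1 + norm g) * norm (y - x)))"
      using d(1) by (auto intro: max.coboundedI2)
    then show ?thesis
      by blast
  next
    case False
    then have "v x t = 0"
      using v_posD(1) [OF x t] v_nonneg [of x t] by (metis less_eq_real_def)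
    moreover obtain d where "0 < d" "\<And>y. y $ k < l \<Longrightarrow> dist y x < d \<Longrightarrow> dist (v y t) (v x t) < \<delta>"
      using v_continuous_on [OF t] x \<delta> unfolding continuous_on_iff by (metis mem_Collect_eq)
    ultimately have "0 < d \<and> 0 \<le> (0::real) \<and> (\<forall>y. y $ k < l \<longrightarrow> norm (y - x) < d \<longrightarrow> v y t \<le> max \<delta> (v x t + 0 * norm (y - x)))"
      by (auto simp: dist_norm le_max_iff_disj less_imp_le)
    then show ?thesis
      by blast
  qed
  then obtain d L where d: "0 < d" "0 \<le> L"
    "\<And>y. y $ k < l \<Longrightarrow> norm (y - x) < d \<Longrightarrow> v y t \<le> max \<delta> (v x t + L * norm (y - x))"
    by blast
  define n where "n = max L (M / d)"
  show ?thesis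
  proof (rule that)
    show "0 \<le> n"
      using d by (simp add: n_def)
    fix y :: "real ^ 'n"
    assume y: "y $ k < l"
    show "v y t \<le> max \<delta> (v x t + n * norm (y - x))"
    proof (cases "norm (y - x) < d")
      case True
      have "L * norm (y - x) \<le> n * norm (y - x)"
        by (intro mult_right_mono) (auto simp: n_def)
      then show ?thesis
        using d(3) [OF y True] by linarith
    next
      case False
      have "M = M / d * d"
        using d(1) by simp
      also have "\<dots> \<le> n * norm (y - x)"
        using False M d(1,2) by (intro mult_mono) (auto simp: n_def le_max_iff_disj)
      finally show ?thesis
        using v_le_M [OF y t] v_nonneg [of x t] by linarith
    qed
  qed
qed

text \<open>
  Points with quantified regularity: a Lipschitz bound in time for this \<open>x\<close>, valid on all of \<open>[tbar, T]\<close>,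
  and linear growth in space from this point at this time. Countably many of these relatively closed sets
  cover the half space at all times.
\<close>

definition tame :: "real \<Rightarrow> nat \<Rightarrow> nat \<Rightarrow> ((real ^ 'n) \<times> real) set"
  where "tame \<delta> T n = {(x, t). x $ k < l \<and> tbar \<le> t \<and> t \<le> real T
    \<and> (\<forall>t' t''. tbar \<le> t' \<longrightarrow> t' \<le> real T \<longrightarrow> tbar \<le> t'' \<longrightarrow> t'' \<le> real T \<longrightarrow> \<bar>v x t' - v x t''\<bar> \<le> real n * \<bar>t' - t''\<bar>)
    \<and> (\<forall>y. y $ k < l \<longrightarrow> v y t \<le> max \<delta> (v x t + real n * norm (y - x)))}"

lemma tame_cover:
  assumes "x $ k < l" "tbar \<le> t" "0 < \<delta>"
  shows "\<exists>T n. (x, t) \<in> tame \<delta> T n"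
proof -
  obtain T :: nat where T: "t \<le> real T"
    using real_arch_simple by blast
  obtain B where B: "\<And>t' t''. tbar \<le> t' \<Longrightarrow> t' \<le> real T \<Longrightarrow> tbar \<le> t'' \<Longrightarrow> t'' \<le> real T \<Longrightarrow> \<bar>v x t' - v x t''\<bar> \<le> B * \<bar>t' - t''\<bar>"
    by (rule v_lipschitz_in_time [of "real T" x], rule that)
  obtain L where L: "\<And>y. y $ k < l \<Longrightarrow> v y t \<le> max \<delta> (v x t + L * norm (y - x))"
    by (rule v_spatial_growth [OF assms], rule that)
  obtain n :: nat where n: "max B L \<le> real n"
    using real_arch_simple by blast
  have "\<bar>v x t' - v x t''\<bar> \<le> real n * \<bar>t' - t''\<bar>"
    if "tbar \<le> t'" "t' \<le> real T" "tbar \<le> t''" "t'' \<le> real T" for t' t''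
    using B [OF that] mult_right_mono [of B "real n" "\<bar>t' - t''\<bar>"] n by simp
  moreover have "v y t \<le> max \<delta> (v x t + real n * norm (y - x))" if "y $ k < l" for y
    using L [OF that] mult_right_mono [of L "real n" "norm (y - x)"] n by simp
  ultimately have "(x, t) \<in> tame \<delta> T n"
    using assms T by (auto simp: tame_def)
  then show ?thesis
    by blast
qed

lemma tame_closed:
  assumes X: "\<And>i. (X i, S i) \<in> tame \<delta> T n" and lim: "X \<longlonglongrightarrow> x" "S \<longlonglongrightarrow> t" and x: "x $ k < l"
  shows "(x, t) \<in> tame \<delta> T n"
proof -
  have XS: "X i $ k < l" "tbar \<le> S i" "S i \<le> real T" for i
    using X [of i] by (auto simp: tame_def)
  have lip: "\<bar>v (X i) t' - v (X i) t''\<bar> \<le> real n * \<bar>t' - t''\<bar>"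
    if "tbar \<le> t'" "t' \<le> real T" "tbar \<le> t''" "t'' \<le> real T" for i t' t''
    using X [of i] that by (auto simp: tame_def)
  have gr: "v y (S i) \<le> max \<delta> (v (X i) (S i) + real n * norm (y - X i))" if "y $ k < l" for y i
    using X [of i] that by (auto simp: tame_def)
  have t: "tbar \<le> t" "t \<le> real T"
    using lim(2) XS by (auto intro: LIMSEQ_le_const LIMSEQ_le_const2)
  have vX: "(\<lambda>i. v (X i) t') \<longlonglongrightarrow> v x t'" if "tbar \<le> t'" for t'
    using continuous_on_tendsto_compose [OF v_continuous_on [OF that] lim(1)] XS x by auto
  have vXS: "(\<lambda>i. v (X i) (S i)) \<longlonglongrightarrow> v x t"
  proof -
    have "(\<lambda>i. real n * \<bar>S i - t\<bar>) \<longlonglongrightarrow> real n * \<bar>t - t\<bar>"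
      by (intro tendsto_intros lim)
    then have lim0: "(\<lambda>i. real n * \<bar>S i - t\<bar>) \<longlonglongrightarrow> 0"
      by simp
    have "(\<lambda>i. v (X i) (S i) - v (X i) t) \<longlonglongrightarrow> 0"
    proof (rule Lim_null_comparison [OF always_eventually lim0], rule allI)
      show "norm (v (X i) (S i) - v (X i) t) \<le> real n * \<bar>S i - t\<bar>" for i
        using lip [of "S i" t i] XS [of i] t by simp
    qed
    from tendsto_add [OF this vX [OF t(1)]] show ?thesis
      by simp
  qed
  have "\<bar>v x t' - v x t''\<bar> \<le> real n * \<bar>t' - t''\<bar>"
    if "tbar \<le> t'" "t' \<le> real T" "tbar \<le> t''" "t'' \<le> real T" for t' t''
  proof (rule LIMSEQ_le_const2)
    show "(\<lambda>i. \<bar>v (X i) t' - v (X i) t''\<bar>) \<longlonglongrightarrow> \<bar>v x t' - v x t''\<bar>"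
      by (intro tendsto_intros vX that)
  qed (use lip that in auto)
  moreover have "v y t \<le> max \<delta> (v x t + real n * norm (y - x))" if "y $ k < l" for y
  proof (rule LIMSEQ_le)
    show "(\<lambda>i. v y (S i)) \<longlonglongrightarrow> v y t"
      using t(1) XS(2) lim(2) by (rule v_time_tendsto)
    show "(\<lambda>i. max \<delta> (v (X i) (S i) + real n * norm (y - X i))) \<longlonglongrightarrow> max \<delta> (v x t + real n * norm (y - x))"
      by (intro tendsto_intros vXS lim)
  qed (use gr that in auto)
  ultimately show ?thesis
    using x t by (auto simp: tame_def)
qed

text \<open>
  By Baire's theorem some portion \<open>V \<inter> E\<close> of the closure \<open>E\<close> of the spike points lies in one of the sets
  \<open>tame \<delta> T n\<close>. Take a spike point \<open>(xs, ts)\<close> in \<open>V\<close> and a later point \<open>(y, r)\<close> close to it at which \<open>v\<close> is too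
  large. Let \<open>a\<close> be the last time in \<open>[ts, r]\<close> at which \<open>E\<close> meets a fixed small ball around \<open>xs\<close>. Going from
  \<open>(xs, ts)\<close> in space to a point \<open>x'\<close> with \<open>(x', a)\<close> in \<open>E\<close>, then in time to \<open>a\<close> and again in space, the tame
  bounds show that \<open>v\<close> at time \<open>a\<close> is hardly larger than at \<open>(xs, ts)\<close> on the whole ball. After
  \<open>a\<close> the ball contains no spike points, and \<open>no_spike_emergence\<close> contradicts the large value at \<open>(y, r)\<close>.
\<close>

lemma no_spikes:
  assumes \<delta>: "0 < \<delta>"
  shows "spikes \<delta> = {}"
proof (rule ccontr)
  assume ne: "spikes \<delta> \<noteq> {}"
  define U where "U = {x::real ^ 'n. x $ k < l} \<times> (UNIV :: real set)"
  define E where "E = closure (spikes \<delta>) \<inter> U"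
  have U: "open U"
    unfolding U_def by (intro open_Times open_halfspace_component_lt_cart) auto
  have spikes_E: "spikes \<delta> \<subseteq> E"
    using closure_subset by (force simp: E_def U_def spikes_def)
  have tbar_E: "tbar \<le> t" if "(x, t) \<in> closure (spikes \<delta>)" for x t
  proof -
    have "closure (spikes \<delta>) \<subseteq> UNIV \<times> {tbar..}"
      by (rule closure_minimal) (auto simp: spikes_def intro: closed_Times)
    then show ?thesis
      using that by auto
  qed
  obtain S V where S: "S \<in> range (\<lambda>(T, n). tame \<delta> T n)" and V: "open V" "V \<inter> E \<noteq> {}" "V \<inter> E \<subseteq> S"
    unfolding E_def
  proof (rule locally_closed_Baire_portion [OF closed_closure U, of "spikes \<delta>" "range (\<lambda>(T, n). tame \<delta> T n)"])
    show "closure (spikes \<delta>) \<inter> U \<noteq> {}"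
      using ne spikes_E by (auto simp: E_def)
    show "closure (spikes \<delta>) \<inter> U \<subseteq> \<Union> (range (\<lambda>(T, n). tame \<delta> T n))"
    proof
      fix z
      assume z: "z \<in> closure (spikes \<delta>) \<inter> U"
      obtain x t where xt: "z = (x, t)"
        by force
      have "\<exists>T n. (x, t) \<in> tame \<delta> T n"
        using z tbar_E [of x t] by (intro tame_cover \<delta>) (auto simp: xt U_def)
      then show "z \<in> \<Union> (range (\<lambda>(T, n). tame \<delta> T n))"
        by (auto simp: xt)
    qed
    fix S
    assume "S \<in> range (\<lambda>(T, n). tame \<delta> T n)"
    then obtain T n where S: "S = tame \<delta> T n"
      by auto
    show "closure (spikes \<delta>) \<inter> U \<inter> closure (closure (spikes \<delta>) \<inter> U \<inter> S) \<subseteq> S"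
    proof
      fix z
      assume z: "z \<in> closure (spikes \<delta>) \<inter> U \<inter> closure (closure (spikes \<delta>) \<inter> U \<inter> S)"
      obtain x t where xt: "z = (x, t)"
        by force
      have "(x, t) \<in> closure (closure (spikes \<delta>) \<inter> U \<inter> S)"
        using z xt by simp
      then obtain Z where Z: "\<And>i. Z i \<in> S" "Z \<longlonglongrightarrow> (x, t)"
        unfolding closure_sequential by auto
      show "z \<in> S"
        unfolding xt S
      proof (rule tame_closed [where X = "fst \<circ> Z" and S = "snd \<circ> Z"])
        show "(fst \<circ> Z) \<longlonglongrightarrow> x" "(snd \<circ> Z) \<longlonglongrightarrow> t"
          using tendsto_fst [OF Z(2)] tendsto_snd [OF Z(2)] by (auto simp: o_def)
      qed (use Z z in \<open>auto simp: S xt U_def\<close>)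
    qed
  qed (auto intro: that)
  obtain T n where S_eq: "S = tame \<delta> T n"
    using S by auto
  have "V \<inter> spikes \<delta> \<noteq> {}"
    using V(1,2) open_Int_closure_eq_empty [of V "spikes \<delta>"] by (auto simp: E_def)
  then obtain xs ts where bad: "(xs, ts) \<in> V" "(xs, ts) \<in> spikes \<delta>"
    by auto
  have xs: "xs $ k < l" and ts: "tbar \<le> ts"
    using bad(2) by (auto simp: spikes_def)
  obtain \<theta> where \<theta>: "0 < \<theta>"
    "\<And>\<eta>. 0 < \<eta> \<Longrightarrow> \<exists>y r. dist y xs < \<eta> \<and> y $ k < l \<and> ts \<le> r \<and> r < ts + \<eta> \<and> max \<delta> (v xs ts) + \<theta> \<le> v y r"
    using bad(2) unfolding spikes_def by blast
  define us where "us = max \<delta> (v xs ts)"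
  obtain V1 V2 where V12: "open V1" "open V2" "xs \<in> V1" "ts \<in> V2" "V1 \<times> V2 \<subseteq> V"
    using open_prod_elim [OF V(1) bad(1)] by (metis mem_Sigma_iff)
  obtain e1 where e1: "0 < e1" "cball xs e1 \<subseteq> V1"
    using V12 open_contains_cball by blast
  obtain e2 where e2: "0 < e2" "cball ts e2 \<subseteq> V2"
    using V12 open_contains_cball by blast
  obtain e3 where e3: "0 < e3" "cball xs e3 \<subseteq> {x. x $ k < l}"
    using xs open_contains_cball [of "{x::real ^ 'n. x $ k < l}"] open_halfspace_component_lt_cart by blast
  \<comment> \<open>The ball has to stay in the portion, and growth by \<open>n\<close> times its radius has to be negligible against \<open>\<theta>\<close>.\<close>
  define \<rho> where "\<rho> = Min {e1, e3, \<theta> / (16 * (real n + 1))}"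
  have \<rho>: "0 < \<rho>" "\<rho> \<le> e1" "\<rho> \<le> e3" "\<rho> \<le> \<theta> / (16 * (real n + 1))"
    using e1 e3 \<theta>(1) by (auto simp: \<rho>_def)
  have n\<rho>: "real n * \<rho> \<le> \<theta> / 16"
  proof -
    have "real n * \<rho> \<le> (real n + 1) * (\<theta> / (16 * (real n + 1)))"
      using \<rho> by (intro mult_mono) auto
    also have "\<dots> = \<theta> / 16"
      by (simp add: field_simps)
    finally show ?thesis .
  qed
  have ball_half: "y $ k < l" if "y \<in> cball xs \<rho>" for y
    using subsetD [OF e3(2), of y] that \<rho>(3) by simp
  obtain B where B: "0 \<le> B"
    "\<And>t0 t2 A. tbar \<le> t0 \<Longrightarrow> t0 < t2 \<Longrightarrow> \<delta> \<le> A \<Longrightarrow>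
      \<forall>y\<in>cball xs \<rho>. \<forall>t. t0 < t \<longrightarrow> t < t2 \<longrightarrow> (y, t) \<notin> spikes \<delta> \<Longrightarrow>
      \<forall>y\<in>cball xs \<rho>. v y t0 \<le> A \<Longrightarrow>
      \<forall>y\<in>cball xs \<rho>. v y t2 \<le> A + M * quad_cutoff xs \<rho> y + B * (t2 - t0)"
    using no_spike_emergence [OF ball_half \<rho>(1) \<delta>] by blast
  define \<eta> where "\<eta> = Min {\<rho>, e2, \<theta> / (16 * (real n + 1)), \<theta> * \<rho> / (8 * M), \<theta> / (8 * (B + 1))}"
  have \<eta>: "0 < \<eta>" "\<eta> \<le> \<rho>" "\<eta> \<le> e2" "\<eta> \<le> \<theta> / (16 * (real n + 1))" "\<eta> \<le> \<theta> * \<rho> / (8 * M)" "\<eta> \<le> \<theta> / (8 * (B + 1))"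
    using \<rho> e2 \<theta>(1) M B(1) by (auto simp: \<eta>_def)
  have n\<eta>: "real n * \<eta> \<le> \<theta> / 16"
  proof -
    have "real n * \<eta> \<le> (real n + 1) * (\<theta> / (16 * (real n + 1)))"
      using \<eta> by (intro mult_mono) auto
    also have "\<dots> = \<theta> / 16"
      by (simp add: field_simps)
    finally show ?thesis .
  qed
  obtain y r where y: "dist y xs < \<eta>" "y $ k < l" "ts \<le> r" "r < ts + \<eta>" "us + \<theta> \<le> v y r"
    using \<theta>(2) [OF \<eta>(1)] unfolding us_def by blast
  have y_ball: "y \<in> cball xs \<rho>"
    using y(1) \<eta>(2) by (simp add: dist_commute)
  have near_E: "v z a \<le> us + \<theta> / 4" if x': "(x', a) \<in> E" "x' \<in> cball xs \<rho>" "ts \<le> a" "a \<le> r" and z: "z \<in> cball xs \<rho>" for x' a z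
  proof -
    have in_V: "(x', a) \<in> V"
    proof -
      have "x' \<in> V1"
        using subsetD [OF e1(2), of x'] x'(2) \<rho>(2) by simp
      moreover have "a \<in> V2"
        using subsetD [OF e2(2), of a] x'(3,4) y(4) \<eta>(3) by (simp add: dist_real_def)
      ultimately show ?thesis
        using V12(5) by auto
    qed
    have tame_x': "(x', a) \<in> tame \<delta> T n" and tame_xs: "(xs, ts) \<in> tame \<delta> T n"
      using V(3) in_V x'(1) bad spikes_E S_eq by auto
    have "v x' ts \<le> max \<delta> (v xs ts + real n * norm (x' - xs))"
      using tame_xs ball_half [OF x'(2)] by (auto simp: tame_def)
    moreover have "real n * norm (x' - xs) \<le> real n * \<rho>"
      using x'(2) by (intro mult_left_mono) (auto simp: dist_norm norm_minus_commute)
    ultimately have 1: "v x' ts \<le> us + \<theta> / 16"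
      using n\<rho> \<theta>(1) unfolding us_def by linarith
    have aT: "a \<le> real T" and lip: "\<And>t' t''. tbar \<le> t' \<Longrightarrow> t' \<le> real T \<Longrightarrow> tbar \<le> t'' \<Longrightarrow> t'' \<le> real T \<Longrightarrow>
        \<bar>v x' t' - v x' t''\<bar> \<le> real n * \<bar>t' - t''\<bar>"
      using tame_x' unfolding tame_def by auto
    have "\<bar>v x' a - v x' ts\<bar> \<le> real n * \<bar>a - ts\<bar>"
      by (rule lip) (use aT ts x'(3) in auto)
    moreover have "real n * \<bar>a - ts\<bar> \<le> real n * \<eta>"
      using x'(3,4) y(4) by (intro mult_left_mono) auto
    ultimately have 2: "v x' a \<le> us + \<theta> / 8"
      using 1 n\<eta> by linarith
    have "v z a \<le> max \<delta> (v x' a + real n * norm (z - x'))"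
      using tame_x' ball_half [OF z] by (auto simp: tame_def)
    moreover have "real n * norm (z - x') \<le> real n * (2 * \<rho>)"
    proof (rule mult_left_mono)
      have "norm (z - x') \<le> dist xs z + dist xs x'"
        by (metis dist_commute dist_norm dist_triangle)
      then show "norm (z - x') \<le> 2 * \<rho>"
        using z x'(2) by simp
    qed simp
    ultimately show ?thesis
      using 2 n\<rho> \<theta>(1) unfolding us_def by linarith
  qed
  \<comment> \<open>The times at which the closure of the spike points meets the ball.\<close>
  define A where "A = snd ` (closure (spikes \<delta>) \<inter> (cball xs \<rho> \<times> {ts..r}))"
  have A_E: "\<exists>x'. (x', a) \<in> E \<and> x' \<in> cball xs \<rho> \<and> ts \<le> a \<and> a \<le> r" if "a \<in> A" for a
    using that ball_half by (force simp: A_def E_def U_def)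
  have "compact A"
    unfolding A_def by (intro compact_continuous_image closed_Int_compact compact_Times continuous_intros) auto
  moreover have "ts \<in> A"
  proof -
    have "(xs, ts) \<in> closure (spikes \<delta>) \<inter> (cball xs \<rho> \<times> {ts..r})"
      using bad(2) closure_subset \<rho>(1) y(3) by auto
    then show ?thesis
      unfolding A_def by force
  qed
  ultimately obtain a where a: "a \<in> A" "\<And>q. q \<in> A \<Longrightarrow> q \<le> a"
    using compact_attains_sup [of A] by auto
  obtain x' where x': "(x', a) \<in> E" "x' \<in> cball xs \<rho>" "ts \<le> a" "a \<le> r"
    using A_E [OF a(1)] by blast
  have init: "v z a \<le> us + \<theta> / 4" if "z \<in> cball xs \<rho>" for z
    using near_E [OF x' that] .
  show False
  proof (cases "a = r")
    case True
    then show False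
      using init [OF y_ball] y(5) \<theta>(1) by simp
  next
    case False
    then have ar: "a < r"
      using x' by simp
    have "\<forall>y\<in>cball xs \<rho>. v y r \<le> (us + \<theta> / 4) + M * quad_cutoff xs \<rho> y + B * (r - a)"
    proof (rule B(2) [OF _ ar])
      show "tbar \<le> a"
        using ts x' by simp
      show "\<delta> \<le> us + \<theta> / 4"
        using \<theta>(1) by (simp add: us_def)
      show "\<forall>z\<in>cball xs \<rho>. \<forall>t. a < t \<longrightarrow> t < r \<longrightarrow> (z, t) \<notin> spikes \<delta>"
      proof (intro ballI allI impI notI)
        fix z t
        assume z: "z \<in> cball xs \<rho>" "a < t" "t < r" and "(z, t) \<in> spikes \<delta>"
        then have "(z, t) \<in> closure (spikes \<delta>) \<inter> (cball xs \<rho> \<times> {ts..r})"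
          using closure_subset x' by auto
        then have "t \<in> A"
          unfolding A_def by force
        then show False
          using a(2) z by force
      qed
      show "\<forall>z\<in>cball xs \<rho>. v z a \<le> us + \<theta> / 4"
        using init by blast
    qed
    then have "v y r \<le> (us + \<theta> / 4) + M * quad_cutoff xs \<rho> y + B * (r - a)"
      using y_ball by blast
    moreover have "M * quad_cutoff xs \<rho> y \<le> \<theta> / 8"
    proof -
      have q: "norm (y - xs) / \<rho> \<le> \<eta> / \<rho>" "\<eta> / \<rho> \<le> 1"
        using y(1) \<eta>(2) \<rho>(1) by (auto simp: dist_norm divide_simps)
      have "quad_cutoff xs \<rho> y \<le> (norm (y - xs) / \<rho>)\<^sup>2"
        by (simp add: quad_cutoff_def)
      also have "\<dots> \<le> 1 * (norm (y - xs) / \<rho>)"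
        unfolding power2_eq_square using order_trans [OF q] \<rho>(1) by (intro mult_right_mono) auto
      also have "\<dots> \<le> \<eta> / \<rho>"
        using q by simp
      finally have "M * quad_cutoff xs \<rho> y \<le> M * (\<eta> / \<rho>)"
        using M by (intro mult_left_mono) auto
      also have "\<dots> \<le> \<theta> / 8"
        using \<eta>(5) M \<rho>(1) by (simp add: field_simps)
      finally show ?thesis .
    qed
    moreover have "B * (r - a) \<le> \<theta> / 8"
    proof -
      have "B * (r - a) \<le> (B + 1) * (\<theta> / (8 * (B + 1)))"
        using B(1) x' y(4) \<eta>(6) by (intro mult_mono) auto
      also have "\<dots> = \<theta> / 8"
        using B(1) by (simp add: field_simps)
      finally show ?thesis .
    qed
    ultimately show False
      using y(5) \<theta>(1) by linarith
  qed
qed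

end

section \<open>A barrier at the hyperplane and the decay of the negative part\<close>

text \<open>
  The squared distance, in the variable \<open>(l - y $ k) / \<kappa>\<close>, to the complement of the interval \<open>(-1, 1)\<close>. A squared
  distance to a set is semiconcave, and the values at both ends join without a convex corner.
\<close>

definition strip :: "'n::finite \<Rightarrow> real \<Rightarrow> real \<Rightarrow> real ^ 'n \<Rightarrow> real"
  where "strip k l \<kappa> y = (max 0 (1 - \<bar>l - y $ k\<bar> / \<kappa>))\<^sup>2"

lemma strip_bounds:
  assumes "0 < \<kappa>"
  shows "0 \<le> strip k l \<kappa> y" "strip k l \<kappa> y \<le> 1"
proof -
  show "0 \<le> strip k l \<kappa> y"
    by (simp add: strip_def)
  have "max 0 (1 - \<bar>l - y $ k\<bar> / \<kappa>) \<le> 1"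
    using assms by simp
  then show "strip k l \<kappa> y \<le> 1"
    unfolding strip_def by (rule power_le_one [rotated]) simp
qed

lemma strip_continuous: "0 < \<kappa> \<Longrightarrow> continuous_on S (strip k l \<kappa>)"
  unfolding strip_def [abs_def] by (intro continuous_intros) auto

lemma strip_eq_0: "0 < \<kappa> \<Longrightarrow> \<kappa> \<le> \<bar>l - y $ k\<bar> \<Longrightarrow> strip k l \<kappa> y = 0"
  by (simp add: strip_def)

lemma strip_ge_quarter:
  assumes "0 < \<kappa>" "\<bar>l - y $ k\<bar> \<le> \<kappa> / 2"
  shows "1 / 4 \<le> strip k l \<kappa> y"
proof -
  have "\<bar>l - y $ k\<bar> / \<kappa> \<le> 1 / 2"
    using assms by (simp add: field_simps)
  then have "1 / 2 \<le> max 0 (1 - \<bar>l - y $ k\<bar> / \<kappa>)"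
    by linarith
  then have "(1 / 2)\<^sup>2 \<le> (max 0 (1 - \<bar>l - y $ k\<bar> / \<kappa>))\<^sup>2"
    by (rule power_mono) simp
  then show ?thesis
    by (simp add: strip_def power2_eq_square)
qed

lemma unit_bump_second_difference:
  fixes \<xi> h :: real
  defines "Q \<equiv> \<lambda>\<eta>. (max 0 (1 - \<bar>\<eta>\<bar>))\<^sup>2"
  shows "Q (\<xi> + h) + Q (\<xi> - h) - 2 * Q \<xi> \<le> 2 * h\<^sup>2"
proof -
  \<comment> \<open>The nearest point of the complement of the open unit interval.\<close>
  obtain p where p: "1 \<le> \<bar>p\<bar>" "Q \<xi> = (\<xi> - p)\<^sup>2"
  proof (cases "1 \<le> \<bar>\<xi>\<bar>")
    case True
    then show ?thesis
      using that [of \<xi>] by (simp add: Q_def)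
  next
    case False
    show ?thesis
    proof (cases "0 \<le> \<xi>")
      case True
      then show ?thesis
        using that [of 1] False by (simp add: Q_def power2_commute)
    next
      case neg: False
      then show ?thesis
        using that [of "- 1"] False by (simp add: Q_def add.commute)
    qed
  qed
  have le: "Q \<eta> \<le> (\<eta> - p)\<^sup>2" for \<eta>
  proof -
    have "max 0 (1 - \<bar>\<eta>\<bar>) \<le> \<bar>\<eta> - p\<bar>"
      using p(1) by linarith
    then have "(max 0 (1 - \<bar>\<eta>\<bar>))\<^sup>2 \<le> \<bar>\<eta> - p\<bar>\<^sup>2"
      by (intro power_mono) auto
    then show ?thesis
      by (simp add: Q_def)
  qed
  have "(\<xi> + h - p)\<^sup>2 + (\<xi> - h - p)\<^sup>2 = 2 * (\<xi> - p)\<^sup>2 + 2 * h\<^sup>2"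
    by (simp add: power2_eq_square algebra_simps)
  then show ?thesis
    using le [of "\<xi> + h"] le [of "\<xi> - h"] p(2) by linarith
qed

text \<open>
  The bound depends on the distance \<open>d\<close> to the hyperplane but not on the width \<open>\<kappa>\<close>: second differences of
  the bump are of order \<open>1 / \<kappa>\<^sup>2\<close>, and they vanish for \<open>norm z < d / 2\<close> unless \<open>d < 2 * \<kappa>\<close>.
\<close>

lemma strip_second_diff:
  fixes x z :: "real ^ 'n::finite"
  assumes \<kappa>: "0 < \<kappa>" and x: "x $ k < l" and z: "norm z < (l - x $ k) / 2"
  shows "second_diff (strip k l \<kappa>) x z \<le> 8 / (l - x $ k)\<^sup>2 * (norm z)\<^sup>2"
proof -
  define d where "d = l - x $ k"
  have d: "0 < d" "norm z < d / 2"
    using x z by (auto simp: d_def)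
  have zk: "\<bar>z $ k\<bar> \<le> norm z"
    by (rule component_le_norm_cart)
  show ?thesis
  proof (cases "2 * \<kappa> \<le> d")
    case True
    have "\<kappa> \<le> \<bar>l - (x + z) $ k\<bar>" "\<kappa> \<le> \<bar>l - (x - z) $ k\<bar>" "\<kappa> \<le> \<bar>l - x $ k\<bar>"
      using True d zk \<kappa> by (auto simp: d_def)
    then have "second_diff (strip k l \<kappa>) x z = 0"
      using \<kappa> by (simp add: second_diff_def strip_eq_0)
    then show ?thesis
      by simp
  next
    case False
    define \<xi> where "\<xi> = d / \<kappa>"
    define h where "h = z $ k / \<kappa>"
    have Q: "strip k l \<kappa> y = (max 0 (1 - \<bar>(l - y $ k) / \<kappa>\<bar>))\<^sup>2" for y
      using \<kappa> by (simp add: strip_def abs_divide)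
    have "second_diff (strip k l \<kappa>) x z
        = (max 0 (1 - \<bar>\<xi> - h\<bar>))\<^sup>2 + (max 0 (1 - \<bar>\<xi> + h\<bar>))\<^sup>2 - 2 * (max 0 (1 - \<bar>\<xi>\<bar>))\<^sup>2"
    proof -
      have "(l - (x + z) $ k) / \<kappa> = \<xi> - h" "(l - (x - z) $ k) / \<kappa> = \<xi> + h" "(l - x $ k) / \<kappa> = \<xi>"
        by (auto simp: \<xi>_def h_def d_def diff_divide_distrib add_divide_distrib)
      then show ?thesis
        unfolding second_diff_def Q by simp
    qed
    also have "\<dots> \<le> 2 * h\<^sup>2"
      using unit_bump_second_difference [of \<xi> h] by simp
    also have "\<dots> = 2 * (z $ k)\<^sup>2 * (1 / \<kappa>\<^sup>2)"
      by (simp add: h_def power_divide)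
    also have "\<dots> \<le> 2 * (norm z)\<^sup>2 * (4 / d\<^sup>2)"
    proof (intro mult_mono)
      show "(z $ k)\<^sup>2 \<le> (norm z)\<^sup>2"
        using zk by (rule power2_le_iff_abs_le [THEN iffD2, rotated]) simp
      have "(d / 2)\<^sup>2 \<le> \<kappa>\<^sup>2"
        using False d by (intro power_mono) auto
      then show "1 / \<kappa>\<^sup>2 \<le> 4 / d\<^sup>2"
        using d \<kappa> by (simp add: field_simps power_divide)
    qed auto
    finally show ?thesis
      by (simp add: d_def)
  qed
qed

lemma trunc_diffusion_half_space_sign:
  fixes x :: "real ^ 'n::finite"
  assumes s: "0 < s" and x: "x $ k < l" and \<epsilon>: "0 < \<epsilon>" "\<epsilon> < l - x $ k"
    and c: "b \<le> (LINT z::real ^ 'n|lborel. indicator {z. l - x $ k \<le> z $ k} z * kernel s z)"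
  shows "trunc_diffusion s (\<lambda>y. if y $ k < l then 1 else - 1) x \<epsilon> \<le> - 2 * b"
proof -
  define d where "d = l - x $ k"
  have m: "(\<lambda>z::real ^ 'n. indicator {z. d \<le> z $ k} z * kernel s z) \<in> borel_measurable lborel"
    by measurable
  have m': "(\<lambda>y. indicator {y::real ^ 'n. l \<le> y $ k} y * kernel s (x - y)) \<in> borel_measurable lebesgue"
  proof -
    have "(\<lambda>y. indicator {y::real ^ 'n. l \<le> y $ k} y * kernel s (x - y)) \<in> borel_measurable borel"
      by measurable
    then show ?thesis
      by (simp add: measurable_completion)
  qed
  have "trunc_diffusion s (\<lambda>y. if y $ k < l then 1 else - 1) x \<epsilon>
      = (LINT y|lebesgue. - 2 * (indicator {y. l \<le> y $ k} y * kernel s (x - y)))"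
    unfolding trunc_diffusion_def
  proof (rule Bochner_Integration.integral_cong)
    fix y :: "real ^ 'n"
    have "y \<in> - ball x \<epsilon>" if "l \<le> y $ k"
      using that component_le_norm_cart [of "x - y" k] \<epsilon> by (auto simp: dist_norm)
    then show "indicator (- ball x \<epsilon>) y * (((if y $ k < l then 1 else - 1) - (if x $ k < l then 1 else - 1)) * kernel s (x - y))
        = - 2 * (indicator {y. l \<le> y $ k} y * kernel s (x - y))"
      using x by (auto simp: not_less)
  qed simp
  also have "\<dots> = - 2 * (LINT y|lebesgue. indicator {y. l \<le> y $ k} y * kernel s (x - y))"
    by simp
  also have "(LINT y|lebesgue. indicator {y. l \<le> y $ k} y * kernel s (x - y))
      = (LINT z|lebesgue. indicator {y. l \<le> y $ k} (x + z) * kernel s (x - (x + z)))"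
    by (rule lebesgue_preserving_integral [symmetric, OF lebesgue_preserving_translation m'])
  also have "\<dots> = (LINT z|lebesgue. indicator {z. d \<le> z $ k} z * kernel s z)"
    by (rule Bochner_Integration.integral_cong) (auto simp: indicator_def d_def)
  also have "\<dots> = (LINT z|lborel. indicator {z. d \<le> z $ k} z * kernel s z)"
    by (rule integral_completion [OF m])
  finally show ?thesis
    using c by (simp add: d_def)
qed

text \<open>
  At distance \<open>d\<close> from the hyperplane, the antisymmetric constant loses a multiple of \<open>d powr (- 2 * s)\<close> by its jump, and
  the bump gains at most another multiple of the same power, independently of \<open>\<kappa>\<close>.
\<close>

lemma barrier_constant:
  fixes k :: "'n::finite"
  assumes s: "0 < s" "s < 1"
  obtains \<beta> where "0 < \<beta>" "\<And>(x :: real ^ 'n) l \<kappa> \<epsilon>. x $ k < l \<Longrightarrow> 0 < \<kappa> \<Longrightarrow> 0 < \<epsilon> \<Longrightarrow> \<epsilon> < (l - x $ k) / 2 \<Longrightarrow>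
    trunc_diffusion s (\<lambda>y. if y $ k < l then 1 else - 1) x \<epsilon> + \<beta> * trunc_diffusion s (strip k l \<kappa>) x \<epsilon> \<le> 0"
proof -
  obtain c1 where c1: "0 \<le> c1"
    "\<And>r. 0 < r \<Longrightarrow> integrable lborel (\<lambda>z::real ^ 'n. indicator (- ball 0 r) z * kernel s z)"
    "\<And>r. 0 < r \<Longrightarrow> (LINT z::real ^ 'n|lborel. indicator (- ball 0 r) z * kernel s z) \<le> c1 * r powr (- 2 * s)"
    by (rule kernel_tail_bound [OF s(1)], rule that)
  obtain c2 where c2: "0 \<le> c2"
    "\<And>r. 0 < r \<Longrightarrow> integrable lborel (\<lambda>z::real ^ 'n. indicator (ball 0 r) z * ((norm z)\<^sup>2 * kernel s z))"
    "\<And>r. 0 < r \<Longrightarrow> (LINT z::real ^ 'n|lborel. indicator (ball 0 r) z * ((norm z)\<^sup>2 * kernel s z)) \<le> c2 * r powr (2 - 2 * s)"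
    by (rule kernel_near_bound [OF s(2,1)], rule that)
  obtain c3 where c3: "0 < c3"
    "\<And>d. 0 < d \<Longrightarrow> c3 * d powr (- 2 * s) \<le> (LINT z::real ^ 'n|lborel. indicator {z. d \<le> z $ k} z * kernel s z)"
    by (rule kernel_half_space_bound [OF s(1)], rule that)
  define K where "K = (c2 + c1) * 2 powr (2 * s)"
  have K0: "0 \<le> K"
    using c1(1) c2(1) by (simp add: K_def)
  define \<beta> where "\<beta> = 2 * c3 / (K + 1)"
  have \<beta>: "0 < \<beta>"
    using c3(1) K0 by (simp add: \<beta>_def)
  have "trunc_diffusion s (\<lambda>y. if y $ k < l then 1 else - 1) x \<epsilon> + \<beta> * trunc_diffusion s (strip k l \<kappa>) x \<epsilon> \<le> 0"
    if x: "x $ k < l" and \<kappa>: "0 < \<kappa>" and \<epsilon>: "0 < \<epsilon>" "\<epsilon> < (l - x $ k) / 2" for x :: "real ^ 'n" and l \<kappa> \<epsilon>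
  proof -
    define d where "d = l - x $ k"
    have d: "0 < d"
      using x by (simp add: d_def)
    define D where "D = d powr (- 2 * s)"
    have D0: "0 < D"
      using d by (simp add: D_def)
    have 1: "trunc_diffusion s (\<lambda>y. if y $ k < l then 1 else - 1) x \<epsilon> \<le> - 2 * (c3 * D)"
      by (rule trunc_diffusion_half_space_sign [OF s(1) x \<epsilon>(1)])
        (use c3(2) [OF d] \<epsilon> d in \<open>auto simp: d_def D_def\<close>)
    have int: "tail_integrable s (strip k l \<kappa>)"
    proof (rule tail_integrable_continuous_bounded [OF s(1) strip_continuous [OF \<kappa>]])
      show "\<bar>strip k l \<kappa> y\<bar> \<le> 1" for y
        using strip_bounds [OF \<kappa>, of k l y] by simp
    qed
    have half: "0 < d / 2" "\<epsilon> \<le> d / 2"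
      using d \<epsilon> by (auto simp: d_def)
    have "trunc_diffusion s (strip k l \<kappa>) x \<epsilon>
        \<le> 8 / d\<^sup>2 * (c2 * (d / 2) powr (2 - 2 * s)) / 2 + trunc_diffusion s (strip k l \<kappa>) x (d / 2)"
      by (rule trunc_diffusion_near_le [OF s(1) int \<epsilon>(1) half(2) _ _ c2(2,3) [OF half(1)]])
        (use strip_second_diff [OF \<kappa> x] in \<open>auto simp: d_def\<close>)
    also have "8 / d\<^sup>2 * (c2 * (d / 2) powr (2 - 2 * s)) / 2 = c2 * (d / 2) powr (- 2 * s)"
    proof -
      have "(d / 2) powr (2 - 2 * s) = (d / 2) powr 2 * (d / 2) powr (- 2 * s)"
        by (simp flip: powr_add)
      also have "(d / 2) powr 2 = d\<^sup>2 / 4"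
        using d by (simp add: power_divide)
      finally have eq: "(d / 2) powr (2 - 2 * s) = d\<^sup>2 / 4 * (d / 2) powr (- 2 * s)" .
      show ?thesis
        unfolding eq using d by simp
    qed
    also have "trunc_diffusion s (strip k l \<kappa>) x (d / 2) \<le> 1 * (c1 * (d / 2) powr (- 2 * s))"
    proof (rule trunc_diffusion_far_le [OF s(1) int half(1) _ _ c1(3) [OF half(1)]])
      show "strip k l \<kappa> y \<le> strip k l \<kappa> x + 1" for y
        using strip_bounds(2) [OF \<kappa>, of k l y] strip_bounds(1) [OF \<kappa>, of k l x] by linarith
    qed simp
    finally have 2: "trunc_diffusion s (strip k l \<kappa>) x \<epsilon> \<le> (c2 + c1) * (d / 2) powr (- 2 * s)"
      by (simp add: algebra_simps)
    have "(d / 2) powr (- 2 * s) = 2 powr (2 * s) * D"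
    proof -
      have "(d / 2) powr (- 2 * s) = d powr (- 2 * s) / 2 powr (- 2 * s)"
        by (rule powr_divide)
      also have "2 powr (- 2 * s) = 1 / 2 powr (2 * s)"
        using powr_minus_divide [of 2 "2 * s"] by simp
      finally show ?thesis
        by (simp add: D_def)
    qed
    with 2 have 3: "trunc_diffusion s (strip k l \<kappa>) x \<epsilon> \<le> K * D"
      by (simp add: K_def mult.assoc)
    have "\<beta> * trunc_diffusion s (strip k l \<kappa>) x \<epsilon> \<le> \<beta> * ((K + 1) * D)"
      using 3 \<beta> D0 by (intro mult_left_mono) (auto simp: algebra_simps)
    also have "\<dots> = 2 * (c3 * D)"
      using K0 by (simp add: \<beta>_def)
    finally show ?thesis
      using 1 by linarith
  qed
  then show ?thesis
    using that [OF \<beta>] by blast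
qed

context half_space_supersolution
begin

text \<open>
  The barrier is \<open>h y r = \<Theta> r * (1 + \<beta> * strip k l \<kappa> y)\<close> with the antisymmetric extension of its constant part. Off
  the compact set \<open>D\<close> it lies above \<open>v\<close> because of the bump or because of the behaviour of \<open>w\<close> at infinity. The
  width \<open>\<kappa>\<close> is the distance of the given point \<open>x\<close> from the hyperplane, so that the bump vanishes at \<open>x\<close>.
\<close>

lemma improved_bound:
  assumes \<beta>: "0 < \<beta>" "\<And>(x :: real ^ 'n) l \<kappa> \<epsilon>. x $ k < l \<Longrightarrow> 0 < \<kappa> \<Longrightarrow> 0 < \<epsilon> \<Longrightarrow> \<epsilon> < (l - x $ k) / 2 \<Longrightarrow>
    trunc_diffusion s (\<lambda>y. if y $ k < l then 1 else - 1) x \<epsilon> + \<beta> * trunc_diffusion s (strip k l \<kappa>) x \<epsilon> \<le> 0"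
    and infinity: "\<And>e. 0 < e \<Longrightarrow> \<exists>R. \<forall>x\<in>\<Omega>. \<forall>t\<ge>tbar. R \<le> norm x \<longrightarrow> - e < w x t"
    and t0: "tbar \<le> t0" and m: "0 < m" and bound: "\<And>x t. x $ k < l \<Longrightarrow> t0 \<le> t \<Longrightarrow> v x t \<le> m"
    and x: "x $ k < l" and t: "t0 \<le> t"
  shows "v x t \<le> m / (1 + \<beta> / 4) + (m - m / (1 + \<beta> / 4)) * exp (- \<sigma> * (t - t0))"
proof -
  define m' where "m' = m / (1 + \<beta> / 4)"
  have m': "0 < m'" "m' * (1 + \<beta> / 4) = m" "m' \<le> m"
  proof -
    show "0 < m'" "m' * (1 + \<beta> / 4) = m"
      using m \<beta>(1) by (auto simp: m'_def)
    then show "m' \<le> m"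
      using mult_left_mono [of 1 "1 + \<beta> / 4" m'] \<beta>(1) by simp
  qed
  define \<Theta> where "\<Theta> r = m' + (m - m') * exp (- \<sigma> * (r - t0))" for r
  have \<Theta>_ge: "m' \<le> \<Theta> r" for r
    using m' by (simp add: \<Theta>_def)
  have \<Theta>_pos: "0 < \<Theta> r" for r
    using \<Theta>_ge [of r] m' by linarith
  define \<kappa> where "\<kappa> = l - x $ k"
  have \<kappa>: "0 < \<kappa>"
    using x by (simp add: \<kappa>_def)
  obtain R0 where R0: "\<And>y r. y \<in> \<Omega> \<Longrightarrow> tbar \<le> r \<Longrightarrow> R0 \<le> norm y \<Longrightarrow> - m' < w y r"
    using infinity [OF m'(1)] by blast
  define R where "R = max R0 (norm x)"
  define D where "D = {y::real ^ 'n. y $ k \<le> l - \<kappa> / 2} \<inter> cball 0 R"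
  have D_half: "y $ k < l" if "y \<in> D" for y
    using that \<kappa> by (simp add: D_def)
  define q where "q y = 1 + \<beta> * strip k l \<kappa> y" for y
  have q: "1 \<le> q y" "q y \<le> 1 + \<beta>" for y
    using \<beta>(1) strip_bounds [OF \<kappa>, of k l y] mult_left_mono [of "strip k l \<kappa> y" 1 \<beta>] by (auto simp: q_def)
  have q_cont: "continuous_on S q" for S
    unfolding q_def [abs_def] by (intro continuous_intros strip_continuous \<kappa>)
  define h where "h y r = \<Theta> r * q y" for y r
  have h_ge: "m' \<le> h y r" "\<Theta> r \<le> h y r" for y r
  proof -
    have "\<Theta> r * 1 \<le> \<Theta> r * q y"
      using q(1) [of y] \<Theta>_pos [of r] by (intro mult_left_mono) auto
    then show "m' \<le> h y r" "\<Theta> r \<le> h y r"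
      using \<Theta>_ge [of r] unfolding h_def by linarith+
  qed
  have off_D: "v y r \<le> h y r" if y: "y $ k < l" "y \<notin> D" and r: "t0 \<le> r" for y r
  proof (cases "y $ k \<le> l - \<kappa> / 2")
    case True
    then have "R0 \<le> norm y"
      using y(2) by (auto simp: D_def R_def)
    then have "v y r \<le> m'"
      using R0 [of y r] v_posD [OF y(1), of r] t0 r m' by (cases "0 < v y r") auto
    then show ?thesis
      using h_ge(1) [of y r] by linarith
  next
    case False
    then have "1 / 4 \<le> strip k l \<kappa> y"
      using y(1) by (intro strip_ge_quarter \<kappa>) auto
    then have "1 + \<beta> / 4 \<le> q y"
      using mult_left_mono [of "1 / 4" "strip k l \<kappa> y" \<beta>] \<beta>(1) by (simp add: q_def)
    then have "m' * (1 + \<beta> / 4) \<le> \<Theta> r * q y"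
      using \<Theta>_ge [of r] \<Theta>_pos [of r] \<beta>(1) by (intro mult_mono) auto
    then show ?thesis
      using bound [OF y(1) r] m'(2) by (simp add: h_def)
  qed
  have "v x t - h x t \<le> 0"
  proof (rule right_usc_comparison [of D t0 t "\<lambda>y r. v y r - h y r"])
    show "compact D"
      unfolding D_def by (intro closed_Int_compact closed_halfspace_component_le_cart) auto
    show "continuous_on D (\<lambda>y. v y r - h y r)" if "t0 \<le> r" for r
    proof (intro continuous_on_diff)
      show "continuous_on D (\<lambda>y. v y r)"
        using v_continuous_on [of r] that t0 D_half by (auto intro: continuous_on_subset)
      show "continuous_on D (\<lambda>y. h y r)"
        unfolding h_def by (intro continuous_intros q_cont)
    qed
    show "v y t0 - h y t0 \<le> 0" if "y \<in> D" for y
      using bound [OF D_half [OF that], of t0] h_ge(2) [of t0 y] by (simp add: \<Theta>_def)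
  next
    fix y r X S \<gamma>
    assume y: "y \<in> D" and r: "t0 \<le> r" and X: "\<And>i. X i \<in> D" "X \<longlonglongrightarrow> y"
      and S: "\<And>i::nat. r < S i" "S \<longlonglongrightarrow> r" and \<gamma>: "0 < \<gamma>" "\<And>i. \<gamma> \<le> v (X i) (S i) - h (X i) (S i)"
    show "\<gamma> \<le> v y r - h y r"
    proof (rule right_usc_off_spikes [where \<delta> = m', OF _ D_half [OF y] _ _ X(2) S _ h_ge(1) \<gamma>])
      show "(y, r) \<notin> spikes m'"
        using no_spikes [OF m'(1)] by simp
      show "(\<lambda>i. h (X i) (S i)) \<longlonglongrightarrow> h y r"
        unfolding h_def \<Theta>_def
        by (intro tendsto_intros S(2) continuous_on_tendsto_compose [OF q_cont [of UNIV] X(2)]) auto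
    qed (use X D_half r t0 in auto)
  next
    fix y r
    assume y: "y \<in> D" and r: "t0 < r" and pos: "0 < v y r - h y r"
      and mx: "\<And>z. z \<in> D \<Longrightarrow> v z r - h z r \<le> v y r - h y r"
    define G where "G z = (if z $ k < l then 1 else - 1 :: real)" for z :: "real ^ 'n"
    define H where "H z = \<Theta> r * (G z + \<beta> * strip k l \<kappa> z)" for z
    have H_eq: "H z = h z r" if "z $ k < l" for z
      using that by (simp add: H_def G_def h_def q_def)
    have G_int: "tail_integrable s G"
    proof (rule tail_integrable_bounded [OF s(1)])
      have "G \<in> borel_measurable borel"
        unfolding G_def [abs_def] by measurable
      then show "G \<in> borel_measurable lebesgue"
        by (simp add: measurable_completion)
      show "\<bar>G z\<bar> \<le> 1" for z
        by (simp add: G_def)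
    qed
    have B_int: "tail_integrable s (\<lambda>z. 0 + \<beta> * strip k l \<kappa> z)"
    proof (rule tail_integrable_continuous_bounded [OF s(1)])
      show "\<bar>0 + \<beta> * strip k l \<kappa> z\<bar> \<le> \<beta>" for z
        using q [of z] by (simp add: q_def)
    qed (intro continuous_intros strip_continuous \<kappa>)
    have GB_int: "tail_integrable s (\<lambda>z. G z + (0 + \<beta> * strip k l \<kappa> z))"
      by (rule tail_integrable_add [OF G_int B_int])
    have H_int: "tail_integrable s H"
      using tail_integrable_mult [OF GB_int, of "\<Theta> r"] by (simp add: H_def [abs_def])
    have y_half: "y $ k < l"
      using y by (rule D_half)
    have "\<exists>\<eta>>0. \<forall>r'. r - \<eta> < r' \<and> r' < r \<and> tbar \<le> r' \<longrightarrow> v y r - h y r < v y r' - h y r'"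
    proof (rule decrease_at_touching_point [where H = H and b = 0, OF y_half _ H_int])
      show "tbar < r"
        using t0 r by simp
      show "0 \<le> H z + H (reflect k l z)" if "z $ k < l" for z
      proof -
        have "H z + H (reflect k l z) = \<Theta> r * (\<beta> * strip k l \<kappa> z + \<beta> * strip k l \<kappa> (reflect k l z))"
          using that by (simp add: H_def G_def algebra_simps)
        then show ?thesis
          using \<Theta>_pos [of r] \<beta>(1) strip_bounds(1) [OF \<kappa>, of k l] by simp
      qed
      show "0 \<le> H y" "H y < v y r"
        using h_ge(1) [of y r] m' pos by (auto simp: H_eq [OF y_half])
      show "v z r - H z \<le> v y r - H y" if z: "z $ k < l" for z
        unfolding H_eq [OF z] H_eq [OF y_half]
        using mx [of z] off_D [OF z, of r] pos r by (cases "z \<in> D") auto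
      show "0 < (l - y $ k) / 2"
        using y_half by simp
      show "trunc_diffusion s H y \<epsilon> \<le> 0" if \<epsilon>: "0 < \<epsilon>" "\<epsilon> < (l - y $ k) / 2" for \<epsilon>
      proof -
        have "trunc_diffusion s H y \<epsilon> = \<Theta> r * trunc_diffusion s (\<lambda>z. G z + (0 + \<beta> * strip k l \<kappa> z)) y \<epsilon>"
          using trunc_diffusion_affine [of s 0 "\<Theta> r" "\<lambda>z. G z + (0 + \<beta> * strip k l \<kappa> z)" y \<epsilon>]
          by (simp add: H_def [abs_def])
        also have "trunc_diffusion s (\<lambda>z. G z + (0 + \<beta> * strip k l \<kappa> z)) y \<epsilon>
            = trunc_diffusion s G y \<epsilon> + \<beta> * trunc_diffusion s (strip k l \<kappa>) y \<epsilon>"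
          unfolding trunc_diffusion_add [OF s(1) G_int B_int \<epsilon>(1)] trunc_diffusion_affine ..
        also have "\<Theta> r * \<dots> \<le> \<Theta> r * 0"
          using \<beta>(2) [OF y_half \<kappa> \<epsilon>] \<Theta>_pos [of r] unfolding G_def [abs_def] by (intro mult_left_mono) auto
        finally show ?thesis
          by simp
      qed
      show "((\<lambda>r. h y r) has_real_derivative (- \<sigma> * (m - m') * exp (- \<sigma> * (r - t0)) * q y)) (at r)"
        unfolding h_def \<Theta>_def by (auto intro!: derivative_eq_intros)
      have "(m - m') * exp (- \<sigma> * (r - t0)) * q y \<le> h y r"
        using m' q(1) [of y] by (simp add: h_def \<Theta>_def algebra_simps)
      also have "\<dots> \<le> v y r"
        using pos by simp
      finally have "\<sigma> * ((m - m') * exp (- \<sigma> * (r - t0)) * q y) \<le> \<sigma> * v y r"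
        using \<sigma> by (intro mult_left_mono) auto
      then show "C * 0 - \<sigma> * v y r \<le> - \<sigma> * (m - m') * exp (- \<sigma> * (r - t0)) * q y"
        by (simp add: mult.assoc)
    qed
    then show "\<exists>\<eta>>0. \<forall>r'. r - \<eta> < r' \<and> r' < r \<and> t0 \<le> r' \<longrightarrow> v y r - h y r < v y r' - h y r'"
      using t0 by (meson order_trans)
  next
    have "x $ k \<le> l - \<kappa> / (2::real)"
      using x by (simp add: \<kappa>_def field_simps)
    then show "x \<in> D"
      by (simp add: D_def R_def)
  qed (use t in auto)
  moreover have "h x t = \<Theta> t"
    using strip_eq_0 [OF \<kappa>, of l x k] by (simp add: h_def q_def \<kappa>_def)
  ultimately show ?thesis
    by (simp add: \<Theta>_def m'_def)
qed

lemma negative_part_vanishes: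
  assumes infinity: "\<And>e. 0 < e \<Longrightarrow> \<exists>R. \<forall>x\<in>\<Omega>. \<forall>t\<ge>tbar. R \<le> norm x \<longrightarrow> - e < w x t"
    and e: "0 < e"
  shows "\<exists>t0\<ge>tbar. \<forall>x t. x $ k < l \<longrightarrow> t0 \<le> t \<longrightarrow> v x t < e"
proof -
  obtain \<beta> where \<beta>: "0 < \<beta>" "\<And>(x :: real ^ 'n) l \<kappa> \<epsilon>. x $ k < l \<Longrightarrow> 0 < \<kappa> \<Longrightarrow> 0 < \<epsilon> \<Longrightarrow> \<epsilon> < (l - x $ k) / 2 \<Longrightarrow>
    trunc_diffusion s (\<lambda>y. if y $ k < l then 1 else - 1) x \<epsilon> + \<beta> * trunc_diffusion s (strip k l \<kappa>) x \<epsilon> \<le> 0"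
    using barrier_constant [OF s, of k] by blast
  \<comment> \<open>The factor of \<open>improved_bound\<close> at time \<open>ln 2 / \<sigma>\<close> after the start, where the exponential is \<open>1 / 2\<close>.\<close>
  define \<gamma> where "\<gamma> = (1 / (1 + \<beta> / 4) + 1) / 2"
  have \<gamma>: "0 < \<gamma>" "\<gamma> < 1"
    using \<beta>(1) by (auto simp: \<gamma>_def field_simps)
  have decay: "\<exists>t0\<ge>tbar. \<forall>x t. x $ k < l \<longrightarrow> t0 \<le> t \<longrightarrow> v x t \<le> M * \<gamma> ^ j" for j
  proof (induction j)
    case 0
    show ?case
      using v_le_M by (intro exI [of _ tbar]) auto
  next
    case (Suc j)
    then obtain t0 where t0: "tbar \<le> t0" "\<And>x t. x $ k < l \<Longrightarrow> t0 \<le> t \<Longrightarrow> v x t \<le> M * \<gamma> ^ j"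
      by blast
    define m where "m = M * \<gamma> ^ j"
    have m: "0 < m"
      using M \<gamma> by (simp add: m_def)
    define t1 where "t1 = t0 + ln 2 / \<sigma>"
    have t1: "t0 \<le> t1"
      using \<sigma> by (simp add: t1_def)
    have "v x t \<le> M * \<gamma> ^ Suc j" if x: "x $ k < l" and t: "t1 \<le> t" for x t
    proof -
      have "v x t \<le> m / (1 + \<beta> / 4) + (m - m / (1 + \<beta> / 4)) * exp (- \<sigma> * (t - t0))"
        by (rule improved_bound [OF \<beta> infinity t0(1) m _ x]) (use t0(2) t t1 in \<open>auto simp: m_def\<close>)
      also have "\<dots> \<le> m / (1 + \<beta> / 4) + (m - m / (1 + \<beta> / 4)) * (1 / 2)"
      proof (intro add_left_mono mult_left_mono)
        have "ln 2 \<le> \<sigma> * (t - t0)"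
          using t \<sigma> by (simp add: t1_def field_simps)
        then have "exp (- \<sigma> * (t - t0)) \<le> exp (- ln 2)"
          by simp
        then show "exp (- \<sigma> * (t - t0)) \<le> 1 / 2"
          by (simp add: exp_minus)
        have "m / (1 + \<beta> / 4) \<le> m / 1"
          using m \<beta>(1) by (intro divide_left_mono) auto
        then show "0 \<le> m - m / (1 + \<beta> / 4)"
          by simp
      qed
      also have "\<dots> = m * \<gamma>"
      proof -
        define u where "u = inverse (1 + \<beta> / 4)"
        have "m / (1 + \<beta> / 4) = m * u" and "\<gamma> = (u + 1) / 2"
          unfolding u_def \<gamma>_def divide_inverse by simp_all
        moreover have "m * u + (m - m * u) * (1 / 2) = m * ((u + 1) / 2)"
          by (simp add: field_simps)
        ultimately show ?thesis
          by presburger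
      qed
      finally show ?thesis
        by (simp add: m_def mult_ac)
    qed
    then show ?case
      using t0(1) t1 by (intro exI [of _ t1]) auto
  qed
  have "(\<lambda>j. M * \<gamma> ^ j) \<longlonglongrightarrow> M * 0"
    using \<gamma> by (intro tendsto_intros LIMSEQ_realpow_zero) auto
  then have "\<forall>\<^sub>F j in sequentially. M * \<gamma> ^ j < e"
    using e by (intro order_tendstoD(2)) auto
  then obtain j where j: "M * \<gamma> ^ j < e"
    using eventually_happens' [OF sequentially_bot] by blast
  show ?thesis
    using decay [of j] j by (meson le_less_trans)
qed

end

theorem theorem4:
  fixes k :: "'n::finite"
    and s l tbar \<sigma> :: real
    and \<Omega> :: "(real ^ 'n) set"
    and w c :: "real ^ 'n \<Rightarrow> real \<Rightarrow> real"
  assumes s: "0 < s" "s < 1"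
    and domain: "open \<Omega>" "connected \<Omega>" "\<not> bounded \<Omega>" "\<Omega> \<subseteq> half_space k l"
    and w_space: "\<forall>t\<ge>tbar. C11_loc \<Omega> (\<lambda>x. w x t) \<and> L_2s s (\<lambda>x. w x t)"
    and w_time: "\<forall>x. C1_on {tbar..} (w x)"
    and w_bounded: "\<exists>M. \<forall>x\<in>closure \<Omega>. \<forall>t\<ge>tbar. \<bar>w x t\<bar> \<le> M"
    and w_lsc: "\<forall>t\<ge>tbar. lower_semicont_on (closure \<Omega>) (\<lambda>x. w x t)"
    and equation: "\<forall>x\<in>\<Omega>. \<forall>t\<ge>tbar.
      vector_derivative (w x) (at t within {tbar..}) + frac_laplacian s (\<lambda>y. w y t) x
        = c x t * w x t"
    and exterior: "\<forall>x\<in>half_space k l - \<Omega>. \<forall>t\<ge>tbar. w x t \<ge> 0"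
    and antisym: "\<forall>x\<in>half_space k l. \<forall>t\<ge>tbar. w x t = - w (reflect k l x) t"
    and \<sigma>: "\<sigma> > 0"
    and c_neg: "\<forall>x\<in>\<Omega>. \<forall>t\<ge>tbar. w x t < 0 \<longrightarrow> c x t < - \<sigma>"
    and at_infinity: "\<forall>\<epsilon>>0. \<exists>R. \<forall>x\<in>\<Omega>. \<forall>t\<ge>tbar. norm x \<ge> R \<longrightarrow> w x t > - \<epsilon>"
  shows "\<forall>x\<in>\<Omega>. Liminf at_top (\<lambda>t. ereal (w x t)) \<ge> 0"
proof
  fix x
  assume x: "x \<in> \<Omega>"
  obtain M0 where M0: "\<And>x t. x \<in> closure \<Omega> \<Longrightarrow> tbar \<le> t \<Longrightarrow> \<bar>w x t\<bar> \<le> M0"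
    using w_bounded by blast
  interpret half_space_supersolution k s l tbar \<sigma> "max 1 M0" "frac_const CARD('n) s" \<Omega> w c
  proof
    show "- max 1 M0 \<le> w x t" if "x \<in> \<Omega>" "tbar \<le> t" for x t
    proof -
      have "x \<in> closure \<Omega>"
        using that(1) closure_subset by blast
      from M0 [OF this that(2)] show ?thesis
        by linarith
    qed
  qed (use s domain w_space w_time w_lsc equation exterior antisym \<sigma> c_neg in auto)
  have xk: "x $ k < l"
    using x domain(4) by (auto simp: half_space_def)
  show "0 \<le> Liminf at_top (\<lambda>t. ereal (w x t))"
    unfolding le_Liminf_iff
  proof (intro allI impI)
    fix b :: ereal
    assume "b < 0"
    then obtain e where e: "b < ereal (- e)" "0 < e"
      by (metis ereal_dense2 less_ereal.simps(1) neg_0_less_iff_less minus_minus zero_ereal_def)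
    obtain t0 where t0: "tbar \<le> t0" "\<And>x t. x $ k < l \<Longrightarrow> t0 \<le> t \<Longrightarrow> v x t < e"
      using negative_part_vanishes [OF _ e(2)] at_infinity by metis
    show "\<forall>\<^sub>F t in at_top. b < ereal (w x t)"
      unfolding eventually_at_top_linorder
    proof (intro exI [of _ t0] allI impI)
      fix t
      assume "t0 \<le> t"
      then have "- e < w x t"
        using t0(2) [OF xk, of t] by (simp add: v_def)
      then show "b < ereal (w x t)"
        using e(1) by (meson ereal_less(2) less_ereal.simps(1) order_less_trans)
    qed
  qed
qed

end
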